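(* (Quasiconvexity at the boundary.) Suppose that $\mathbf{n}\in\mathcal{A}\cap C^1(\overline{\Omega},M)$ is a strong local minimizer of $I$, and let $\nu(x)$ denote the exterior unit normal to $\Omega$ at a point $x$. Then, for $\mathcal{H}^{d-1}$-a.e. $x\in\partial\Omega_2$ at which $\partial\Omega_2$ is locally $C^1$, $$F\big(x,\mathbf{n}(x),\nabla\mathbf{n}(x)\big)\leqslant\frac{1}{|\mathbf{B}^-_{\nu(x)}|}\int_{\mathbf{B}^-_{\nu(x)}}F\big(x,\mathbf{n}(x),\nabla\mathbf{n}(x)+\nabla P(\mathbf{n}(x))\nabla\boldsymbol{\phi}(y)\big)\,dy$$ for all $\boldsymbol{\phi}\in W^{1,\infty}(\mathbf{B}^-_{\nu(x)},\mathbb{R}^k)$ with $\boldsymbol{\phi}=0$ on $\partial\mathbf{B}\cap\partial\mathbf{B}^-_{\nu(x)}$, where $\mathbf{B}^-_{\nu(x)}=\{y\in\mathbf{B}: y\cdot\nu(x)<0\}$ and $\mathbf{B}$ is the unit ball of $\mathbb{R}^d$.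
   Context: $\Omega\subset\mathbb{R}^d$ is a bounded Lipschitz domain whose boundary has two disjoint, relatively open, measurable components $\partial\Omega_1,\partial\Omega_2$ with $\partial\Omega=\overline{\partial\Omega_1}\cup\overline{\partial\Omega_2}$. $M\subset\mathbb{R}^k$ is a closed, bounded manifold of class $C^4$. There is an open set $U\supset M$ on which the nearest point projection $P:U\to M$ is uniquely defined and of class $C^3$; $\nabla P$ denotes its $k\times k$ derivative matrix, and $\nabla P(\mathbf{n}(x))\nabla\boldsymbol{\phi}(y)$ is a matrix product. $W^{1,1}(\Omega,M)=\{\mathbf{n}\in W^{1,1}(\Omega,\mathbb{R}^k): \mathbf{n}(x)\in M\text{ a.e.}\}$. Given $\mathbf{n}_0\in W^{1,1}(\Omega,M)$, the admissible set is $\mathcal{A}=\{\mathbf{n}\in W^{1,1}(\Omega,M):\mathbf{n}=\mathbf{n}_0\text{ on }\partial\Omega_1\}$ (so $\partial\Omega_2$ is the free boundary). The functional is $I(\mathbf{n})=\int_\Omega F(x,\mathbf{n}(x),\nabla\mathbf{n}(x))\,dx$, where for this result the Lagrangian is only assumed to satisfy $F\in C(\overline{\Omega}\times M\times\mathbb{R}^{k\times d})$ (no differentiability). $\mathbf{n}\in\mathcal{A}$ is a strong local minimizer of $I$ if there is $\epsilon>0$ such that $I(\mathbf{m})\geqslant I(\mathbf{n})$ for all $\mathbf{m}\in\mathcal{A}$ with $\|\mathbf{n}-\mathbf{m}\|_\infty<\epsilon$. $\mathcal{H}^{d-1}$ is $(d-1)$-dimensional Hausdorff measure and $|\cdot|$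 of a set is Lebesgue measure. *)

theory Defs
  imports "HOL-Analysis.Analysis" "HOL-Probability.Essential_Supremum"
begin

fun higher_differentiable_on ::
    "nat \<Rightarrow> ('a::real_normed_vector \<Rightarrow> 'b::real_normed_vector) \<Rightarrow> 'a set \<Rightarrow> bool" where
  "higher_differentiable_on 0 f S \<longleftrightarrow> continuous_on S f"
| "higher_differentiable_on (Suc r) f S \<longleftrightarrow>
     (\<forall>x\<in>S. f differentiable (at x)) \<and>
     (\<forall>v. higher_differentiable_on r (\<lambda>x. frechet_derivative f (at x) v) S)"

text \<open>The function \<open>u\<close> belongs to C^1 of the closure of \<open>\<Omega>\<close> and \<open>Du\<close> is its gradient: on
  \<open>\<Omega>\<close> it is the classical one, on the boundary it is the continuous extension.\<close>

definition C1_closure_gradient ::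
    "(real^'d) set \<Rightarrow> (real^'d \<Rightarrow> real^'k) \<Rightarrow> (real^'d \<Rightarrow> real^'d^'k) \<Rightarrow> bool" where
  "C1_closure_gradient \<Omega> u Du \<longleftrightarrow>
     continuous_on (closure \<Omega>) u \<and> continuous_on (closure \<Omega>) Du \<and>
     (\<forall>x\<in>\<Omega>. (u has_derivative (\<lambda>h. Du x *v h)) (at x))"

text \<open>The case distinction makes the empty set contribute 0 also for \<open>s = 0\<close>, while
  points then contribute 1 (counting measure).\<close>

definition hausdorff_content :: "nat \<Rightarrow> real \<Rightarrow> 'a::metric_space set \<Rightarrow> ennreal" where
  "hausdorff_content s \<delta> A =
     (INF C \<in> {C :: nat \<Rightarrow> 'a set. A \<subseteq> (\<Union>i. C i) \<and> (\<forall>i. bounded (C i) \<and> diameter (C i) \<le> \<delta>)}.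
        \<Sum>i. if C i = {} then 0 else ennreal (unit_ball_vol (real s) * (diameter (C i) / 2) ^ s))"

definition hausdorff_outer :: "nat \<Rightarrow> 'a::metric_space set \<Rightarrow> ennreal" where
  "hausdorff_outer s A = (SUP \<delta>\<in>{0<..}. hausdorff_content s \<delta> A)"

text \<open>As \<open>hausdorff_outer s\<close> is a metric outer measure, it is countably additive on the Borel
  sets, so the degenerate case of \<open>measure_of\<close> does not occur.\<close>

definition hausdorff_measure :: "nat \<Rightarrow> 'a::metric_space measure" where
  "hausdorff_measure s = measure_of UNIV (sets borel) (hausdorff_outer s)"

text \<open>Near \<open>p\<close> the set \<open>\<Omega>\<close> is the region below the graph of \<open>\<gamma>\<close> over the hyperplane orthogonal
  to the unit vector \<open>e\<close>. Only the values of \<open>\<gamma>\<close> on that hyperplane matter; requiring regularity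
  on the whole space is no restriction, since \<open>\<gamma>\<close> can be composed with the projection.\<close>

definition locally_subgraph ::
    "((real^'d \<Rightarrow> real) \<Rightarrow> bool) \<Rightarrow> (real^'d) set \<Rightarrow> real^'d \<Rightarrow> bool" where
  "locally_subgraph reg \<Omega> p \<longleftrightarrow>
     (\<exists>e r \<gamma>. norm e = 1 \<and> r > 0 \<and> reg \<gamma> \<and>
        \<Omega> \<inter> ball p r = {y \<in> ball p r. y \<bullet> e < \<gamma> (y - (y \<bullet> e) *\<^sub>R e)})"

definition bounded_lipschitz_domain :: "(real^'d) set \<Rightarrow> bool" where
  "bounded_lipschitz_domain \<Omega> \<longleftrightarrow>
     open \<Omega> \<and> connected \<Omega> \<and> \<Omega> \<noteq> {} \<and> bounded \<Omega> \<and>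
     (\<forall>p\<in>frontier \<Omega>. locally_subgraph (\<lambda>\<gamma>. \<exists>L. L-lipschitz_on UNIV \<gamma>) \<Omega> p)"

definition boundary_C1_at :: "(real^'d) set \<Rightarrow> real^'d \<Rightarrow> bool" where
  "boundary_C1_at \<Omega> p \<longleftrightarrow>
     p \<in> frontier \<Omega> \<and> locally_subgraph (\<lambda>\<gamma>. higher_differentiable_on 1 \<gamma> UNIV) \<Omega> p"

text \<open>The exterior unit normal is the normalised gradient of a C^1 defining function
  \<open>\<rho>\<close> that is negative exactly inside \<open>\<Omega>\<close>; for a subgraph one may take
  \<open>\<rho> y = y \<bullet> e - \<gamma> (y - (y \<bullet> e) *\<^sub>R e)\<close>.\<close>

definition exterior_unit_normal :: "(real^'d) set \<Rightarrow> real^'d \<Rightarrow> real^'d \<Rightarrow> bool" where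
  "exterior_unit_normal \<Omega> x \<nu> \<longleftrightarrow>
     x \<in> frontier \<Omega> \<and>
     (\<exists>\<rho> r D. r > 0 \<and> higher_differentiable_on 1 \<rho> (ball x r) \<and>
        \<Omega> \<inter> ball x r = {y \<in> ball x r. \<rho> y < (0::real)} \<and>
        GDERIV \<rho> x :> D \<and> D \<noteq> 0 \<and> \<nu> = sgn D)"

definition half_ball :: "real^'d \<Rightarrow> (real^'d) set" where
  "half_ball \<nu> = {y \<in> ball 0 1. y \<bullet> \<nu> < 0}"

definition submanifold_of_class :: "nat \<Rightarrow> 'a::euclidean_space set \<Rightarrow> bool" where
  "submanifold_of_class r M \<longleftrightarrow>
     (\<exists>m. \<forall>p\<in>M. \<exists>V V' \<Phi> \<Psi> S.
        open V \<and> p \<in> V \<and> open V' \<and> homeomorphism V V' \<Phi> \<Psi> \<and>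
        higher_differentiable_on r \<Phi> V \<and> higher_differentiable_on r \<Psi> V' \<and>
        subspace (S :: 'a set) \<and> dim S = m \<and> \<Phi> ` (M \<inter> V) = S \<inter> V')"

definition nearest_point_projection ::
    "'a::metric_space set \<Rightarrow> 'a set \<Rightarrow> ('a \<Rightarrow> 'a) \<Rightarrow> bool" where
  "nearest_point_projection M U P \<longleftrightarrow>
     (\<forall>y\<in>U. P y \<in> M \<and> (\<forall>z\<in>M. z \<noteq> P y \<longrightarrow> dist y (P y) < dist y z))"

definition test_function :: "(real^'d) set \<Rightarrow> (real^'d \<Rightarrow> real) \<Rightarrow> bool" where
  "test_function \<Omega> \<psi> \<longleftrightarrow>
     (\<forall>r. higher_differentiable_on r \<psi> UNIV) \<and>
     compact (closure {x. \<psi> x \<noteq> 0}) \<and> closure {x. \<psi> x \<noteq> 0} \<subseteq> \<Omega>"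

definition locally_integrable_on ::
    "('a::euclidean_space) set \<Rightarrow> ('a \<Rightarrow> 'b::euclidean_space) \<Rightarrow> bool" where
  "locally_integrable_on \<Omega> u \<longleftrightarrow> (\<forall>K. compact K \<and> K \<subseteq> \<Omega> \<longrightarrow> set_integrable lebesgue K u)"

definition has_weak_gradient ::
    "(real^'d) set \<Rightarrow> (real^'d \<Rightarrow> real^'k) \<Rightarrow> (real^'d \<Rightarrow> real^'d^'k) \<Rightarrow> bool" where
  "has_weak_gradient \<Omega> u G \<longleftrightarrow>
     locally_integrable_on \<Omega> u \<and> locally_integrable_on \<Omega> G \<and>
     (\<forall>\<psi> i j. test_function \<Omega> \<psi> \<longrightarrow>
        (LINT x:\<Omega>|lebesgue. u x $ i * frechet_derivative \<psi> (at x) (axis j 1)) =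
        - (LINT x:\<Omega>|lebesgue. G x $ i $ j * \<psi> x))"

text \<open>A representative; weak gradients are unique up to Lebesgue null sets, and all the
  definitions below are insensitive to the choice.\<close>

definition weak_gradient ::
    "(real^'d) set \<Rightarrow> (real^'d \<Rightarrow> real^'k) \<Rightarrow> real^'d \<Rightarrow> real^'d^'k" where
  "weak_gradient \<Omega> u = (SOME G. has_weak_gradient \<Omega> u G)"

definition W11 :: "(real^'d) set \<Rightarrow> (real^'d \<Rightarrow> real^'k) set" where
  "W11 \<Omega> = {u. (\<exists>G. has_weak_gradient \<Omega> u G) \<and>
     set_integrable lebesgue \<Omega> u \<and> set_integrable lebesgue \<Omega> (weak_gradient \<Omega> u)}"

definition Linf_norm :: "(real^'d) set \<Rightarrow> (real^'d \<Rightarrow> 'b::real_normed_vector) \<Rightarrow> ereal" where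
  "Linf_norm \<Omega> u = esssup (lebesgue_on \<Omega>) (\<lambda>x. ereal (norm (u x)))"

definition W1inf :: "(real^'d) set \<Rightarrow> (real^'d \<Rightarrow> real^'k) set" where
  "W1inf \<Omega> = {u. (\<exists>G. has_weak_gradient \<Omega> u G) \<and>
     Linf_norm \<Omega> u < \<infinity> \<and> Linf_norm \<Omega> (weak_gradient \<Omega> u) < \<infinity>}"

text \<open>The graph of the trace operator from \<open>W11 \<Omega>\<close> to L^1 of the boundary, that is, of the
  continuous extension of the restriction map \<open>v \<mapsto> v\<close> on the boundary for
  \<open>v\<close> in \<open>W11 \<Omega>\<close> continuous up to the boundary.\<close>

definition has_trace ::
    "(real^'d) set \<Rightarrow> (real^'d \<Rightarrow> real^'k) \<Rightarrow> (real^'d \<Rightarrow> real^'k) \<Rightarrow> bool" where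
  "has_trace \<Omega> u g \<longleftrightarrow>
     set_borel_measurable (hausdorff_measure (CARD('d) - 1)) (frontier \<Omega>) g \<and>
     (\<exists>v :: nat \<Rightarrow> real^'d \<Rightarrow> real^'k.
        (\<forall>j. v j \<in> W11 \<Omega> \<and> continuous_on (closure \<Omega>) (v j)) \<and>
        (\<lambda>j. \<integral>\<^sup>+x\<in>\<Omega>. ennreal (norm (v j x - u x)) \<partial>lebesgue) \<longlonglongrightarrow> 0 \<and>
        (\<lambda>j. \<integral>\<^sup>+x\<in>\<Omega>. ennreal (norm (weak_gradient \<Omega> (v j) x - weak_gradient \<Omega> u x)) \<partial>lebesgue)
          \<longlonglongrightarrow> 0 \<and>
        (\<lambda>j. \<integral>\<^sup>+x\<in>frontier \<Omega>. ennreal (norm (v j x - g x)) \<partial>hausdorff_measure (CARD('d) - 1))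
          \<longlonglongrightarrow> 0)"

definition trace_eq_on ::
    "(real^'d) set \<Rightarrow> (real^'d) set \<Rightarrow> (real^'d \<Rightarrow> real^'k) \<Rightarrow> (real^'d \<Rightarrow> real^'k) \<Rightarrow> bool" where
  "trace_eq_on \<Omega> \<Gamma> u v \<longleftrightarrow>
     (\<exists>g h. has_trace \<Omega> u g \<and> has_trace \<Omega> v h \<and>
        (AE x in hausdorff_measure (CARD('d) - 1). x \<in> \<Gamma> \<longrightarrow> g x = h x))"

text \<open>Vanishing of a function in \<open>W1inf\<close> on part of the boundary is understood pointwise,
  through its representative that is continuous up to the boundary.\<close>

definition vanishes_on_boundary_part ::
    "(real^'d) set \<Rightarrow> (real^'d) set \<Rightarrow> (real^'d \<Rightarrow> real^'k) \<Rightarrow> bool" where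
  "vanishes_on_boundary_part \<Omega> \<Gamma> u \<longleftrightarrow>
     (\<exists>v. continuous_on (closure \<Omega>) v \<and> (AE x in lebesgue_on \<Omega>. v x = u x) \<and> (\<forall>x\<in>\<Gamma>. v x = 0))"

definition W11_into :: "(real^'d) set \<Rightarrow> (real^'k) set \<Rightarrow> (real^'d \<Rightarrow> real^'k) set" where
  "W11_into \<Omega> M = {u \<in> W11 \<Omega>. AE x in lebesgue_on \<Omega>. u x \<in> M}"

definition admissible ::
    "(real^'d) set \<Rightarrow> (real^'k) set \<Rightarrow> (real^'d) set \<Rightarrow> (real^'d \<Rightarrow> real^'k) \<Rightarrow>
     (real^'d \<Rightarrow> real^'k) set" where
  "admissible \<Omega> M \<Gamma>1 n0 = {u \<in> W11_into \<Omega> M. trace_eq_on \<Omega> \<Gamma>1 u n0}"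

text \<open>The integral of the positive part minus that of the negative part. No growth is imposed
  on \<open>F\<close>, so the integral may be infinite; it counts as \<open>\<infinity>\<close> whenever the positive part
  is not integrable (in particular \<open>\<infinity> - \<infinity> = \<infinity>\<close> in \<^typ>\<open>ereal\<close>).\<close>

definition energy ::
    "(real^'d \<Rightarrow> real^'k \<Rightarrow> real^'d^'k \<Rightarrow> real) \<Rightarrow> (real^'d) set \<Rightarrow> (real^'d \<Rightarrow> real^'k) \<Rightarrow> ereal" where
  "energy F \<Omega> u =
     enn2ereal (\<integral>\<^sup>+x\<in>\<Omega>. ennreal (F x (u x) (weak_gradient \<Omega> u x)) \<partial>lebesgue) -
     enn2ereal (\<integral>\<^sup>+x\<in>\<Omega>. ennreal (- F x (u x) (weak_gradient \<Omega> u x)) \<partial>lebesgue)"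

definition strong_local_minimizer ::
    "(real^'d \<Rightarrow> real^'k \<Rightarrow> real^'d^'k \<Rightarrow> real) \<Rightarrow> (real^'d) set \<Rightarrow> (real^'d \<Rightarrow> real^'k) set \<Rightarrow>
     (real^'d \<Rightarrow> real^'k) \<Rightarrow> bool" where
  "strong_local_minimizer F \<Omega> A n \<longleftrightarrow>
     n \<in> A \<and>
     (\<exists>\<epsilon>>0. \<forall>m\<in>A. Linf_norm \<Omega> (\<lambda>x. n x - m x) < ereal \<epsilon> \<longrightarrow> energy F \<Omega> m \<ge> energy F \<Omega> n)"

end

theory Submission
  imports Defs
begin

text \<open>The proof perturbs the minimizer near a boundary point \<open>x\<close> of the free part \<open>\<Gamma>2\<close> and
blows up. For a \<open>C\<^sup>1\<close> field \<open>\<Phi>\<close> on the whole space with compact support, the maps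
\<open>y \<mapsto> P (n y + \<epsilon> \<Phi> ((y - x) / \<epsilon>))\<close> take values in \<open>M\<close>, converge uniformly to \<open>n\<close> because \<open>P\<close> is
the identity on \<open>M\<close>, and agree with \<open>n\<close> outside a ball of radius of order \<open>\<epsilon>\<close> around \<open>x\<close>. Since
\<open>\<Gamma>2\<close> is relatively open and disjoint from \<open>\<Gamma>1\<close>, they keep the boundary values on \<open>\<Gamma>1\<close>
as soon as \<open>\<epsilon>\<close> is small, so they compete with \<open>n\<close>. Their gradient is
\<open>\<nabla>P(\<dots>) (\<nabla>n + \<nabla>\<Phi>((y - x)/\<epsilon>))\<close>. After the change of variables \<open>y = x + \<epsilon> z\<close> the energy inequality
becomes an integral over \<open>(\<Omega> - x)/\<epsilon>\<close>; these sets converge to the half space \<open>z \<bullet> \<nu> < 0\<close>, and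
dominated convergence gives, with \<open>J = \<nabla>P(n x)\<close> and \<open>J \<nabla>n = \<nabla>n\<close>,
\<open>0 \<le> \<integral> F(x, n, \<nabla>n + J \<nabla>\<Phi>) - F(x, n, \<nabla>n)\<close> over the half space (\<open>blow_up_inequality\<close>).
The argument applies at every point of \<open>\<Gamma>2\<close> that has an exterior normal.

A competitor differs from \<open>n\<close> by a function \<open>w\<close> that is continuous up to the boundary. Adding \<open>w\<close> to
the approximating sequence and to the boundary values that witness a trace of \<open>n\<close> yields a trace of
\<open>n + w\<close> directly (\<open>has_trace_add_continuous\<close>), and \<open>w\<close> vanishes on \<open>\<Gamma>1\<close>.

A test function \<open>\<phi>\<close> in \<open>W\<^sup>1\<^sup>,\<^sup>\<infinity>\<close> of the half ball is reduced to \<open>C\<^sup>1\<close> fields by density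
(\<open>half_ball_C1_approximation\<close>). Mollification in the interior shows that \<open>\<phi>\<close> is Lipschitz; as it
vanishes on the hemisphere, reflection in the flat face and extension by zero turn it into a Lipschitz
function on the whole space. Its mollifications are \<open>C\<^sup>1\<close>, have uniformly bounded gradients, and these
converge almost everywhere, in the half ball to \<open>\<nabla>\<phi>\<close> and outside the unit ball to zero. The integrand
depends continuously on the gradient, so the inequality passes to the limit; the half space outside the
unit ball contributes nothing, which leaves the average over the half ball.

Weak gradients are only determined up to null sets. That the gradients of the competitors are the
classical ones, so that the energies are integrals of continuous functions, rests on the fundamental
lemma of the calculus of variations (\<open>has_weak_gradient_unique\<close>), which in turn follows from the
convergence of mollifications in \<open>L\<^sup>1\<close>.\<close>

section \<open>Auxiliary facts\<close>

lemma derivative_of_locally_vanishing: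
  assumes "(f has_derivative f') (at x)" "open S" "x \<in> S" "\<And>y. y \<in> S \<Longrightarrow> f y = 0"
  shows "f' = (\<lambda>_. 0)"
proof -
  have "((\<lambda>_. 0) has_derivative f') (at x)"
    by (rule has_derivative_transform_within_open[OF assms(1-3)]) (rule assms(4))
  then show ?thesis using has_derivative_unique[OF _ has_derivative_const] by blast
qed

lemma has_real_derivative_along_line:
  fixes f :: "'a::real_normed_vector \<Rightarrow> real"
  assumes "(f has_derivative f') (at (x + t *\<^sub>R h))"
  shows "((\<lambda>s. f (x + s *\<^sub>R h)) has_real_derivative f' h) (at t)"
proof -
  have "((\<lambda>s. x + s *\<^sub>R h) has_derivative (\<lambda>s. s *\<^sub>R h)) (at t)"
    by (auto intro!: derivative_eq_intros)
  from has_derivative_compose[OF this assms] show ?thesis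
    using linear_scale[OF has_derivative_linear[OF assms]]
    by (simp add: has_field_derivative_def mult_commute_abs)
qed

lemma matrix_eq_0I:
  fixes A :: "real^'d^'k"
  assumes "(\<lambda>h. A *v h) = (\<lambda>_. 0)"
  shows "A = 0"
proof -
  have "A *v h = 0 *v h" for h using assms by (metis matrix_vector_mult_0)
  then show ?thesis by (simp only: matrix_eq) simp
qed

lemma open_ball_halfspace:
  fixes \<nu> :: "'a::euclidean_space"
  shows "open {y \<in> ball 0 r. y \<bullet> \<nu> < 0}"
proof -
  have "{y \<in> ball 0 r. y \<bullet> \<nu> < 0} = ball 0 r \<inter> {y. \<nu> \<bullet> y < 0}" by (auto simp: inner_commute)
  then show ?thesis by (simp add: open_Int open_halfspace_lt)
qed

lemma continuous_vanishing_outside_bounded: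
  fixes f :: "'a::euclidean_space \<Rightarrow> 'b::real_normed_vector"
  assumes "continuous_on UNIV f" "\<And>y. R < norm y \<Longrightarrow> f y = 0"
  shows "\<exists>C>0. \<forall>y. norm (f y) \<le> C"
proof -
  have "bounded (f ` cball 0 R)"
    by (intro compact_imp_bounded compact_continuous_image continuous_on_subset[OF assms(1)]) auto
  then obtain C where C: "\<And>y. y \<in> cball 0 R \<Longrightarrow> norm (f y) \<le> C" unfolding bounded_iff by blast
  have "norm (f y) \<le> max C 1" for y
  proof (cases "norm y \<le> R")
    case True
    then show ?thesis using C[of y] by simp
  next
    case False
    then show ?thesis using assms(2)[of y] by simp
  qed
  moreover have "0 < max C 1" by simp
  ultimately show ?thesis by blast
qed

section \<open>Smooth functions and mollifiers\<close>

text \<open>The functions \<open>exp (-1/t) / t ^ k\<close>, continued by zero to \<open>t \<le> 0\<close>. The powers in the denominator are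
included because they make the family closed under differentiation.\<close>

definition flat_exp :: "nat \<Rightarrow> real \<Rightarrow> real" where
  "flat_exp k t = (if t > 0 then exp (- (1 / t)) / t ^ k else 0)"

lemma flat_exp_tendsto_0: "((\<lambda>t. flat_exp k t) \<longlongrightarrow> 0) (at 0)"
proof -
  have inv: "filterlim (\<lambda>t::real. inverse t) at_top (at_right 0)"
    by (rule filterlim_inverse_at_top_right)
  have "((\<lambda>t::real. (inverse t) ^ k / exp (inverse t)) \<longlongrightarrow> 0) (at_right 0)"
    by (rule filterlim_compose[OF tendsto_power_div_exp_0 inv])
  moreover have "\<forall>\<^sub>F t in at_right 0. (inverse t) ^ k / exp (inverse t) = flat_exp k t"
    by (auto simp: eventually_at_filter flat_exp_def exp_minus field_simps)
  ultimately have R: "((\<lambda>t. flat_exp k t) \<longlongrightarrow> 0) (at_right 0)"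
    by (rule Lim_transform_eventually)
  have "\<forall>\<^sub>F t in at_left 0. 0 = flat_exp k t"
    by (auto simp: eventually_at_filter flat_exp_def)
  then have L: "((\<lambda>t. flat_exp k t) \<longlongrightarrow> 0) (at_left 0)"
    by (rule Lim_transform_eventually[OF tendsto_const])
  show ?thesis using L R by (simp add: filterlim_split_at)
qed

lemma flat_exp_has_real_derivative:
  "(flat_exp k has_real_derivative (flat_exp (k + 2) t - real k * flat_exp (k + 1) t)) (at t)"
proof -
  consider "t < 0" | "t = 0" | "t > 0" by linarith
  then show ?thesis
  proof cases
    case 1
    have ev: "\<forall>\<^sub>F s in nhds t. 0 = flat_exp k s"
      using eventually_nhds_in_open[of "{..<0}" t] 1 by (auto simp: flat_exp_def elim: eventually_mono)
    have "((\<lambda>_. 0) has_real_derivative 0) (at t)" by simp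
    then have "(flat_exp k has_real_derivative 0) (at t)"
      by (rule DERIV_cong_ev[THEN iffD1, rotated 3]) (use ev in auto)
    then show ?thesis using 1 by (simp add: flat_exp_def)
  next
    case 2
    have "((\<lambda>h. flat_exp (k + 1) h) \<longlongrightarrow> 0) (at 0)" by (rule flat_exp_tendsto_0)
    moreover have "\<forall>\<^sub>F h in at 0. flat_exp (k + 1) h = (flat_exp k (0 + h) - flat_exp k 0) / h"
      by (auto simp: eventually_at_filter flat_exp_def)
    ultimately have "((\<lambda>h. (flat_exp k (0 + h) - flat_exp k 0) / h) \<longlongrightarrow> 0) (at 0)"
      by (rule Lim_transform_eventually)
    then show ?thesis using 2 by (simp add: DERIV_def flat_exp_def)
  next
    case 3
    have ev: "\<forall>\<^sub>F s in nhds t. exp (- (1 / s)) / s ^ k = flat_exp k s"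
      using eventually_nhds_in_open[of "{0<..}" t] 3 by (auto simp: flat_exp_def elim: eventually_mono)
    have "((\<lambda>s. exp (- (1 / s)) / s ^ k) has_real_derivative
        (flat_exp (k + 2) t - real k * flat_exp (k + 1) t)) (at t)"
    proof -
      have "((\<lambda>s. exp (- (1 / s)) / s ^ k) has_real_derivative
          (exp (- (1 / t)) * (1 / t\<^sup>2) * t ^ k - exp (- (1 / t)) * (real k * t ^ (k - 1))) / (t ^ k * t ^ k)) (at t)"
        using 3 by (auto intro!: derivative_eq_intros simp: power2_eq_square)
      also have "(exp (- (1 / t)) * (1 / t\<^sup>2) * t ^ k - exp (- (1 / t)) * (real k * t ^ (k - 1))) / (t ^ k * t ^ k)
          = flat_exp (k + 2) t - real k * flat_exp (k + 1) t"
        using 3 by (cases k) (simp_all add: flat_exp_def field_simps power2_eq_square)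
      finally show ?thesis .
    qed
    then show ?thesis
      by (rule DERIV_cong_ev[THEN iffD1, rotated 3]) (use ev in auto)
  qed
qed

text \<open>A syntactically generated algebra of smooth functions that is closed under directional derivatives,
which gives differentiability of every order by a plain induction on the order. Composition with \<open>flat_exp\<close> is what provides
compactly supported members.\<close>

inductive smooth_expr :: "('a::real_inner \<Rightarrow> real) \<Rightarrow> bool" where
  const: "smooth_expr (\<lambda>x. c)"
| linear: "smooth_expr (\<lambda>x. x \<bullet> a)"
| add: "smooth_expr f \<Longrightarrow> smooth_expr g \<Longrightarrow> smooth_expr (\<lambda>x. f x + g x)"
| mult: "smooth_expr f \<Longrightarrow> smooth_expr g \<Longrightarrow> smooth_expr (\<lambda>x. f x * g x)"
| flat: "smooth_expr f \<Longrightarrow> smooth_expr (\<lambda>x. flat_exp k (f x))"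

lemma smooth_expr_has_derivative:
  assumes "smooth_expr f"
  shows "\<exists>f'. (\<forall>x. (f has_derivative (\<lambda>v. f' v x)) (at x)) \<and> (\<forall>v. smooth_expr (f' v))"
  using assms
proof induction
  case (const c)
  show ?case by (rule exI[of _ "\<lambda>v x. 0"]) (auto intro: smooth_expr.intros)
next
  case (linear a)
  show ?case
    by (rule exI[of _ "\<lambda>v x. v \<bullet> a"])
       (auto intro: smooth_expr.intros intro!: derivative_eq_intros)
next
  case (add f g)
  then obtain f' g' where d: "\<And>x. (f has_derivative (\<lambda>v. f' v x)) (at x)" "\<And>v. smooth_expr (f' v)"
    "\<And>x. (g has_derivative (\<lambda>v. g' v x)) (at x)" "\<And>v. smooth_expr (g' v)" by blast
  have "((\<lambda>x. f x + g x) has_derivative (\<lambda>v. f' v x + g' v x)) (at x)" for x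
    by (intro has_derivative_add d)
  moreover have "smooth_expr (\<lambda>x. f' v x + g' v x)" for v
    by (intro smooth_expr.add d)
  ultimately show ?case by (intro exI[of _ "\<lambda>v x. f' v x + g' v x"]) simp
next
  case (mult f g)
  then obtain f' g' where d: "\<And>x. (f has_derivative (\<lambda>v. f' v x)) (at x)" "\<And>v. smooth_expr (f' v)"
    "\<And>x. (g has_derivative (\<lambda>v. g' v x)) (at x)" "\<And>v. smooth_expr (g' v)" by blast
  have "((\<lambda>x. f x * g x) has_derivative (\<lambda>v. f x * g' v x + f' v x * g x)) (at x)" for x
    by (intro has_derivative_mult d)
  moreover have "smooth_expr (\<lambda>x. f x * g' v x + f' v x * g x)" for v
    by (intro smooth_expr.add smooth_expr.mult d mult.hyps)
  ultimately show ?case by (intro exI[of _ "\<lambda>v x. f x * g' v x + f' v x * g x"]) simp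
next
  case (flat f k)
  then obtain f' where f': "\<And>x. (f has_derivative (\<lambda>v. f' v x)) (at x)" "\<And>v. smooth_expr (f' v)" by blast
  let ?d = "\<lambda>v x. (flat_exp (k + 2) (f x) + (- real k) * flat_exp (k + 1) (f x)) * f' v x"
  have "((\<lambda>x. flat_exp k (f x)) has_derivative (\<lambda>v. ?d v x)) (at x)" for x
    using has_derivative_compose[OF f'(1)[of x]
        flat_exp_has_real_derivative[of k "f x", unfolded has_field_derivative_def]]
    by (simp add: algebra_simps)
  moreover have "smooth_expr (?d v)" for v
    by (intro smooth_expr.add smooth_expr.mult smooth_expr.const smooth_expr.flat f' flat.hyps)
  ultimately show ?case by (intro exI[of _ ?d]) simp
qed

lemma smooth_expr_differentiable: "smooth_expr f \<Longrightarrow> f differentiable (at x)"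
  using smooth_expr_has_derivative[of f] unfolding differentiable_def by blast

lemma smooth_expr_continuous_on: "smooth_expr f \<Longrightarrow> continuous_on S f"
  by (rule continuous_at_imp_continuous_on)
     (blast intro: differentiable_imp_continuous_within smooth_expr_differentiable)

lemma smooth_expr_frechet_derivative:
  assumes "smooth_expr f"
  shows "smooth_expr (\<lambda>x. frechet_derivative f (at x) v)"
proof -
  obtain f' where f': "\<And>x. (f has_derivative (\<lambda>v. f' v x)) (at x)" "\<And>v. smooth_expr (f' v)"
    using smooth_expr_has_derivative[OF assms] by blast
  have "frechet_derivative f (at x) v = f' v x" for x
    using frechet_derivative_at[OF f'(1)[of x]] by (metis)
  then have "(\<lambda>x. frechet_derivative f (at x) v) = f' v" by (rule ext)
  then show ?thesis using f'(2)[of v] by (simp only:)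
qed

lemma smooth_expr_higher_differentiable: "smooth_expr f \<Longrightarrow> higher_differentiable_on r f S"
proof (induction r arbitrary: f)
  case 0
  then show ?case using smooth_expr_continuous_on[of f S] by (simp only: higher_differentiable_on.simps)
next
  case (Suc r)
  have "higher_differentiable_on r (\<lambda>x. frechet_derivative f (at x) v) S" for v
    by (rule Suc.IH[OF smooth_expr_frechet_derivative[OF Suc.prems]])
  then show ?case using smooth_expr_differentiable[OF Suc.prems]
    by (simp only: higher_differentiable_on.simps) blast
qed

lemma smooth_expr_reflect: "smooth_expr f \<Longrightarrow> smooth_expr (\<lambda>x. f (y - x))"
proof (induction rule: smooth_expr.induct)
  case (linear a)
  have "(\<lambda>x. (y - x) \<bullet> a) = (\<lambda>x. y \<bullet> a + (-1) * (x \<bullet> a))" by (auto simp: inner_diff_left)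
  moreover have "smooth_expr (\<lambda>x. y \<bullet> a + (-1) * (x \<bullet> a))"
    by (intro smooth_expr.add smooth_expr.mult smooth_expr.const smooth_expr.linear)
  ultimately show ?case by simp
qed (intro smooth_expr.const smooth_expr.add smooth_expr.mult smooth_expr.flat; assumption)+

lemma smooth_expr_sum:
  assumes "finite I" "\<And>i. i \<in> I \<Longrightarrow> smooth_expr (f i)"
  shows "smooth_expr (\<lambda>x. \<Sum>i\<in>I. f i x)"
  using assms
proof (induction rule: finite_induct)
  case empty
  show ?case using smooth_expr.const[of 0] by simp
next
  case (insert i I)
  then have "smooth_expr (\<lambda>x. f i x + (\<Sum>i\<in>I. f i x))" by (intro smooth_expr.add) simp_all
  then show ?case using insert by simp
qed

lemma smooth_expr_square_norm: "smooth_expr (\<lambda>x::'a::euclidean_space. x \<bullet> x)"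
proof -
  have "(\<lambda>x::'a. x \<bullet> x) = (\<lambda>x. \<Sum>b\<in>Basis. (x \<bullet> b) * (x \<bullet> b))"
    by (rule ext) (rule euclidean_inner)
  moreover have "smooth_expr (\<lambda>x::'a. \<Sum>b\<in>Basis. (x \<bullet> b) * (x \<bullet> b))"
    by (rule smooth_expr_sum[OF finite_Basis], rule smooth_expr.mult) (rule smooth_expr.linear)+
  ultimately show ?thesis by simp
qed

definition smooth_kernel :: "real \<Rightarrow> ('a::real_inner \<Rightarrow> real) \<Rightarrow> bool" where
  "smooth_kernel \<mu> \<kappa> \<longleftrightarrow> smooth_expr \<kappa> \<and> (\<forall>z. \<mu> \<le> norm z \<longrightarrow> \<kappa> z = 0)"

definition mollifier :: "real \<Rightarrow> ('a::euclidean_space \<Rightarrow> real) \<Rightarrow> bool" where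
  "mollifier \<mu> \<kappa> \<longleftrightarrow> smooth_kernel \<mu> \<kappa> \<and> (\<forall>z. 0 \<le> \<kappa> z) \<and> integrable lborel \<kappa> \<and> integral\<^sup>L lborel \<kappa> = 1"

text \<open>The usual bump \<open>exp (-1 / (\<mu>\<^sup>2 - |z|\<^sup>2))\<close>, divided by its integral.\<close>

lemma mollifier_exists:
  assumes "\<mu> > (0::real)"
  obtains \<kappa> :: "'a::euclidean_space \<Rightarrow> real" where "mollifier \<mu> \<kappa>"
proof -
  define b :: "'a \<Rightarrow> real" where "b z = flat_exp 0 (\<mu>\<^sup>2 + (-1) * (z \<bullet> z))" for z
  have sm: "smooth_expr b"
  proof -
    have "smooth_expr (\<lambda>z::'a. flat_exp 0 (\<mu>\<^sup>2 + (-1) * (z \<bullet> z)))"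
      by (rule smooth_expr.flat, rule smooth_expr.add, rule smooth_expr.const, rule smooth_expr.mult,
          rule smooth_expr.const, rule smooth_expr_square_norm)
    moreover have "b = (\<lambda>z. flat_exp 0 (\<mu>\<^sup>2 + (-1) * (z \<bullet> z)))" by (rule ext) (rule b_def)
    ultimately show ?thesis by (simp only:)
  qed
  have pos: "b z > 0 \<longleftrightarrow> norm z < \<mu>" for z
  proof -
    have "b z > 0 \<longleftrightarrow> z \<bullet> z < \<mu>\<^sup>2" by (simp add: b_def flat_exp_def)
    then show ?thesis using norm_lt_square[of z \<mu>] assms by blast
  qed
  have nn: "b z \<ge> 0" for z by (simp add: b_def flat_exp_def)
  have out: "norm z \<ge> \<mu> \<Longrightarrow> b z = 0" for z using pos[of z] nn[of z] by linarith
  have "integrable lborel (\<lambda>x. indicator (cball 0 \<mu>) x *\<^sub>R b x)"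
    by (rule borel_integrable_compact) (auto intro: smooth_expr_continuous_on sm)
  moreover have "(\<lambda>x. indicator (cball 0 \<mu>) x *\<^sub>R b x) = b"
    using out by (auto simp: indicator_def fun_eq_iff not_le)
  ultimately have int: "integrable lborel b" by simp
  have "integral\<^sup>L lborel b \<noteq> 0"
  proof
    assume "integral\<^sup>L lborel b = 0"
    then have "AE x in lborel. b x = 0"
      using int nn by (simp add: integral_nonneg_eq_0_iff_AE)
    then have "AE x in lborel. (x::'a) \<notin> ball 0 \<mu>"
    proof (rule eventually_mono)
      show "z \<notin> ball 0 \<mu>" if "b z = 0" for z using pos[of z] that by simp
    qed
    then have "ball (0::'a) \<mu> \<in> null_sets lborel" by (subst (asm) AE_iff_null_sets[symmetric]) auto
    then have "negligible (ball (0::'a) \<mu>)"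
      by (simp add: negligible_iff_null_sets null_sets_completionI)
    then show False using assms open_not_negligible[of "ball (0::'a) \<mu>"] by auto
  qed
  moreover have "0 \<le> integral\<^sup>L lborel b" by (rule integral_nonneg_AE) (simp add: nn)
  ultimately have p: "integral\<^sup>L lborel b > 0" by simp
  let ?c = "inverse (integral\<^sup>L lborel b)"
  have "smooth_expr (\<lambda>z. ?c * b z)"
    by (rule smooth_expr.mult[OF smooth_expr.const sm])
  moreover have "0 \<le> ?c * b z" for z using p nn[of z] by simp
  moreover have "?c * b z = 0" if "norm z \<ge> \<mu>" for z using out[OF that] by simp
  moreover have "integrable lborel (\<lambda>z. ?c * b z)" using int by simp
  moreover have "integral\<^sup>L lborel (\<lambda>z. ?c * b z) = 1" using p by simp
  ultimately have "mollifier \<mu> (\<lambda>z. ?c * b z)" by (simp only: mollifier_def smooth_kernel_def) blast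
  then show ?thesis by (rule that)
qed

lemma mollifier_sequence:
  assumes "r > 0"
  obtains \<mu> :: "nat \<Rightarrow> real" and \<kappa> :: "nat \<Rightarrow> 'a::euclidean_space \<Rightarrow> real"
  where "\<And>n. \<mu> n \<le> r" "\<mu> \<longlonglongrightarrow> 0" "\<And>n. mollifier (\<mu> n) (\<kappa> n)"
proof -
  define \<mu> :: "nat \<Rightarrow> real" where "\<mu> n = r * inverse (real (Suc n))" for n
  have \<mu>: "\<mu> n > 0" "\<mu> n \<le> r" for n using assms by (auto simp: \<mu>_def field_simps)
  have \<mu>0: "\<mu> \<longlonglongrightarrow> 0" unfolding \<mu>_def by (intro tendsto_mult_right_zero LIMSEQ_inverse_real_of_nat)
  have "\<exists>\<kappa> :: 'a \<Rightarrow> real. mollifier (\<mu> n) \<kappa>" for n using mollifier_exists[OF \<mu>(1)[of n]] by metis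
  then obtain \<kappa> :: "nat \<Rightarrow> 'a \<Rightarrow> real" where \<kappa>: "\<And>n. mollifier (\<mu> n) (\<kappa> n)" by metis
  show ?thesis by (rule that[OF \<mu>(2) \<mu>0 \<kappa>])
qed

text \<open>These are the test functions for which the weak formulation expresses derivatives of a mollification.\<close>

lemma test_function_reflected_mollifier:
  fixes \<kappa> :: "real^'d \<Rightarrow> real"
  assumes \<kappa>: "mollifier \<mu> \<kappa>" and sub: "cball y \<mu> \<subseteq> \<Omega>"
  shows "test_function \<Omega> (\<lambda>z. \<kappa> (y - z))"
proof -
  have "{z. \<kappa> (y - z) \<noteq> 0} \<subseteq> cball y \<mu>"
  proof
    fix z assume "z \<in> {z. \<kappa> (y - z) \<noteq> 0}"
    then show "z \<in> cball y \<mu>" using \<kappa> unfolding mollifier_def smooth_kernel_def by (cases "norm (y - z) \<ge> \<mu>") (auto simp: dist_norm)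
  qed
  then have c: "closure {z. \<kappa> (y - z) \<noteq> 0} \<subseteq> cball y \<mu>"
    by (simp add: closure_minimal)
  then have "compact (closure {z. \<kappa> (y - z) \<noteq> 0})"
    by (meson bounded_cball bounded_subset closed_closure compact_eq_bounded_closed)
  moreover have "smooth_expr (\<lambda>z. \<kappa> (y - z))" using \<kappa> unfolding mollifier_def smooth_kernel_def by (blast intro: smooth_expr_reflect)
  ultimately show ?thesis
    using c sub smooth_expr_higher_differentiable unfolding test_function_def by blast
qed

section \<open>Mollification in L1\<close>

lemma lborel_affine_integral:
  fixes f :: "'a::euclidean_space \<Rightarrow> 'b::{banach, second_countable_topology}"
  assumes f: "f \<in> borel_measurable borel" and c: "c \<noteq> 0"
  shows "integral\<^sup>L lborel f = \<bar>c\<bar> ^ DIM('a) *\<^sub>R integral\<^sup>L lborel (\<lambda>x. f (t + c *\<^sub>R x))" (is ?I)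
    and "integrable lborel f \<longleftrightarrow> integrable lborel (\<lambda>x. f (t + c *\<^sub>R x))" (is ?E)
proof -
  have eq: "(lborel :: 'a measure) = density (distr lborel borel (\<lambda>x. t + c *\<^sub>R x)) (\<lambda>_. ennreal (\<bar>c\<bar> ^ DIM('a)))"
    using lborel_affine[OF c, of t] by (simp add: ennreal_power)
  show ?I
    by (subst eq) (use f in \<open>simp add: integral_density integral_distr\<close>)
  have "integrable lborel f \<longleftrightarrow> integrable lborel (\<lambda>x. \<bar>c\<bar> ^ DIM('a) *\<^sub>R f (t + c *\<^sub>R x))"
    by (subst eq) (use f c in \<open>simp add: integrable_density integrable_distr_eq\<close>)
  also have "\<dots> \<longleftrightarrow> integrable lborel (\<lambda>x. f (t + c *\<^sub>R x))"
  proof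
    assume "integrable lborel (\<lambda>x. \<bar>c\<bar> ^ DIM('a) *\<^sub>R f (t + c *\<^sub>R x))"
    then have "integrable lborel (\<lambda>x. inverse (\<bar>c\<bar> ^ DIM('a)) *\<^sub>R \<bar>c\<bar> ^ DIM('a) *\<^sub>R f (t + c *\<^sub>R x))"
      by (rule integrable_scaleR_right)
    then show "integrable lborel (\<lambda>x. f (t + c *\<^sub>R x))" using c by simp
  qed simp
  finally show ?E .
qed

lemma lborel_translate:
  fixes f :: "'a::euclidean_space \<Rightarrow> 'b::{banach, second_countable_topology}"
  assumes "integrable lborel f"
  shows "integrable lborel (\<lambda>y. f (y - z))" "integral\<^sup>L lborel (\<lambda>y. f (y - z)) = integral\<^sup>L lborel f"
    "integrable lborel (\<lambda>y. f (z - y))" "integral\<^sup>L lborel (\<lambda>y. f (z - y)) = integral\<^sup>L lborel f"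
proof -
  have f: "f \<in> borel_measurable borel" using assms by (auto dest: borel_measurable_integrable)
  show "integrable lborel (\<lambda>y. f (y - z))" "integral\<^sup>L lborel (\<lambda>y. f (y - z)) = integral\<^sup>L lborel f"
    using lborel_affine_integral[OF f, of 1 "- z"] assms by simp_all
  show "integrable lborel (\<lambda>y. f (z - y))" "integral\<^sup>L lborel (\<lambda>y. f (z - y)) = integral\<^sup>L lborel f"
    using lborel_affine_integral[OF f, of "-1" "z"] assms by simp_all
qed

text \<open>Continuity of translations survives \<open>L\<^sup>1\<close> limits, because translations are isometries of \<open>L\<^sup>1\<close>:
this carries it from indicators of open sets to all integrable functions.\<close>

lemma translation_continuous_L1_approx:
  fixes g :: "'a::euclidean_space \<Rightarrow> 'b::{banach, second_countable_topology}"
  assumes g: "integrable lborel g"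
    and approx: "\<And>e. e > 0 \<Longrightarrow> \<exists>h. integrable lborel h \<and> (\<integral>x. norm (g x - h x) \<partial>lborel) \<le> e \<and>
      ((\<lambda>z. \<integral>y. norm (h (y - z) - h y) \<partial>lborel) \<longlongrightarrow> 0) (at 0)"
  shows "((\<lambda>z. \<integral>y. norm (g (y - z) - g y) \<partial>lborel) \<longlongrightarrow> 0) (at 0)"
proof (rule tendstoI)
  fix e :: real assume "e > 0"
  then obtain h where h: "integrable lborel h" and small: "(\<integral>x. norm (g x - h x) \<partial>lborel) \<le> e / 4"
    and lim: "((\<lambda>z. \<integral>y. norm (h (y - z) - h y) \<partial>lborel) \<longlongrightarrow> 0) (at 0)"
    using approx[of "e / 4"] by auto
  have gh: "integrable lborel (\<lambda>x. norm (g x - h x))" using g h by simp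
  have le: "(\<integral>y. norm (g (y - z) - g y) \<partial>lborel) \<le> e / 2 + (\<integral>y. norm (h (y - z) - h y) \<partial>lborel)" for z
  proof -
    have int: "integrable lborel (\<lambda>y. norm (g (y - z) - h (y - z)))" "integrable lborel (\<lambda>y. norm (h (y - z) - h y))"
       "integrable lborel (\<lambda>y. norm (g (y - z) - g y))"
      using lborel_translate(1)[OF gh] lborel_translate(1)[OF g] lborel_translate(1)[OF h] g h by simp_all
    have "(\<integral>y. norm (g (y - z) - g y) \<partial>lborel) \<le>
       (\<integral>y. norm (g (y - z) - h (y - z)) + norm (h (y - z) - h y) + norm (g y - h y) \<partial>lborel)"
    proof (rule integral_mono)
      show "norm (g (y - z) - g y) \<le> norm (g (y - z) - h (y - z)) + norm (h (y - z) - h y) + norm (g y - h y)" for y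
        by norm
    qed (use int gh in auto)
    also have "\<dots> = (\<integral>y. norm (g (y - z) - h (y - z)) \<partial>lborel) + (\<integral>y. norm (h (y - z) - h y) \<partial>lborel)
        + (\<integral>y. norm (g y - h y) \<partial>lborel)"
      using int gh by simp
    also have "(\<integral>y. norm (g (y - z) - h (y - z)) \<partial>lborel) = (\<integral>y. norm (g y - h y) \<partial>lborel)"
      by (rule lborel_translate(2)[OF gh])
    finally show ?thesis using small by simp
  qed
  have "\<forall>\<^sub>F z in at 0. dist (\<integral>y. norm (h (y - z) - h y) \<partial>lborel) 0 < e / 2"
    using lim \<open>e > 0\<close> by (intro tendstoD) auto
  then show "\<forall>\<^sub>F z in at 0. dist (\<integral>y. norm (g (y - z) - g y) \<partial>lborel) 0 < e"
  proof eventually_elim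
    case (elim z)
    have "0 \<le> (\<integral>y. norm (g (y - z) - g y) \<partial>lborel)" by (rule integral_nonneg_AE) simp
    then show ?case using elim le[of z] by (simp add: dist_real_def)
  qed
qed

lemma translation_continuous_L1_open:
  fixes c :: "'b::{banach, second_countable_topology}"
  assumes U: "open (U :: 'a::euclidean_space set)" "emeasure lborel U < \<infinity>"
  shows "((\<lambda>z. \<integral>y. norm (indicator U (y - z) *\<^sub>R c - indicator U y *\<^sub>R c) \<partial>lborel) \<longlongrightarrow> 0) (at 0)"
proof -
  have i: "integrable lborel (indicator U :: 'a \<Rightarrow> real)" using U by simp
  note it = lborel_translate(1,2)[OF i]
  define q :: "'a \<Rightarrow> 'a \<Rightarrow> real" where "q z y = indicator U y * (1 - indicator U (y - z))" for z y
  have [measurable]: "U \<in> sets borel" using U by simp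
  have qint: "integrable lborel (q z)" for z
  proof (rule Bochner_Integration.integrable_bound[OF i])
    show "q z \<in> borel_measurable lborel"
      unfolding q_def using borel_measurable_integrable[OF it(1)[of z]] by measurable
  qed (auto simp: q_def indicator_def)
  \<comment> \<open>A set and its translate have equal measure, so their symmetric difference is twice the part that is lost; openness makes that part shrink pointwise.\<close>
  have eq: "(\<integral>y. norm (indicator U (y - z) *\<^sub>R c - indicator U y *\<^sub>R c) \<partial>lborel) = 2 * norm c * integral\<^sup>L lborel (q z)" for z
  proof -
    have "norm (indicator U (y - z) *\<^sub>R c - indicator U y *\<^sub>R c) =
       norm c * ((indicator U (y - z) - indicator U y) + 2 * q z y)" for y
      by (auto simp: q_def indicator_def)
    then have "(\<integral>y. norm (indicator U (y - z) *\<^sub>R c - indicator U y *\<^sub>R c) \<partial>lborel)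
       = norm c * (\<integral>y. (indicator U (y - z) - indicator U y) + 2 * q z y \<partial>lborel)" by simp
    also have "(\<integral>y. (indicator U (y - z) - indicator U y) + 2 * q z y \<partial>lborel) = 2 * integral\<^sup>L lborel (q z)"
      using it[of z] i qint[of z] by simp
    finally show ?thesis by simp
  qed
  have "((\<lambda>z. integral\<^sup>L lborel (q z)) \<longlongrightarrow> 0) (at 0)"
    unfolding tendsto_at_iff_sequentially
  proof (intro allI impI)
    fix X :: "nat \<Rightarrow> 'a" assume X: "X \<longlonglongrightarrow> 0"
    have "(\<lambda>n. integral\<^sup>L lborel (q (X n))) \<longlonglongrightarrow> integral\<^sup>L lborel (\<lambda>_::'a. 0::real)"
    proof (rule integral_dominated_convergence[where w = "indicator U"])
      show "AE y in lborel. (\<lambda>n. q (X n) y) \<longlonglongrightarrow> 0"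
      proof (rule AE_I2)
        fix y
        show "(\<lambda>n. q (X n) y) \<longlonglongrightarrow> 0"
        proof (cases "y \<in> U")
          case True
          have "(\<lambda>n. y - X n) \<longlonglongrightarrow> y - 0" by (intro tendsto_intros X)
          then have "\<forall>\<^sub>F n in sequentially. y - X n \<in> U"
            using True U(1) by (auto intro: topological_tendstoD)
          then have "\<forall>\<^sub>F n in sequentially. q (X n) y = 0" by eventually_elim (simp add: q_def)
          then show ?thesis by (rule tendsto_eventually)
        qed (simp add: q_def)
      qed
    qed (use i qint in \<open>auto simp: q_def indicator_def borel_measurable_integrable\<close>)
    then show "((\<lambda>z. integral\<^sup>L lborel (q z)) \<circ> X) \<longlonglongrightarrow> 0" by (simp add: o_def)
  qed
  then have "((\<lambda>z. 2 * norm c * integral\<^sup>L lborel (q z)) \<longlongrightarrow> 2 * norm c * 0) (at 0)" by (intro tendsto_intros)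
  then show ?thesis unfolding eq by simp
qed

lemma translation_continuous_L1:
  fixes g :: "'a::euclidean_space \<Rightarrow> 'b::{banach, second_countable_topology}"
  assumes "integrable lborel g"
  shows "((\<lambda>z. \<integral>y. norm (g (y - z) - g y) \<partial>lborel) \<longlongrightarrow> 0) (at 0)"
  using assms
proof (induction rule: integrable_induct)
  case (base A c)
  then have A: "A \<in> sets borel" "emeasure lborel A < \<infinity>" by auto
  have iA: "integrable lborel (\<lambda>x. indicator A x *\<^sub>R c)" using A by simp
  show ?case
  proof (rule translation_continuous_L1_approx[OF iA])
    fix e :: real assume "e > 0"
    define d where "d = e / (norm c + 1)"
    have "norm c + 1 > 0" by (intro add_nonneg_pos) auto
    then have d: "d > 0" "d * norm c \<le> e" using \<open>e > 0\<close> by (auto simp: d_def field_simps)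
    obtain U where U: "open U" "A \<subseteq> U" "emeasure lborel (U - A) < d"
      using outer_regular_lborel[OF A(1) d(1)] by blast
    have UA: "emeasure lborel (U - A) < \<infinity>" using U(3) by (rule less_trans) simp
    have "emeasure lborel U = emeasure lborel A + emeasure lborel (U - A)"
      using A(1) U by (subst plus_emeasure) (auto intro!: arg_cong[where f="emeasure lborel"])
    then have fin: "emeasure lborel U < \<infinity>" using A(2) UA by (simp add: less_top)
    have "(\<integral>x. norm (indicator A x *\<^sub>R c - indicator U x *\<^sub>R c) \<partial>lborel) = (\<integral>x. indicator (U - A) x * norm c \<partial>lborel)"
      using U(2) by (intro Bochner_Integration.integral_cong) (auto simp: indicator_def)
    also have "\<dots> = measure lborel (U - A) * norm c" by simp
    also have "\<dots> \<le> d * norm c"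
    proof (rule mult_right_mono)
      have "emeasure lborel (U - A) = ennreal (measure lborel (U - A))"
        using UA by (intro emeasure_eq_ennreal_measure) simp
      then show "measure lborel (U - A) \<le> d" using U(3) d(1) by (simp add: ennreal_less_iff)
    qed simp
    finally show "\<exists>h. integrable lborel h \<and> (\<integral>x. norm (indicator A x *\<^sub>R c - h x) \<partial>lborel) \<le> e \<and>
        ((\<lambda>z. \<integral>y. norm (h (y - z) - h y) \<partial>lborel) \<longlongrightarrow> 0) (at 0)"
      using translation_continuous_L1_open[OF U(1) fin, of c] fin U(1) d(2)
      by (intro exI[of _ "\<lambda>x. indicator U x *\<^sub>R c"]) auto
  qed
next
  case (add f g)
  have "((\<lambda>z. (\<integral>y. norm (f (y - z) - f y) \<partial>lborel) + (\<integral>y. norm (g (y - z) - g y) \<partial>lborel)) \<longlongrightarrow> 0 + 0) (at 0)"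
    by (intro tendsto_add add.IH)
  then have lim: "((\<lambda>z. (\<integral>y. norm (f (y - z) - f y) \<partial>lborel) + (\<integral>y. norm (g (y - z) - g y) \<partial>lborel)) \<longlongrightarrow> 0) (at 0)" by simp
  show ?case
  proof (rule tendsto_sandwich[OF _ _ tendsto_const lim]; intro always_eventually allI)
    fix z
    show "0 \<le> (\<integral>y. norm (f (y - z) + g (y - z) - (f y + g y)) \<partial>lborel)" by (rule integral_nonneg_AE) simp
    have int: "integrable lborel (\<lambda>y. norm (f (y - z) - f y))" "integrable lborel (\<lambda>y. norm (g (y - z) - g y))"
      "integrable lborel (\<lambda>y. norm (f (y - z) + g (y - z) - (f y + g y)))"
      using lborel_translate(1)[OF add.hyps(1)] lborel_translate(1)[OF add.hyps(2)] add.hyps by simp_all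
    have "(\<integral>y. norm (f (y - z) + g (y - z) - (f y + g y)) \<partial>lborel) \<le>
       (\<integral>y. norm (f (y - z) - f y) + norm (g (y - z) - g y) \<partial>lborel)"
      by (rule integral_mono) (use int in \<open>auto intro: norm_diff_triangle_ineq\<close>)
    then show "(\<integral>y. norm (f (y - z) + g (y - z) - (f y + g y)) \<partial>lborel) \<le>
       (\<integral>y. norm (f (y - z) - f y) \<partial>lborel) + (\<integral>y. norm (g (y - z) - g y) \<partial>lborel)"
      using int by simp
  qed
next
  case (lim f s)
  show ?case
  proof (rule translation_continuous_L1_approx[OF lim.hyps(4)])
    fix e :: real assume "e > 0"
    have "(\<lambda>i. \<integral>x. norm (f x - s i x) \<partial>lborel) \<longlonglongrightarrow> integral\<^sup>L lborel (\<lambda>_::'a. 0::real)"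
    proof (rule integral_dominated_convergence[where w = "\<lambda>x. 3 * norm (f x)"])
      show "AE x in lborel. (\<lambda>i. norm (f x - s i x)) \<longlonglongrightarrow> 0"
      proof (rule AE_I2)
        fix x :: 'a
        have "(\<lambda>i. norm (f x - s i x)) \<longlonglongrightarrow> norm (f x - f x)" using lim.hyps(2)[of x] by (intro tendsto_intros) auto
        then show "(\<lambda>i. norm (f x - s i x)) \<longlonglongrightarrow> 0" by simp
      qed
      show "AE x in lborel. norm (norm (f x - s i x)) \<le> 3 * norm (f x)" for i
      proof (rule AE_I2)
        fix x
        show "norm (norm (f x - s i x)) \<le> 3 * norm (f x)"
          using lim.hyps(3)[of x i] norm_triangle_ineq4[of "f x" "s i x"] by simp
      qed
    qed (use lim.hyps in auto)
    then have "\<forall>\<^sub>F i in sequentially. (\<integral>x. norm (f x - s i x) \<partial>lborel) < e"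
      using \<open>e > 0\<close> by (auto intro: order_tendstoD)
    then obtain i where "(\<integral>x. norm (f x - s i x) \<partial>lborel) < e" by (auto simp: eventually_sequentially)
    then show "\<exists>h. integrable lborel h \<and> (\<integral>x. norm (f x - h x) \<partial>lborel) \<le> e \<and>
        ((\<lambda>z. \<integral>y. norm (h (y - z) - h y) \<partial>lborel) \<longlongrightarrow> 0) (at 0)"
      using lim by (intro exI[of _ "s i"]) auto
  qed
qed

text \<open>The kernel carries the translation, so that the derivative of the convolution is the convolution with
the derivative of the kernel, whatever the regularity of \<open>g\<close>.\<close>

definition convolve :: "('a::euclidean_space \<Rightarrow> real) \<Rightarrow> ('a \<Rightarrow> 'b::{banach, second_countable_topology}) \<Rightarrow> 'a \<Rightarrow> 'b" where
  "convolve \<kappa> g y = (\<integral>z. \<kappa> (y - z) *\<^sub>R g z \<partial>lborel)"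

lemma mollifier_kernel: "mollifier \<mu> \<kappa> \<Longrightarrow> smooth_kernel \<mu> \<kappa>"
  by (simp add: mollifier_def)

lemma smooth_kernel_eq_0: "smooth_kernel \<mu> \<kappa> \<Longrightarrow> \<mu> \<le> norm z \<Longrightarrow> \<kappa> z = 0"
  by (simp add: smooth_kernel_def)

lemma mollifier_nonneg: "mollifier \<mu> \<kappa> \<Longrightarrow> 0 \<le> \<kappa> z"
  by (simp add: mollifier_def)

lemma mollifier_mono: "mollifier \<mu> \<kappa> \<Longrightarrow> \<mu> \<le> \<delta> \<Longrightarrow> mollifier \<delta> \<kappa>"
  unfolding mollifier_def smooth_kernel_def by (meson order_trans)

lemma smooth_kernel_continuous: "smooth_kernel \<mu> \<kappa> \<Longrightarrow> continuous_on S \<kappa>"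
  unfolding smooth_kernel_def by (blast intro: smooth_expr_continuous_on)

lemma smooth_kernel_measurable: "smooth_kernel \<mu> \<kappa> \<Longrightarrow> \<kappa> \<in> borel_measurable borel"
  by (intro borel_measurable_continuous_onI smooth_kernel_continuous)

lemma smooth_kernel_bounded:
  fixes \<kappa> :: "'a::euclidean_space \<Rightarrow> real"
  assumes "smooth_kernel \<mu> \<kappa>"
  shows "\<exists>C. \<forall>z. norm (\<kappa> z) \<le> C"
  using continuous_vanishing_outside_bounded[OF smooth_kernel_continuous[OF assms], of \<mu>]
    smooth_kernel_eq_0[OF assms] by (meson less_imp_le)

lemma convolve_integrand_integrable:
  fixes g :: "'a::euclidean_space \<Rightarrow> 'b::{banach, second_countable_topology}"
  assumes \<kappa>: "smooth_kernel \<mu> \<kappa>" and g: "integrable lborel g"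
  shows "integrable lborel (\<lambda>z. \<kappa> (y - z) *\<^sub>R g z)"
proof -
  obtain C where C: "\<And>z. norm (\<kappa> z) \<le> C" using smooth_kernel_bounded[OF \<kappa>] by blast
  note [measurable] = smooth_kernel_measurable[OF \<kappa>]
  have [measurable]: "g \<in> borel_measurable borel" using borel_measurable_integrable[OF g] by simp
  show ?thesis
  proof (rule Bochner_Integration.integrable_bound)
    show "integrable lborel (\<lambda>z. C *\<^sub>R norm (g z))" using g by simp
    show "AE z in lborel. norm (\<kappa> (y - z) *\<^sub>R g z) \<le> norm (C *\<^sub>R norm (g z))"
    proof (rule AE_I2)
      fix z
      have "norm (\<kappa> (y - z)) \<le> \<bar>C\<bar>" using C[of "y - z"] by linarith
      then show "norm (\<kappa> (y - z) *\<^sub>R g z) \<le> norm (C *\<^sub>R norm (g z))"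
        by (simp add: abs_mult mult_right_mono)
    qed
  qed measurable
qed

lemma convolve_altdef:
  fixes g :: "'a::euclidean_space \<Rightarrow> 'b::{banach, second_countable_topology}"
  assumes "smooth_kernel \<mu> \<kappa>" "integrable lborel g"
  shows "integrable lborel (\<lambda>z. \<kappa> z *\<^sub>R g (y - z))" "convolve \<kappa> g y = (\<integral>z. \<kappa> z *\<^sub>R g (y - z) \<partial>lborel)"
  using lborel_translate(3,4)[OF convolve_integrand_integrable[OF assms, of y], of y]
  by (simp_all add: convolve_def)

text \<open>A mollification is an average of translates by vectors shorter than the radius of the kernel. By
Tonelli its \<open>L\<^sup>1\<close> distance from \<open>g\<close> is at most the largest \<open>L\<^sup>1\<close> distance of these translates from
\<open>g\<close>, uniformly in the kernel.\<close>

lemma convolve_tendsto_L1: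
  fixes g :: "'a::euclidean_space \<Rightarrow> 'b::{banach, second_countable_topology}"
  assumes g: "integrable lborel g" and e: "e > 0"
  obtains \<delta> where "\<delta> > 0" "\<And>\<kappa>. mollifier \<delta> \<kappa> \<Longrightarrow> integrable lborel (convolve \<kappa> g)"
    "\<And>\<kappa>. mollifier \<delta> \<kappa> \<Longrightarrow> (\<integral>y. norm (convolve \<kappa> g y - g y) \<partial>lborel) \<le> e"
proof -
  let ?T = "\<lambda>z. \<integral>y. norm (g (y - z) - g y) \<partial>lborel"
  have "\<forall>\<^sub>F z in at 0. ?T z < e"
    using translation_continuous_L1[OF g] e by (rule order_tendstoD)
  then obtain \<delta> where \<delta>: "\<delta> > 0" "\<And>z. z \<noteq> 0 \<Longrightarrow> dist z 0 < \<delta> \<Longrightarrow> ?T z < e"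
    unfolding eventually_at by blast
  have T: "?T z \<le> e" if "norm z < \<delta>" for z
    using \<delta>(2)[of z] that e by (cases "z = 0") auto
  have [measurable]: "g \<in> borel_measurable borel" using borel_measurable_integrable[OF g] by simp
  have main: "integrable lborel (convolve \<kappa> g) \<and> (\<integral>y. norm (convolve \<kappa> g y - g y) \<partial>lborel) \<le> e" if \<kappa>: "mollifier \<delta> \<kappa>" for \<kappa>
  proof -
    note [measurable] = smooth_kernel_measurable[OF mollifier_kernel[OF \<kappa>]]
    note nn = mollifier_nonneg[OF \<kappa>] and out = smooth_kernel_eq_0[OF mollifier_kernel[OF \<kappa>]]
    have \<kappa>i: "integrable lborel \<kappa>" "integral\<^sup>L lborel \<kappa> = 1" using \<kappa> unfolding mollifier_def by blast+
    have conv_meas: "convolve \<kappa> g \<in> borel_measurable lborel"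
    proof -
      have "(\<lambda>y. \<integral>z. \<kappa> (y - z) *\<^sub>R g z \<partial>lborel) \<in> borel_measurable lborel" by measurable
      then show ?thesis unfolding convolve_def .
    qed
    have diff: "convolve \<kappa> g y - g y = (\<integral>z. \<kappa> z *\<^sub>R (g (y - z) - g y) \<partial>lborel)"
      and diff_int: "integrable lborel (\<lambda>z. \<kappa> z *\<^sub>R (g (y - z) - g y))" for y
    proof -
      have i: "integrable lborel (\<lambda>z. \<kappa> z *\<^sub>R g y)" using \<kappa>i by simp
      have "(\<integral>z. \<kappa> z *\<^sub>R g y \<partial>lborel) = g y" using \<kappa>i by simp
      then show "convolve \<kappa> g y - g y = (\<integral>z. \<kappa> z *\<^sub>R (g (y - z) - g y) \<partial>lborel)"
        using convolve_altdef[OF mollifier_kernel[OF \<kappa>] g, of y] i by (simp add: scaleR_diff_right)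
      show "integrable lborel (\<lambda>z. \<kappa> z *\<^sub>R (g (y - z) - g y))"
        using convolve_altdef[OF mollifier_kernel[OF \<kappa>] g, of y] i by (simp add: scaleR_diff_right)
    qed
    have Ti: "integrable lborel (\<lambda>y. norm (g (y - z) - g y))" for z
      using lborel_translate(1)[OF g, of z] g by simp
    have "(\<integral>\<^sup>+y. ennreal (norm (convolve \<kappa> g y - g y)) \<partial>lborel)
        \<le> (\<integral>\<^sup>+y. (\<integral>\<^sup>+z. ennreal (\<kappa> z) * ennreal (norm (g (y - z) - g y)) \<partial>lborel) \<partial>lborel)"
    proof (rule nn_integral_mono)
      fix y
      have "ennreal (norm (convolve \<kappa> g y - g y)) \<le> (\<integral>\<^sup>+z. ennreal (norm (\<kappa> z *\<^sub>R (g (y - z) - g y))) \<partial>lborel)"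
        unfolding diff by (rule integral_norm_bound_ennreal[OF diff_int])
      also have "\<dots> = (\<integral>\<^sup>+z. ennreal (\<kappa> z) * ennreal (norm (g (y - z) - g y)) \<partial>lborel)"
        by (intro nn_integral_cong) (simp add: nn ennreal_mult)
      finally show "ennreal (norm (convolve \<kappa> g y - g y)) \<le> \<dots>" .
    qed
    also have "\<dots> = (\<integral>\<^sup>+z. (\<integral>\<^sup>+y. ennreal (\<kappa> z) * ennreal (norm (g (y - z) - g y)) \<partial>lborel) \<partial>lborel)"
      by (rule lborel_pair.Fubini') measurable
    also have "\<dots> \<le> (\<integral>\<^sup>+z. ennreal (\<kappa> z) * ennreal e \<partial>lborel)"
    proof (rule nn_integral_mono)
      fix z
      have "(\<integral>\<^sup>+y. ennreal (\<kappa> z) * ennreal (norm (g (y - z) - g y)) \<partial>lborel) = ennreal (\<kappa> z) * ennreal (?T z)"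
        by (subst nn_integral_cmult) (auto simp: nn_integral_eq_integral[OF Ti])
      also have "\<dots> \<le> ennreal (\<kappa> z) * ennreal e"
        using T[of z] out[of z] by (cases "norm z < \<delta>") (auto intro!: mult_left_mono ennreal_leI)
      finally show "(\<integral>\<^sup>+y. ennreal (\<kappa> z) * ennreal (norm (g (y - z) - g y)) \<partial>lborel) \<le> \<dots>" .
    qed
    also have "\<dots> = ennreal e"
      using \<kappa>i nn by (simp add: nn_integral_multc nn_integral_eq_integral)
    finally have le: "(\<integral>\<^sup>+y. ennreal (norm (convolve \<kappa> g y - g y)) \<partial>lborel) \<le> ennreal e" .
    have id: "integrable lborel (\<lambda>y. convolve \<kappa> g y - g y)"
    proof (rule integrableI_bounded)
      show "(\<integral>\<^sup>+y. ennreal (norm (convolve \<kappa> g y - g y)) \<partial>lborel) < \<infinity>"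
        using le by (rule le_less_trans) simp
    qed (use conv_meas in measurable)
    then have "integrable lborel (\<lambda>y. (convolve \<kappa> g y - g y) + g y)" using g by (rule Bochner_Integration.integrable_add)
    moreover have "(\<integral>y. norm (convolve \<kappa> g y - g y) \<partial>lborel) \<le> e"
      using le e nn_integral_eq_integral[OF integrable_norm[OF id]] by simp
    ultimately show ?thesis by simp
  qed
  show ?thesis using that[of \<delta>] \<delta>(1) main by blast
qed

lemma convolve_AE_subseq:
  fixes g :: "'a::euclidean_space \<Rightarrow> 'b::{banach, second_countable_topology}"
  assumes g: "integrable lborel g" and \<kappa>: "\<And>n. mollifier (\<mu> n) (\<kappa> n)" and \<mu>: "\<mu> \<longlonglongrightarrow> 0"
  obtains r :: "nat \<Rightarrow> nat" where "strict_mono r" "AE y in lborel. (\<lambda>n. convolve (\<kappa> (r n)) g y) \<longlonglongrightarrow> g y"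
proof -
  have ev: "\<forall>\<^sub>F n in sequentially. integrable lborel (convolve (\<kappa> n) g) \<and> (\<integral>y. norm (convolve (\<kappa> n) g y - g y) \<partial>lborel) \<le> e" if "e > 0" for e
  proof -
    obtain \<delta> where \<delta>: "\<delta> > 0" "\<And>\<kappa>. mollifier \<delta> \<kappa> \<Longrightarrow> integrable lborel (convolve \<kappa> g)"
      "\<And>\<kappa>. mollifier \<delta> \<kappa> \<Longrightarrow> (\<integral>y. norm (convolve \<kappa> g y - g y) \<partial>lborel) \<le> e"
      using convolve_tendsto_L1[OF g \<open>e > 0\<close>] by blast
    have "\<forall>\<^sub>F n in sequentially. \<mu> n < \<delta>" using \<mu> \<delta>(1) by (rule order_tendstoD)
    then show ?thesis
    proof eventually_elim
      case (elim n)
      have "mollifier \<delta> (\<kappa> n)" using mollifier_mono[OF \<kappa>[of n]] elim by simp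
      then show ?case using \<delta>(2,3) by blast
    qed
  qed
  obtain N where N: "\<And>n. n \<ge> N \<Longrightarrow> integrable lborel (convolve (\<kappa> n) g)"
    using ev[of 1] unfolding eventually_sequentially by auto
  have "(\<lambda>n. \<integral>y. norm (convolve (\<kappa> n) g y - g y) \<partial>lborel) \<longlonglongrightarrow> 0"
  proof (rule tendstoI)
    fix e :: real assume "e > 0"
    then have "e / 2 > 0" by simp
    from ev[OF this] show "\<forall>\<^sub>F n in sequentially. dist (\<integral>y. norm (convolve (\<kappa> n) g y - g y) \<partial>lborel) 0 < e"
    proof eventually_elim
      case (elim n)
      have "0 \<le> (\<integral>y. norm (convolve (\<kappa> n) g y - g y) \<partial>lborel)" by (rule integral_nonneg_AE) simp
      then show ?case using elim \<open>e > 0\<close> by (simp add: dist_real_def)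
    qed
  qed
  then have "(\<lambda>n. \<integral>y. norm (convolve (\<kappa> (n + N)) g y - g y) \<partial>lborel) \<longlonglongrightarrow> 0"
    by (rule LIMSEQ_ignore_initial_segment)
  moreover have "integrable lborel (\<lambda>y. convolve (\<kappa> (n + N)) g y - g y)" for n
    using N[of "n + N"] g by simp
  ultimately obtain r :: "nat \<Rightarrow> nat" where r: "strict_mono r"
      "AE y in lborel. (\<lambda>n. convolve (\<kappa> (r n + N)) g y - g y) \<longlonglongrightarrow> 0"
    using tendsto_L1_AE_subseq[of lborel "\<lambda>n y. convolve (\<kappa> (n + N)) g y - g y"] by blast
  have "strict_mono (\<lambda>n. r n + N)" using r(1) by (simp add: strict_mono_def)
  moreover have "AE y in lborel. (\<lambda>n. convolve (\<kappa> (r n + N)) g y) \<longlonglongrightarrow> g y"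
    using r(2) by eventually_elim (simp add: LIM_zero_iff)
  ultimately show ?thesis by (rule that)
qed

section \<open>Weak gradients\<close>

text \<open>Integration by parts in its simplest form: the integral of a difference quotient vanishes by translation
invariance.\<close>

lemma integral_directional_derivative_eq_0:
  fixes w :: "'a::euclidean_space \<Rightarrow> real"
  assumes w: "\<And>x. (w has_derivative w' x) (at x)" and cont: "continuous_on UNIV (\<lambda>x. w' x e)"
    and out: "\<And>x. norm x > R \<Longrightarrow> w x = 0"
  shows "(\<integral>x. w' x e \<partial>lborel) = 0"
proof -
  have out': "w' x e = 0" if "norm x > R" for x
  proof -
    have "w' x = (\<lambda>_. 0)"
      by (rule derivative_of_locally_vanishing[OF w, of "- cball 0 R"]) (use that out in auto)
    then show ?thesis by simp
  qed
  have "bounded ((\<lambda>x. w' x e) ` cball 0 R)"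
    by (intro compact_imp_bounded compact_continuous_image continuous_on_subset[OF cont]) auto
  then obtain C where C: "\<And>x. x \<in> cball 0 R \<Longrightarrow> \<bar>w' x e\<bar> \<le> C" unfolding bounded_iff by fastforce
  have bd: "\<bar>w' x e\<bar> \<le> \<bar>C\<bar>" for x
  proof (cases "norm x \<le> R")
    case True
    then show ?thesis using C[of x] by simp
  next
    case False
    then show ?thesis using out'[of x] by simp
  qed
  have wc: "continuous_on UNIV w"
    by (rule continuous_at_imp_continuous_on) (use has_derivative_continuous[OF w] in blast)
  have [measurable]: "w \<in> borel_measurable borel" by (rule borel_measurable_continuous_onI[OF wc])
  have wi: "integrable lborel w"
  proof -
    have "integrable lborel (\<lambda>x. indicator (cball 0 R) x *\<^sub>R w x)"
      by (rule borel_integrable_compact) (auto intro: continuous_on_subset[OF wc])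
    moreover have "(\<lambda>x. indicator (cball 0 R) x *\<^sub>R w x) = w"
      using out by (auto simp: indicator_def fun_eq_iff not_le)
    ultimately show ?thesis by simp
  qed
  have line: "((\<lambda>t. w (x + t *\<^sub>R e)) has_real_derivative w' (x + t *\<^sub>R e) e) (at t)" for x t
    by (rule has_real_derivative_along_line[OF w])
  define t :: "nat \<Rightarrow> real" where "t n = inverse (real (Suc n))" for n
  have t: "t n > 0" "t n \<le> 1" for n by (auto simp: t_def field_simps)
  have t0: "t \<longlonglongrightarrow> 0" unfolding t_def by (rule LIMSEQ_inverse_real_of_nat)
  define q where "q n x = (w (x + t n *\<^sub>R e) - w x) / t n" for n x
  have q0: "(\<integral>x. q n x \<partial>lborel) = 0" for n
  proof -
    have "integrable lborel (\<lambda>x. w (x - (- (t n *\<^sub>R e))))" "(\<integral>x. w (x - (- (t n *\<^sub>R e))) \<partial>lborel) = integral\<^sup>L lborel w"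
      by (rule lborel_translate[OF wi])+
    then show ?thesis using wi by (simp add: q_def)
  qed
  \<comment> \<open>The quotients are dominated because \<open>w\<close> is Lipschitz along \<open>e\<close> and their supports lie in a common ball.\<close>
  have "(\<lambda>n. \<integral>x. q n x \<partial>lborel) \<longlonglongrightarrow> (\<integral>x. w' x e \<partial>lborel)"
  proof (rule integral_dominated_convergence[where w = "\<lambda>x. indicator (cball 0 (R + norm e)) x *\<^sub>R \<bar>C\<bar>"])
    show "integrable lborel (\<lambda>x. indicat_real (cball 0 (R + norm e)) x *\<^sub>R \<bar>C\<bar>)"
      by (rule borel_integrable_compact) auto
    show "(\<lambda>x. w' x e) \<in> borel_measurable lborel"
      using borel_measurable_continuous_onI[OF cont] by simp
    show "q n \<in> borel_measurable lborel" for n unfolding q_def by measurable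
    show "AE x in lborel. (\<lambda>n. q n x) \<longlonglongrightarrow> w' x e"
    proof (rule AE_I2)
      fix x
      have "((\<lambda>h. (w (x + h *\<^sub>R e) - w x) / h) \<longlongrightarrow> w' x e) (at 0)"
        using line[of x 0] by (simp add: DERIV_def)
      then show "(\<lambda>n. q n x) \<longlonglongrightarrow> w' x e"
        unfolding q_def by (rule filterlim_compose) (use t0 t in \<open>auto simp: filterlim_at less_imp_neq[symmetric]\<close>)
    qed
    show "AE x in lborel. norm (q n x) \<le> indicat_real (cball 0 (R + norm e)) x *\<^sub>R \<bar>C\<bar>" for n
    proof (rule AE_I2)
      fix x
      have lip: "norm (q n x) \<le> \<bar>C\<bar>"
      proof -
        obtain s where "w (x + t n *\<^sub>R e) - w (x + 0 *\<^sub>R e) = (t n - 0) * w' (x + s *\<^sub>R e) e"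
          using MVT2[of 0 "t n" "\<lambda>s. w (x + s *\<^sub>R e)" "\<lambda>s. w' (x + s *\<^sub>R e) e"] t(1)[of n] line by blast
        then show ?thesis using bd[of "x + s *\<^sub>R e"] t(1)[of n] by (simp add: q_def)
      qed
      show "norm (q n x) \<le> indicat_real (cball 0 (R + norm e)) x *\<^sub>R \<bar>C\<bar>"
      proof (cases "norm x \<le> R + norm e")
        case True
        then show ?thesis using lip by simp
      next
        case False
        have "norm (t n *\<^sub>R e) \<le> norm e" using t[of n] by (simp add: mult_left_le_one_le)
        then have "norm (x + t n *\<^sub>R e) > R" using False norm_diff_ineq[of x "t n *\<^sub>R e"] by linarith
        moreover have "norm x > R" using False norm_ge_zero[of e] by linarith
        ultimately have "q n x = 0" by (simp add: q_def out)
        then show ?thesis by simp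
      qed
    qed
  qed
  then show ?thesis unfolding q0 using LIMSEQ_unique tendsto_const by metis
qed

lemma test_function_higher_differentiable:
  "test_function \<Omega> \<psi> \<Longrightarrow> higher_differentiable_on r \<psi> UNIV"
  by (simp only: test_function_def)

lemma test_function_has_derivative:
  assumes "test_function \<Omega> \<psi>"
  shows "(\<psi> has_derivative frechet_derivative \<psi> (at x)) (at x)"
  using test_function_higher_differentiable[OF assms, of "Suc 0"]
  by (simp only: higher_differentiable_on.simps frechet_derivative_works[symmetric]) blast

lemma test_function_continuous:
  assumes "test_function \<Omega> \<psi>"
  shows "continuous_on UNIV \<psi>" "continuous_on UNIV (\<lambda>x. frechet_derivative \<psi> (at x) v)"
  using test_function_higher_differentiable[OF assms, of 0]
    test_function_higher_differentiable[OF assms, of "Suc 0"]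
  by (simp_all only: higher_differentiable_on.simps)

lemma test_function_support:
  assumes "test_function \<Omega> \<psi>"
  obtains K where "compact K" "K \<subseteq> \<Omega>" "\<And>x. x \<notin> K \<Longrightarrow> \<psi> x = 0"
    "\<And>x v. x \<notin> K \<Longrightarrow> frechet_derivative \<psi> (at x) v = 0"
proof -
  define K where "K = closure {x. \<psi> x \<noteq> 0}"
  have K: "compact K" "K \<subseteq> \<Omega>" using assms unfolding K_def by (simp_all only: test_function_def)
  have out: "\<psi> x = 0" if "x \<notin> K" for x
  proof (rule ccontr)
    assume "\<psi> x \<noteq> 0"
    then have "x \<in> K" unfolding K_def by (intro subsetD[OF closure_subset]) simp
    with that show False by contradiction
  qed
  have "frechet_derivative \<psi> (at x) v = 0" if "x \<notin> K" for x v
  proof -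
    have "frechet_derivative \<psi> (at x) = (\<lambda>_. 0)"
    proof (rule derivative_of_locally_vanishing[OF test_function_has_derivative[OF assms]])
      show "open (- K)" using compact_imp_closed[OF K(1)] by (rule open_Compl)
      show "x \<in> - K" using that by simp
      show "\<psi> y = 0" if "y \<in> - K" for y using out that by simp
    qed
    then show ?thesis by simp
  qed
  with K out show ?thesis by (rule that)
qed

lemma continuous_set_integrable_compact:
  fixes f :: "'a::euclidean_space \<Rightarrow> 'b::euclidean_space"
  assumes "compact K" "continuous_on K f"
  shows "set_integrable lebesgue K f"
  unfolding set_integrable_def by (rule integrable_completion[THEN iffD2, rotated])
    (use borel_integrable_compact[OF assms] in \<open>auto dest: borel_measurable_integrable\<close>)

lemma continuous_on_locally_integrable:
  "continuous_on \<Omega> u \<Longrightarrow> locally_integrable_on \<Omega> u"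
  unfolding locally_integrable_on_def
  by (blast intro: continuous_set_integrable_compact continuous_on_subset)

text \<open>Everything that occurs in the weak formulation is of this form, a locally integrable function times a
derivative of a test function.\<close>

lemma locally_integrable_mult:
  fixes u :: "'a::euclidean_space \<Rightarrow> real"
  assumes u: "locally_integrable_on \<Omega> u" and f: "continuous_on UNIV f"
    and K: "compact K" "K \<subseteq> \<Omega>" "\<And>x. x \<notin> K \<Longrightarrow> f x = 0"
  shows "set_integrable lebesgue \<Omega> (\<lambda>x. u x * f x)"
proof -
  have "bounded (f ` K)"
    by (intro compact_imp_bounded compact_continuous_image continuous_on_subset[OF f] K) auto
  then obtain C where C: "\<And>x. x \<in> K \<Longrightarrow> norm (f x) \<le> C" unfolding bounded_iff by blast
  have uK: "integrable lebesgue (\<lambda>x. indicator K x *\<^sub>R u x)"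
    using u K unfolding locally_integrable_on_def set_integrable_def by blast
  have fm: "f \<in> borel_measurable lebesgue"
    by (intro measurable_completion) (simp add: borel_measurable_continuous_onI[OF f])
  have "integrable lebesgue (\<lambda>x. (indicator K x *\<^sub>R u x) * f x)"
  proof (rule Bochner_Integration.integrable_bound)
    show "integrable lebesgue (\<lambda>x. C * norm (indicator K x *\<^sub>R u x))" using uK by simp
    show "AE x in lebesgue. norm ((indicator K x *\<^sub>R u x) * f x) \<le> norm (C * norm (indicator K x *\<^sub>R u x))"
    proof (rule AE_I2)
      fix x
      show "norm ((indicator K x *\<^sub>R u x) * f x) \<le> norm (C * norm (indicator K x *\<^sub>R u x))"
      proof (cases "x \<in> K")
        case True
        then have "\<bar>f x\<bar> \<le> \<bar>C\<bar>" using C[of x] by simp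
        then have "\<bar>u x\<bar> * \<bar>f x\<bar> \<le> \<bar>C\<bar> * \<bar>u x\<bar>" by (simp add: mult.commute mult_right_mono)
        then show ?thesis using True by (simp add: abs_mult)
      qed simp
    qed
    show "(\<lambda>x. (indicator K x *\<^sub>R u x) * f x) \<in> borel_measurable lebesgue"
      using borel_measurable_integrable[OF uK] fm by (rule borel_measurable_times)
  qed
  moreover have "(\<lambda>x. (indicator K x *\<^sub>R u x) * f x) = (\<lambda>x. indicator \<Omega> x *\<^sub>R (u x * f x))"
  proof
    fix x
    show "(indicator K x *\<^sub>R u x) * f x = indicator \<Omega> x *\<^sub>R (u x * f x)"
      using K by (cases "x \<in> K") (auto simp: indicator_def)
  qed
  ultimately show ?thesis unfolding set_integrable_def by (simp only:)
qed

lemma locally_integrable_bounded_linear: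
  assumes "bounded_linear L" "locally_integrable_on \<Omega> u"
  shows "locally_integrable_on \<Omega> (\<lambda>x. L (u x))"
  unfolding locally_integrable_on_def set_integrable_def
proof (intro allI impI)
  fix K assume "compact K \<and> K \<subseteq> \<Omega>"
  then have "integrable lebesgue (\<lambda>x. indicator K x *\<^sub>R u x)"
    using assms(2) unfolding locally_integrable_on_def set_integrable_def by blast
  from integrable_bounded_linear[OF assms(1) this]
  show "integrable lebesgue (\<lambda>x. indicator K x *\<^sub>R L (u x))"
    by (simp add: linear_scale[OF bounded_linear.linear[OF assms(1)]])
qed

lemma bounded_linear_entry: "bounded_linear (\<lambda>A::real^'d^'k. A $ i $ j)"
  using bounded_linear_compose[OF bounded_linear_vec_nth[of j] bounded_linear_vec_nth[of i]] by simp

lemmas locally_integrable_component = locally_integrable_bounded_linear[OF bounded_linear_vec_nth]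
lemmas locally_integrable_entry = locally_integrable_bounded_linear[OF bounded_linear_entry]

lemma has_weak_gradient_integrable:
  assumes "has_weak_gradient \<Omega> u G" "test_function \<Omega> \<psi>"
  shows "set_integrable lebesgue \<Omega> (\<lambda>x. u x $ i * frechet_derivative \<psi> (at x) v)"
    "set_integrable lebesgue \<Omega> (\<lambda>x. G x $ i $ j * \<psi> x)"
proof -
  obtain K where K: "compact K" "K \<subseteq> \<Omega>" "\<And>x. x \<notin> K \<Longrightarrow> \<psi> x = 0"
    "\<And>x v. x \<notin> K \<Longrightarrow> frechet_derivative \<psi> (at x) v = 0"
    using test_function_support[OF assms(2)] by blast
  have li: "locally_integrable_on \<Omega> (\<lambda>x. u x $ i)" "locally_integrable_on \<Omega> (\<lambda>x. G x $ i $ j)"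
    using assms(1) unfolding has_weak_gradient_def
    by (blast intro: locally_integrable_component locally_integrable_entry)+
  show "set_integrable lebesgue \<Omega> (\<lambda>x. u x $ i * frechet_derivative \<psi> (at x) v)"
    by (rule locally_integrable_mult[OF li(1) test_function_continuous(2)[OF assms(2)] K(1,2) K(4)])
  show "set_integrable lebesgue \<Omega> (\<lambda>x. G x $ i $ j * \<psi> x)"
    by (rule locally_integrable_mult[OF li(2) test_function_continuous(1)[OF assms(2)] K(1-3)])
qed

text \<open>The product of a component of \<open>u\<close> with a test function, extended by zero, is \<open>C\<^sup>1\<close> on the whole space
with compact support; the integral of its partial derivative vanishes.\<close>

lemma classical_gradient_is_weak:
  fixes u :: "real^'d \<Rightarrow> real^'k"
  assumes \<Omega>: "open \<Omega>" and u: "\<And>x. x \<in> \<Omega> \<Longrightarrow> (u has_derivative (\<lambda>h. Du x *v h)) (at x)"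
    and Du: "continuous_on \<Omega> Du"
  shows "has_weak_gradient \<Omega> u Du"
  unfolding has_weak_gradient_def
proof (intro conjI allI impI)
  have uc: "continuous_on \<Omega> u"
    by (rule continuous_at_imp_continuous_on) (use has_derivative_continuous[OF u] in blast)
  show "locally_integrable_on \<Omega> u" "locally_integrable_on \<Omega> Du"
    using uc Du by (auto intro: continuous_on_locally_integrable)
  fix \<psi> i j assume \<psi>: "test_function \<Omega> \<psi>"
  obtain K where K: "compact K" "K \<subseteq> \<Omega>" "\<And>x. x \<notin> K \<Longrightarrow> \<psi> x = 0"
    "\<And>x v. x \<notin> K \<Longrightarrow> frechet_derivative \<psi> (at x) v = 0"
    using test_function_support[OF \<psi>] by blast
  let ?e = "axis j 1 :: real^'d"
  define w where "w x = (if x \<in> \<Omega> then u x $ i * \<psi> x else 0)" for x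
  define w' where "w' x v = (if x \<in> \<Omega> then u x $ i * frechet_derivative \<psi> (at x) v + (Du x *v v) $ i * \<psi> x else 0)" for x v
  have cases: "x \<in> \<Omega> \<or> x \<in> - K" for x using K(2) by blast
  have oK: "open (- K)" using compact_imp_closed[OF K(1)] by auto
  have der: "(w has_derivative w' x) (at x)" for x
    using cases[of x]
  proof
    assume x: "x \<in> \<Omega>"
    have "((\<lambda>y. u y $ i) has_derivative (\<lambda>h. (Du x *v h) $ i)) (at x)"
      by (rule bounded_linear.has_derivative[OF bounded_linear_vec_nth u[OF x]])
    note has_derivative_mult[OF this test_function_has_derivative[OF \<psi>]]
    moreover have "w' x = (\<lambda>h. u x $ i * frechet_derivative \<psi> (at x) h + (Du x *v h) $ i * \<psi> x)"
      by (rule ext) (simp add: w'_def x)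
    ultimately have "((\<lambda>y. u y $ i * \<psi> y) has_derivative w' x) (at x)" by (simp only:)
    then show ?thesis
      by (rule has_derivative_transform_within_open[OF _ \<Omega> x]) (simp add: w_def)
  next
    assume x: "x \<in> - K"
    have "w' x = (\<lambda>_. 0)" using x K by (auto simp: w'_def fun_eq_iff)
    moreover have "(w has_derivative (\<lambda>_. 0)) (at x)"
      by (rule has_derivative_transform_within_open[OF has_derivative_const[of 0] oK x])
         (use K in \<open>auto simp: w_def\<close>)
    ultimately show ?thesis by simp
  qed
  have cont: "continuous_on UNIV (\<lambda>x. w' x ?e)"
  proof -
    have "continuous_on \<Omega> (\<lambda>x. u x $ i * frechet_derivative \<psi> (at x) ?e + (Du x *v ?e) $ i * \<psi> x)"
      unfolding matrix_vector_mult_basis column_def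
      by (intro continuous_intros uc continuous_on_subset[OF test_function_continuous(1)[OF \<psi>]]
          continuous_on_subset[OF test_function_continuous(2)[OF \<psi>]] Du) auto
    then have "continuous_on \<Omega> (\<lambda>x. w' x ?e)"
      by (rule continuous_on_cong[THEN iffD1, rotated 2]) (auto simp: w'_def)
    moreover have "continuous_on (- K) (\<lambda>x. w' x ?e)"
    proof -
      have "continuous_on (- K) (\<lambda>x. 0::real)" by simp
      then show ?thesis
        by (rule continuous_on_cong[THEN iffD1, rotated 2]) (use K in \<open>auto simp: w'_def\<close>)
    qed
    ultimately have "continuous_on (\<Omega> \<union> - K) (\<lambda>x. w' x ?e)"
      by (intro continuous_on_open_Un \<Omega> oK)
    moreover have "\<Omega> \<union> - K = UNIV" using cases by blast
    ultimately show ?thesis by simp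
  qed
  obtain R where R: "\<And>x. x \<in> K \<Longrightarrow> norm x \<le> R" using compact_imp_bounded[OF K(1)] unfolding bounded_iff by blast
  have "(\<integral>x. w' x ?e \<partial>lborel) = 0"
  proof (rule integral_directional_derivative_eq_0[OF der cont])
    show "w x = 0" if "norm x > R" for x using R[of x] that K(3)[of x] by (auto simp: w_def)
  qed
  then have "(\<integral>x. w' x ?e \<partial>lebesgue) = 0"
    using integral_completion[of "\<lambda>x. w' x ?e" lborel] borel_measurable_continuous_onI[OF cont] by simp
  moreover have "w' x ?e = indicator \<Omega> x *\<^sub>R (u x $ i * frechet_derivative \<psi> (at x) ?e) + indicator \<Omega> x *\<^sub>R (Du x $ i $ j * \<psi> x)" for x
    by (simp add: w'_def indicator_def matrix_vector_mult_basis column_def)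
  moreover have "set_integrable lebesgue \<Omega> (\<lambda>x. u x $ i * frechet_derivative \<psi> (at x) ?e)"
    using continuous_on_locally_integrable[OF uc]
    by (intro locally_integrable_mult[OF _ test_function_continuous(2)[OF \<psi>] K(1,2) K(4)] locally_integrable_component)
  moreover have "set_integrable lebesgue \<Omega> (\<lambda>x. Du x $ i $ j * \<psi> x)"
    using continuous_on_locally_integrable[OF Du]
    by (intro locally_integrable_mult[OF _ test_function_continuous(1)[OF \<psi>] K(1-3)] locally_integrable_entry)
  ultimately show "(LINT x:\<Omega>|lebesgue. u x $ i * frechet_derivative \<psi> (at x) ?e) = - (LINT x:\<Omega>|lebesgue. Du x $ i $ j * \<psi> x)"
    unfolding set_integrable_def set_lebesgue_integral_def by simp
qed

lemma has_weak_gradient_add: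
  assumes "has_weak_gradient \<Omega> u G" "has_weak_gradient \<Omega> v H"
  shows "has_weak_gradient \<Omega> (\<lambda>x. u x + v x) (\<lambda>x. G x + H x)"
  unfolding has_weak_gradient_def
proof (intro conjI allI impI)
  show "locally_integrable_on \<Omega> (\<lambda>x. u x + v x)" "locally_integrable_on \<Omega> (\<lambda>x. G x + H x)"
    using assms unfolding has_weak_gradient_def locally_integrable_on_def
    by (auto intro: set_integral_add(1))
  fix \<psi> i j assume \<psi>: "test_function \<Omega> \<psi>"
  note i = has_weak_gradient_integrable[OF assms(1) \<psi>] has_weak_gradient_integrable[OF assms(2) \<psi>]
  show "(LINT x:\<Omega>|lebesgue. (u x + v x) $ i * frechet_derivative \<psi> (at x) (axis j 1)) =
      - (LINT x:\<Omega>|lebesgue. (G x + H x) $ i $ j * \<psi> x)"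
    using assms \<psi> i unfolding has_weak_gradient_def
    by (simp add: distrib_right set_integral_add(2))
qed

text \<open>Weak gradients are only Lebesgue measurable, while Tonelli's theorem for convolutions asks for
measurability with respect to a product of Borel measures.\<close>

lemma integrable_lebesgue_borel_version:
  fixes g :: "'a::euclidean_space \<Rightarrow> 'b::euclidean_space"
  assumes g: "integrable lebesgue g"
  obtains h where "integrable lborel h" "AE x in lebesgue. g x = h x"
proof -
  have "\<exists>h. h \<in> borel_measurable lborel \<and> (AE x in lborel. g x \<bullet> b = h x)" for b
  proof -
    have "(\<lambda>x. g x \<bullet> b) \<in> borel_measurable lebesgue"
      using borel_measurable_integrable[OF g] by measurable
    from completion_ex_borel_measurable_real[OF this] show ?thesis by blast
  qed
  then obtain H where H: "\<And>b. H b \<in> borel_measurable lborel" "\<And>b. AE x in lborel. g x \<bullet> b = H b x"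
    by metis
  let ?h = "\<lambda>x. \<Sum>b\<in>Basis. H b x *\<^sub>R b"
  have hm: "?h \<in> borel_measurable lborel"
    using H(1) by measurable
  have "AE x in lborel. \<forall>b\<in>Basis. g x \<bullet> b = H b x"
    using H(2) by (simp add: AE_finite_all)
  then have "AE x in lborel. g x = ?h x"
  proof eventually_elim
    case (elim x)
    have "g x = (\<Sum>b\<in>Basis. (g x \<bullet> b) *\<^sub>R b)" by (simp add: euclidean_representation)
    then show ?case using elim by simp
  qed
  then have ae: "AE x in lebesgue. g x = ?h x" by (rule AE_completion)
  have "integrable lebesgue ?h"
    using g by (rule integrable_cong_AE_imp) (use ae hm in \<open>auto intro: measurable_completion simp: eq_commute\<close>)
  then have "integrable lborel ?h" using hm by (simp add: integrable_completion)
  then show ?thesis using ae by (rule that)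
qed

lemma integral_vec_entry:
  fixes f :: "'a \<Rightarrow> real^'d^'k"
  assumes "integrable M f"
  shows "(\<integral>x. f x \<partial>M) $ i $ j = (\<integral>x. f x $ i $ j \<partial>M)"
  using integral_bounded_linear[OF bounded_linear_entry assms] by simp

lemma convolve_lebesgue_version:
  fixes g :: "real^'d \<Rightarrow> real^'d^'k"
  assumes \<kappa>: "mollifier \<mu> \<kappa>" and h: "integrable lborel h" and gh: "AE x in lebesgue. g x = h x"
    and g: "g \<in> borel_measurable lebesgue"
  shows "convolve \<kappa> h y $ i $ j = (\<integral>z. \<kappa> (y - z) * g z $ i $ j \<partial>lebesgue)"
proof -
  note [measurable] = smooth_kernel_measurable[OF mollifier_kernel[OF \<kappa>]]
  have [measurable]: "h \<in> borel_measurable borel" using borel_measurable_integrable[OF h] by simp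
  have entry: "(\<lambda>A::real^'d^'k. A $ i $ j) \<in> borel_measurable borel"
    by (intro borel_measurable_continuous_onI linear_continuous_on bounded_linear_entry)
  have hm: "(\<lambda>z. \<kappa> (y - z) * h z $ i $ j) \<in> borel_measurable lborel"
    by (intro borel_measurable_times measurable_compose[OF _ entry]) measurable
  have km: "(\<lambda>z. \<kappa> (y - z)) \<in> borel_measurable lebesgue" by (rule measurable_completion) measurable
  have "convolve \<kappa> h y $ i $ j = (\<integral>z. (\<kappa> (y - z) *\<^sub>R h z) $ i $ j \<partial>lborel)"
    unfolding convolve_def by (rule integral_vec_entry[OF convolve_integrand_integrable[OF mollifier_kernel[OF \<kappa>] h]])
  also have "\<dots> = (\<integral>z. \<kappa> (y - z) * h z $ i $ j \<partial>lborel)" by simp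
  also have "\<dots> = (\<integral>z. \<kappa> (y - z) * h z $ i $ j \<partial>lebesgue)" using integral_completion[OF hm] by simp
  also have "\<dots> = (\<integral>z. \<kappa> (y - z) * g z $ i $ j \<partial>lebesgue)"
  proof (rule integral_cong_AE)
    show "(\<lambda>z. \<kappa> (y - z) * h z $ i $ j) \<in> borel_measurable lebesgue" using hm by (rule measurable_completion)
    show "(\<lambda>z. \<kappa> (y - z) * g z $ i $ j) \<in> borel_measurable lebesgue"
      by (intro borel_measurable_times km measurable_compose[OF g entry])
    show "AE z in lebesgue. \<kappa> (y - z) * h z $ i $ j = \<kappa> (y - z) * g z $ i $ j"
      using gh by eventually_elim simp
  qed
  finally show ?thesis .
qed

lemma has_weak_gradient_locally_integrable:
  assumes "has_weak_gradient \<Omega> u G"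
  shows "locally_integrable_on \<Omega> u" "locally_integrable_on \<Omega> G"
  by (rule assms[unfolded has_weak_gradient_def, THEN conjunct1],
      rule assms[unfolded has_weak_gradient_def, THEN conjunct2, THEN conjunct1])

lemma has_weak_gradient_integral:
  assumes "has_weak_gradient \<Omega> u G" "test_function \<Omega> \<psi>"
  shows "(LINT x:\<Omega>|lebesgue. u x $ i * frechet_derivative \<psi> (at x) (axis j 1)) =
    - (LINT x:\<Omega>|lebesgue. G x $ i $ j * \<psi> x)"
  by (rule assms(1)[unfolded has_weak_gradient_def, THEN conjunct2, THEN conjunct2, rule_format, OF assms(2)])

text \<open>Locally, testing with reflected mollifiers says that all mollifications of the difference of two weak
gradients vanish; they converge to this difference almost everywhere along a sequence of radii.\<close>

lemma has_weak_gradient_unique: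
  fixes G H :: "real^'d \<Rightarrow> real^'d^'k"
  assumes \<Omega>: "open \<Omega>" and G: "has_weak_gradient \<Omega> u G" and H: "has_weak_gradient \<Omega> u H"
  shows "AE x in lebesgue. x \<in> \<Omega> \<longrightarrow> G x = H x"
proof -
  let ?S = "{x \<in> \<Omega>. G x \<noteq> H x}"
  have "negligible ?S"
  proof (rule locally_negligible_alt[THEN iffD2], rule ballI)
    fix x assume "x \<in> ?S"
    then have "x \<in> \<Omega>" by simp
    with \<Omega> obtain e where e: "e > 0" "cball x e \<subseteq> \<Omega>" unfolding open_contains_cball by blast
    let ?B = "cball x e"
    let ?g = "\<lambda>z. indicator ?B z *\<^sub>R (G z - H z)"
    have sG: "integrable lebesgue (\<lambda>z. indicator ?B z *\<^sub>R G z)" "integrable lebesgue (\<lambda>z. indicator ?B z *\<^sub>R H z)"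
      using has_weak_gradient_locally_integrable(2)[OF G] has_weak_gradient_locally_integrable(2)[OF H] e(2)
      unfolding locally_integrable_on_def set_integrable_def by simp_all
    then have g: "integrable lebesgue ?g" by (simp add: scaleR_diff_right)
    obtain h where h: "integrable lborel h" "AE z in lebesgue. ?g z = h z"
      using integrable_lebesgue_borel_version[OF g] by blast
    have zero: "convolve \<kappa> h y = 0" if \<kappa>: "mollifier \<mu> \<kappa>" and \<mu>: "\<mu> \<le> e / 2" and y: "dist x y < e / 2" for \<kappa> \<mu> y
    proof -
      have sub: "cball y \<mu> \<subseteq> ?B"
      proof
        fix z assume "z \<in> cball y \<mu>"
        then show "z \<in> ?B" using dist_triangle[of x z y] \<mu> y by simp
      qed
      then have \<psi>: "test_function \<Omega> (\<lambda>z. \<kappa> (y - z))"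
        using e(2) by (intro test_function_reflected_mollifier[OF \<kappa>]) blast
      have "convolve \<kappa> h y $ i $ j = 0" for i j
      proof -
        have "convolve \<kappa> h y $ i $ j = (\<integral>z. \<kappa> (y - z) * ?g z $ i $ j \<partial>lebesgue)"
          by (rule convolve_lebesgue_version[OF \<kappa> h borel_measurable_integrable[OF g]])
        also have "\<dots> = (LINT z:\<Omega>|lebesgue. G z $ i $ j * \<kappa> (y - z) - H z $ i $ j * \<kappa> (y - z))"
          unfolding set_lebesgue_integral_def
        proof (rule Bochner_Integration.integral_cong[OF refl])
          fix z
          show "\<kappa> (y - z) * ?g z $ i $ j = indicator \<Omega> z *\<^sub>R (G z $ i $ j * \<kappa> (y - z) - H z $ i $ j * \<kappa> (y - z))"
          proof (cases "z \<in> ?B")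
            case True
            then have "z \<in> \<Omega>" using e(2) by blast
            then show ?thesis using True by (simp add: algebra_simps)
          next
            case False
            then have "z \<notin> cball y \<mu>" using sub by blast
            then have "\<mu> \<le> norm (y - z)" by (simp add: dist_norm)
            then have "\<kappa> (y - z) = 0" by (rule smooth_kernel_eq_0[OF mollifier_kernel[OF \<kappa>]])
            then show ?thesis by simp
          qed
        qed
        also have "\<dots> = (LINT z:\<Omega>|lebesgue. G z $ i $ j * \<kappa> (y - z)) - (LINT z:\<Omega>|lebesgue. H z $ i $ j * \<kappa> (y - z))"
          by (rule set_integral_diff(2)[OF has_weak_gradient_integrable(2)[OF G \<psi>] has_weak_gradient_integrable(2)[OF H \<psi>]])
        also have "(LINT z:\<Omega>|lebesgue. G z $ i $ j * \<kappa> (y - z)) = (LINT z:\<Omega>|lebesgue. H z $ i $ j * \<kappa> (y - z))"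
        proof -
          have "- (LINT z:\<Omega>|lebesgue. G z $ i $ j * \<kappa> (y - z)) = - (LINT z:\<Omega>|lebesgue. H z $ i $ j * \<kappa> (y - z))"
            using has_weak_gradient_integral[OF G \<psi>] has_weak_gradient_integral[OF H \<psi>] by (simp only:)
          then show ?thesis by simp
        qed
        finally show ?thesis by simp
      qed
      then show ?thesis by (simp add: vec_eq_iff)
    qed
    have "e / 2 > 0" using e(1) by simp
    then obtain \<mu> and \<kappa> :: "nat \<Rightarrow> real^'d \<Rightarrow> real" where \<mu>: "\<And>n. \<mu> n \<le> e / 2" and \<mu>0: "\<mu> \<longlonglongrightarrow> 0"
      and \<kappa>: "\<And>n. mollifier (\<mu> n) (\<kappa> n)" using mollifier_sequence by metis
    obtain r where "AE y in lborel. (\<lambda>n. convolve (\<kappa> (r n)) h y) \<longlonglongrightarrow> h y"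
      using convolve_AE_subseq[OF h(1) \<kappa> \<mu>0] by blast
    then have "AE y in lebesgue. (\<lambda>n. convolve (\<kappa> (r n)) h y) \<longlonglongrightarrow> h y" by (rule AE_completion)
    then have "AE y in lebesgue. y \<notin> ?S \<inter> ball x (e / 2)"
      using h(2)
    proof eventually_elim
      case (elim y)
      show ?case
      proof
        assume y: "y \<in> ?S \<inter> ball x (e / 2)"
        then have "dist x y < e / 2" by simp
        then have "(\<lambda>n. convolve (\<kappa> (r n)) h y) = (\<lambda>n. 0)" using zero[OF \<kappa> \<mu>] by blast
        then have "h y = 0" using elim(1) LIMSEQ_unique tendsto_const by metis
        moreover have "y \<in> ?B" using \<open>dist x y < e / 2\<close> e(1) by simp
        ultimately show False using elim(2) y by simp
      qed
    qed
    then obtain N where N: "{y \<in> space lebesgue. \<not> y \<notin> ?S \<inter> ball x (e / 2)} \<subseteq> N" "N \<in> null_sets lebesgue"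
      unfolding eventually_ae_filter by blast
    have "negligible N" using N(2) by (simp add: negligible_iff_null_sets)
    moreover have "?S \<inter> ball x (e / 2) \<subseteq> N" using N(1) by auto
    ultimately have "negligible (?S \<inter> ball x (e / 2))" by (rule negligible_subset)
    then show "\<exists>U. openin (top_of_set ?S) U \<and> x \<in> U \<and> negligible U"
      using \<open>x \<in> ?S\<close> e(1) by (intro exI[of _ "?S \<inter> ball x (e / 2)"]) (simp add: openin_open_Int)
  qed
  then have "AE x in lebesgue. x \<notin> ?S" unfolding negligible_iff_null_sets by (rule AE_not_in)
  then show ?thesis by (rule eventually_mono) simp
qed

lemma has_weak_gradient_weak_gradient:
  assumes "open \<Omega>" "has_weak_gradient \<Omega> u G"
  shows "has_weak_gradient \<Omega> u (weak_gradient \<Omega> u)"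
    "AE x in lebesgue. x \<in> \<Omega> \<longrightarrow> weak_gradient \<Omega> u x = G x"
proof -
  show w: "has_weak_gradient \<Omega> u (weak_gradient \<Omega> u)"
    unfolding weak_gradient_def by (rule someI[of "has_weak_gradient \<Omega> u", OF assms(2)])
  show "AE x in lebesgue. x \<in> \<Omega> \<longrightarrow> weak_gradient \<Omega> u x = G x"
    by (rule has_weak_gradient_unique[OF assms(1) w assms(2)])
qed

section \<open>Mollifying functions that have a weak gradient\<close>

text \<open>Off the closed ball of radius \<open>\<mu>\<close> the kernel vanishes locally, hence so does its derivative; the radius
\<open>\<mu> + 1\<close> lies strictly beyond that ball.\<close>

lemma smooth_kernel_derivative:
  fixes \<kappa> :: "'a::euclidean_space \<Rightarrow> real"
  assumes "smooth_kernel \<mu> \<kappa>"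
  shows "(\<kappa> has_derivative frechet_derivative \<kappa> (at z)) (at z)"
    and "smooth_kernel (\<mu> + 1) (\<lambda>z. frechet_derivative \<kappa> (at z) v)"
proof -
  have sm: "smooth_expr \<kappa>" using assms by (simp add: smooth_kernel_def)
  show der: "(\<kappa> has_derivative frechet_derivative \<kappa> (at z)) (at z)" for z
    using smooth_expr_differentiable[OF sm] by (simp add: frechet_derivative_works)
  have "frechet_derivative \<kappa> (at z) v = 0" if "\<mu> + 1 \<le> norm z" for z
  proof -
    have "frechet_derivative \<kappa> (at z) = (\<lambda>_. 0)"
    proof (rule derivative_of_locally_vanishing[OF der])
      show "open (- cball (0::'a) \<mu>)" by (rule open_Compl[OF closed_cball])
      show "z \<in> - cball 0 \<mu>" using that by simp
      show "\<kappa> y = 0" if "y \<in> - cball 0 \<mu>" for y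
        using that by (intro smooth_kernel_eq_0[OF assms]) simp
    qed
    then show ?thesis by simp
  qed
  then show "smooth_kernel (\<mu> + 1) (\<lambda>z. frechet_derivative \<kappa> (at z) v)"
    using smooth_expr_frechet_derivative[OF sm] by (simp add: smooth_kernel_def)
qed

lemma smooth_kernel_lipschitz:
  fixes \<kappa> :: "'a::euclidean_space \<Rightarrow> real"
  assumes \<kappa>: "smooth_kernel \<mu> \<kappa>"
  shows "\<exists>L\<ge>0. \<forall>x y. \<bar>\<kappa> x - \<kappa> y\<bar> \<le> L * norm (x - y)"
proof -
  have "\<exists>C. \<forall>z. norm (frechet_derivative \<kappa> (at z) v) \<le> C" for v
    using smooth_kernel_bounded[OF smooth_kernel_derivative(2)[OF \<kappa>, of v]] by blast
  then obtain C where C: "\<And>v z. norm (frechet_derivative \<kappa> (at z) v) \<le> C v" by metis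
  let ?L = "\<Sum>b\<in>Basis. C b"
  have C0: "C v \<ge> 0" for v using C[of 0 v] norm_ge_zero order_trans by blast
  have "onorm (frechet_derivative \<kappa> (at z)) \<le> ?L" for z
  proof (rule onorm_bound)
    fix h :: 'a
    have lin: "linear (frechet_derivative \<kappa> (at z))"
      by (rule has_derivative_linear[OF smooth_kernel_derivative(1)[OF \<kappa>]])
    have "frechet_derivative \<kappa> (at z) h = frechet_derivative \<kappa> (at z) (\<Sum>b\<in>Basis. (h \<bullet> b) *\<^sub>R b)"
      by (simp add: euclidean_representation)
    also have "\<dots> = (\<Sum>b\<in>Basis. (h \<bullet> b) *\<^sub>R frechet_derivative \<kappa> (at z) b)"
      using lin by (simp add: linear_sum linear_scale)
    also have "norm \<dots> \<le> (\<Sum>b\<in>Basis. C b * norm h)"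
    proof (rule sum_norm_le)
      fix b :: 'a assume "b \<in> Basis"
      then have "\<bar>h \<bullet> b\<bar> \<le> norm h" by (rule Basis_le_norm)
      then have "\<bar>h \<bullet> b\<bar> * norm (frechet_derivative \<kappa> (at z) b) \<le> norm h * C b"
        by (intro mult_mono C) auto
      then show "norm ((h \<bullet> b) *\<^sub>R frechet_derivative \<kappa> (at z) b) \<le> C b * norm h"
        by (simp add: mult.commute abs_mult)
    qed
    finally show "norm (frechet_derivative \<kappa> (at z) h) \<le> ?L * norm h" by (simp add: sum_distrib_right)
  qed (simp add: sum_nonneg C0)
  note on = this
  have "norm (\<kappa> x - \<kappa> y) \<le> ?L * norm (x - y)" for x y
    by (rule differentiable_bound[OF convex_UNIV smooth_kernel_derivative(1)[OF \<kappa>] on UNIV_I UNIV_I])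
  then have "\<bar>\<kappa> x - \<kappa> y\<bar> \<le> ?L * norm (x - y)" for x y by (simp only: real_norm_def)
  moreover have "?L \<ge> 0" by (simp add: sum_nonneg C0)
  ultimately show ?thesis by blast
qed

text \<open>The remainder is uniform in the base point, so it can be integrated against an arbitrary integrable
function.\<close>

lemma smooth_kernel_taylor:
  fixes \<kappa> :: "'a::euclidean_space \<Rightarrow> real"
  assumes \<kappa>: "smooth_kernel \<mu> \<kappa>"
  shows "\<exists>C\<ge>0.
    \<forall>x h. \<bar>\<kappa> (x + h) - \<kappa> x - frechet_derivative \<kappa> (at x) h\<bar> \<le> C * norm h ^ 2"
proof -
  let ?d = "\<lambda>x h. frechet_derivative \<kappa> (at x) h"
  have "\<exists>L\<ge>0. \<forall>x y. \<bar>?d x v - ?d y v\<bar> \<le> L * norm (x - y)" for v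
    by (rule smooth_kernel_lipschitz[OF smooth_kernel_derivative(2)[OF \<kappa>, of v]])
  then obtain L where L: "\<And>v. L v \<ge> 0" "\<And>v x y. \<bar>?d x v - ?d y v\<bar> \<le> L v * norm (x - y)" by metis
  let ?C = "\<Sum>b\<in>Basis. L b"
  have lin: "linear (?d x)" for x
    by (rule has_derivative_linear[OF smooth_kernel_derivative(1)[OF \<kappa>]])
  have rep: "?d x h = (\<Sum>b\<in>Basis. (h \<bullet> b) * ?d x b)" for x h
  proof -
    have "?d x h = ?d x (\<Sum>b\<in>Basis. (h \<bullet> b) *\<^sub>R b)" by (simp add: euclidean_representation)
    also have "\<dots> = (\<Sum>b\<in>Basis. (h \<bullet> b) *\<^sub>R ?d x b)" using lin by (simp add: linear_sum linear_scale)
    finally show ?thesis by simp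
  qed
  have "\<bar>\<kappa> (x + h) - \<kappa> x - ?d x h\<bar> \<le> ?C * norm h ^ 2" for x h
  proof -
    have line: "((\<lambda>t. \<kappa> (x + t *\<^sub>R h)) has_real_derivative ?d (x + t *\<^sub>R h) h) (at t)" for t
      by (rule has_real_derivative_along_line[OF smooth_kernel_derivative(1)[OF \<kappa>]])
    obtain s where s: "0 < s" "s < 1" "\<kappa> (x + 1 *\<^sub>R h) - \<kappa> (x + 0 *\<^sub>R h) = (1 - 0) * ?d (x + s *\<^sub>R h) h"
      using MVT2[of 0 1 "\<lambda>t. \<kappa> (x + t *\<^sub>R h)" "\<lambda>t. ?d (x + t *\<^sub>R h) h"] line by force
    then have "\<kappa> (x + h) - \<kappa> x - ?d x h = (\<Sum>b\<in>Basis. (h \<bullet> b) * (?d (x + s *\<^sub>R h) b - ?d x b))"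
      using rep[of "x + s *\<^sub>R h" h] rep[of x h] by (simp add: right_diff_distrib sum_subtractf)
    also have "norm \<dots> \<le> (\<Sum>b\<in>Basis. L b * norm h ^ 2)"
    proof (rule sum_norm_le)
      fix b :: 'a assume "b \<in> Basis"
      then have 1: "\<bar>h \<bullet> b\<bar> \<le> norm h" by (rule Basis_le_norm)
      have "\<bar>?d (x + s *\<^sub>R h) b - ?d x b\<bar> \<le> L b * norm (s *\<^sub>R h)" using L(2)[of "x + s *\<^sub>R h" b x] by simp
      also have "\<dots> \<le> L b * norm h" using s L(1) by (intro mult_left_mono) (auto simp: mult_left_le_one_le)
      finally have "\<bar>h \<bullet> b\<bar> * \<bar>?d (x + s *\<^sub>R h) b - ?d x b\<bar> \<le> norm h * (L b * norm h)"
        by (intro mult_mono 1) auto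
      then show "norm ((h \<bullet> b) * (?d (x + s *\<^sub>R h) b - ?d x b)) \<le> L b * norm h ^ 2"
        by (simp only: abs_mult power2_eq_square mult_ac real_norm_def)
    qed
    finally show ?thesis by (simp add: sum_distrib_right)
  qed
  moreover have "?C \<ge> 0" by (simp add: sum_nonneg L(1))
  ultimately show ?thesis by blast
qed

lemma convolve_continuous:
  fixes w :: "'a::euclidean_space \<Rightarrow> 'b::euclidean_space"
  assumes \<kappa>: "smooth_kernel \<mu> \<kappa>" and w: "integrable lborel w"
  shows "continuous_on S (convolve \<kappa> w)"
proof -
  obtain L where L: "L \<ge> 0" "\<And>x y. \<bar>\<kappa> x - \<kappa> y\<bar> \<le> L * norm (x - y)"
    using smooth_kernel_lipschitz[OF \<kappa>] by blast
  let ?I = "\<integral>z. norm (w z) \<partial>lborel"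
  have I0: "?I \<ge> 0" by (rule integral_nonneg_AE) simp
  have "(L * ?I)-lipschitz_on S (convolve \<kappa> w)"
  proof (rule lipschitz_onI)
    fix x y
    note i = convolve_integrand_integrable[OF \<kappa> w]
    have "norm (convolve \<kappa> w x - convolve \<kappa> w y) = norm (\<integral>z. (\<kappa> (x - z) - \<kappa> (y - z)) *\<^sub>R w z \<partial>lborel)"
      unfolding convolve_def using i by (simp add: scaleR_diff_left)
    also have "\<dots> \<le> (\<integral>z. (L * norm (x - y)) * norm (w z) \<partial>lborel)"
    proof (rule Bochner_Integration.integral_norm_bound_integral)
      show "integrable lborel (\<lambda>z. (\<kappa> (x - z) - \<kappa> (y - z)) *\<^sub>R w z)" using i by (simp add: scaleR_diff_left)
      show "integrable lborel (\<lambda>z. (L * norm (x - y)) * norm (w z))" using w by simp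
      show "norm ((\<kappa> (x - z) - \<kappa> (y - z)) *\<^sub>R w z) \<le> (L * norm (x - y)) * norm (w z)" for z
        using mult_right_mono[OF L(2)[of "x - z" "y - z"], of "norm (w z)"] by simp
    qed
    finally show "dist (convolve \<kappa> w x) (convolve \<kappa> w y) \<le> L * ?I * dist x y"
      by (simp add: dist_norm mult_ac)
  qed (simp add: L(1) I0)
  then show ?thesis by (rule lipschitz_on_continuous_on)
qed

lemma convolve_has_derivative:
  fixes w :: "'a::euclidean_space \<Rightarrow> 'b::euclidean_space"
  assumes \<kappa>: "smooth_kernel \<mu> \<kappa>" and w: "integrable lborel w"
  shows "(convolve \<kappa> w has_derivative (\<lambda>h. convolve (\<lambda>z. frechet_derivative \<kappa> (at z) h) w y)) (at y)"
proof -
  let ?d = "\<lambda>x h. frechet_derivative \<kappa> (at x) h"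
  let ?D = "\<lambda>h. convolve (\<lambda>z. ?d z h) w y"
  have lin: "linear (?d x)" for x
    by (rule has_derivative_linear[OF smooth_kernel_derivative(1)[OF \<kappa>]])
  note i = convolve_integrand_integrable[OF \<kappa> w] and
    id = convolve_integrand_integrable[OF smooth_kernel_derivative(2)[OF \<kappa>] w]
  have "linear ?D"
  proof (rule linearI)
    show "?D (a + b) = ?D a + ?D b" for a b
      using id[where y = y] unfolding convolve_def by (simp add: linear_add[OF lin] scaleR_add_left)
    show "?D (c *\<^sub>R a) = c *\<^sub>R ?D a" for c a
    proof -
      have "(\<lambda>z. ?d (y - z) (c *\<^sub>R a) *\<^sub>R w z) = (\<lambda>z. c *\<^sub>R (?d (y - z) a *\<^sub>R w z))"
        by (simp add: linear_scale[OF lin])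
      then show ?thesis unfolding convolve_def by (simp del: scaleR_scaleR)
    qed
  qed
  then have bl: "bounded_linear ?D" by (rule linear_conv_bounded_linear[THEN iffD1])
  obtain C where C: "C \<ge> 0" "\<And>x h. \<bar>\<kappa> (x + h) - \<kappa> x - ?d x h\<bar> \<le> C * norm h ^ 2"
    using smooth_kernel_taylor[OF \<kappa>] by blast
  let ?I = "\<integral>z. norm (w z) \<partial>lborel"
  have est: "norm (convolve \<kappa> w (y + h) - convolve \<kappa> w y - ?D h) \<le> (C * norm h ^ 2) * ?I" for h
  proof -
    have int: "integrable lborel (\<lambda>z. (\<kappa> (y - z + h) - \<kappa> (y - z) - ?d (y - z) h) *\<^sub>R w z)"
      using i[of "y + h"] i[of y] id[of y h] by (simp add: scaleR_diff_left add.commute add_diff_eq)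
    have "convolve \<kappa> w (y + h) - convolve \<kappa> w y - ?D h = (\<integral>z. (\<kappa> (y - z + h) - \<kappa> (y - z) - ?d (y - z) h) *\<^sub>R w z \<partial>lborel)"
      unfolding convolve_def using i[of "y + h"] i[of y] id[of y h]
      by (simp add: scaleR_diff_left add.commute add_diff_eq)
    also have "norm \<dots> \<le> (\<integral>z. (C * norm h ^ 2) * norm (w z) \<partial>lborel)"
    proof (rule Bochner_Integration.integral_norm_bound_integral[OF int])
      show "integrable lborel (\<lambda>z. (C * norm h ^ 2) * norm (w z))" using w by simp
      show "norm ((\<kappa> (y - z + h) - \<kappa> (y - z) - ?d (y - z) h) *\<^sub>R w z) \<le> (C * norm h ^ 2) * norm (w z)" for z
        using mult_right_mono[OF C(2)[of "y - z" h], of "norm (w z)"] by simp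
    qed
    finally show ?thesis by simp
  qed
  show ?thesis
    unfolding has_derivative_at
  proof (intro conjI bl)
    have lim: "((\<lambda>h. (C * ?I) * norm h) \<longlongrightarrow> 0) (at (0::'a))"
      by (rule tendsto_eq_intros | simp)+
    show "(\<lambda>h. norm (convolve \<kappa> w (y + h) - convolve \<kappa> w y - ?D h) / norm h) \<midarrow>0\<rightarrow> 0"
    proof (rule tendsto_sandwich[OF _ _ tendsto_const lim]; intro always_eventually allI)
      fix h :: 'a
      show "norm (convolve \<kappa> w (y + h) - convolve \<kappa> w y - ?D h) / norm h \<le> (C * ?I) * norm h"
        using est[of h] by (cases "h = 0") (simp_all add: divide_le_eq power2_eq_square mult_ac)
    qed simp
  qed
qed

definition convolve_gradient :: "(real^'d \<Rightarrow> real) \<Rightarrow> (real^'d \<Rightarrow> real^'k) \<Rightarrow> real^'d \<Rightarrow> real^'d^'k" where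
  "convolve_gradient \<kappa> w y = matrix (\<lambda>h. convolve (\<lambda>z. frechet_derivative \<kappa> (at z) h) w y)"

lemma convolve_gradient:
  fixes w :: "real^'d \<Rightarrow> real^'k"
  assumes \<kappa>: "smooth_kernel \<mu> \<kappa>" and w: "integrable lborel w"
  shows "(convolve \<kappa> w has_derivative (\<lambda>h. convolve_gradient \<kappa> w y *v h)) (at y)"
    and "continuous_on S (convolve_gradient \<kappa> w)"
    and "convolve_gradient \<kappa> w y $ i $ j = (\<integral>z. frechet_derivative \<kappa> (at (y - z)) (axis j 1) * w z $ i \<partial>lborel)"
proof -
  have lin: "linear (\<lambda>h. convolve (\<lambda>z. frechet_derivative \<kappa> (at z) h) w y)" for y
    by (rule has_derivative_linear[OF convolve_has_derivative[OF assms]])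
  have "(\<lambda>h. convolve_gradient \<kappa> w y *v h) = (\<lambda>h. convolve (\<lambda>z. frechet_derivative \<kappa> (at z) h) w y)"
    unfolding convolve_gradient_def by (rule matrix_vector_mul(2)[OF lin])
  then show "(convolve \<kappa> w has_derivative (\<lambda>h. convolve_gradient \<kappa> w y *v h)) (at y)"
    using convolve_has_derivative[OF assms, of y] by (simp only:)
  have entry: "convolve_gradient \<kappa> w y $ i $ j = convolve (\<lambda>z. frechet_derivative \<kappa> (at z) (axis j 1)) w y $ i" for y i j
    by (simp add: convolve_gradient_def matrix_def)
  show "continuous_on S (convolve_gradient \<kappa> w)"
  proof -
    have "continuous_on S (\<lambda>y. convolve (\<lambda>z. frechet_derivative \<kappa> (at z) (axis j 1)) w y $ i)" for i j
      by (rule bounded_linear.continuous_on[OF bounded_linear_vec_nth convolve_continuous[OF smooth_kernel_derivative(2)[OF \<kappa>] w]])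
    then have "continuous_on S (\<lambda>y. \<chi> i j. convolve_gradient \<kappa> w y $ i $ j)"
      unfolding entry by (intro continuous_on_vec_lambda)
    then show ?thesis by simp
  qed
  show "convolve_gradient \<kappa> w y $ i $ j = (\<integral>z. frechet_derivative \<kappa> (at (y - z)) (axis j 1) * w z $ i \<partial>lborel)"
    unfolding entry convolve_def
    using integral_bounded_linear[OF bounded_linear_vec_nth convolve_integrand_integrable[OF smooth_kernel_derivative(2)[OF \<kappa>] w]]
    by simp
qed

text \<open>A mollifier is a probability density supported near the origin; the next estimates are all averages of
pointwise bounds.\<close>

lemma mollifier_average_le:
  fixes f :: "'a::euclidean_space \<Rightarrow> 'b::euclidean_space"
  assumes \<kappa>: "mollifier \<mu> \<kappa>" and int: "integrable lborel (\<lambda>z. \<kappa> z *\<^sub>R f z)"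
    and le: "AE z in lborel. norm z < \<mu> \<longrightarrow> norm (f z) \<le> e"
  shows "norm (\<integral>z. \<kappa> z *\<^sub>R f z \<partial>lborel) \<le> e"
proof -
  have \<kappa>i: "integrable lborel \<kappa>" "integral\<^sup>L lborel \<kappa> = 1" using \<kappa> by (simp_all add: mollifier_def)
  have "norm (\<integral>z. \<kappa> z *\<^sub>R f z \<partial>lborel) \<le> (\<integral>z. norm (\<kappa> z *\<^sub>R f z) \<partial>lborel)"
    by (rule integral_norm_bound)
  also have "\<dots> \<le> (\<integral>z. \<kappa> z * e \<partial>lborel)"
  proof (rule integral_mono_AE)
    show "AE z in lborel. norm (\<kappa> z *\<^sub>R f z) \<le> \<kappa> z * e"
      using le
    proof eventually_elim
      case (elim z)
      show ?case
      proof (cases "norm z < \<mu>")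
        case True
        then show ?thesis using elim mollifier_nonneg[OF \<kappa>, of z] by (simp add: mult_left_mono)
      next
        case False
        then show ?thesis using smooth_kernel_eq_0[OF mollifier_kernel[OF \<kappa>], of z] by simp
      qed
    qed
    show "integrable lborel (\<lambda>z. norm (\<kappa> z *\<^sub>R f z))" using int by (rule integrable_norm)
    show "integrable lborel (\<lambda>z. \<kappa> z * e)" using \<kappa>i by simp
  qed
  also have "\<dots> = e" using \<kappa>i by simp
  finally show ?thesis .
qed

lemma convolve_norm_le:
  fixes h :: "'a::euclidean_space \<Rightarrow> 'b::euclidean_space"
  assumes \<kappa>: "mollifier \<mu> \<kappa>" and h: "integrable lborel h" and le: "AE z in lborel. norm (h z) \<le> C"
  shows "norm (convolve \<kappa> h y) \<le> C"
proof -
  have \<kappa>i: "integrable lborel \<kappa>" "integral\<^sup>L lborel \<kappa> = 1" using \<kappa> by (simp_all add: mollifier_def)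
  note i = convolve_integrand_integrable[OF mollifier_kernel[OF \<kappa>] h, of y]
  have "norm (convolve \<kappa> h y) \<le> (\<integral>z. norm (\<kappa> (y - z) *\<^sub>R h z) \<partial>lborel)"
    unfolding convolve_def by (rule integral_norm_bound)
  also have "\<dots> \<le> (\<integral>z. \<kappa> (y - z) * C \<partial>lborel)"
  proof (rule integral_mono_AE)
    show "integrable lborel (\<lambda>z. norm (\<kappa> (y - z) *\<^sub>R h z))" using i by (rule integrable_norm)
    show "integrable lborel (\<lambda>z. \<kappa> (y - z) * C)" using lborel_translate(3)[OF \<kappa>i(1), of y] by simp
    show "AE z in lborel. norm (\<kappa> (y - z) *\<^sub>R h z) \<le> \<kappa> (y - z) * C"
      using le by eventually_elim (simp add: mollifier_nonneg[OF \<kappa>] mult_left_mono)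
  qed
  also have "\<dots> = C" using lborel_translate(4)[OF \<kappa>i(1), of y] \<kappa>i(2) by simp
  finally show ?thesis .
qed

lemma convolve_near:
  fixes w :: "'a::euclidean_space \<Rightarrow> 'b::euclidean_space"
  assumes \<kappa>: "mollifier \<mu> \<kappa>" and w: "integrable lborel w"
    and near: "\<And>z. norm z < \<mu> \<Longrightarrow> norm (w (y - z) - w y) \<le> e"
  shows "norm (convolve \<kappa> w y - w y) \<le> e"
proof -
  have \<kappa>i: "integrable lborel \<kappa>" "integral\<^sup>L lborel \<kappa> = 1" using \<kappa> by (simp_all add: mollifier_def)
  note a = convolve_altdef[OF mollifier_kernel[OF \<kappa>] w, of y]
  have c: "integrable lborel (\<lambda>z. \<kappa> z *\<^sub>R w y)" "(\<integral>z. \<kappa> z *\<^sub>R w y \<partial>lborel) = w y" using \<kappa>i by simp_all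
  have eq: "convolve \<kappa> w y - w y = (\<integral>z. \<kappa> z *\<^sub>R (w (y - z) - w y) \<partial>lborel)"
    using a c by (simp add: scaleR_diff_right)
  have "integrable lborel (\<lambda>z. \<kappa> z *\<^sub>R (w (y - z) - w y))"
    using a c by (simp add: scaleR_diff_right)
  then show ?thesis unfolding eq by (rule mollifier_average_le[OF \<kappa>]) (simp add: near)
qed

lemma convolve_lipschitz:
  fixes w :: "'a::euclidean_space \<Rightarrow> 'b::euclidean_space"
  assumes \<kappa>: "mollifier \<mu> \<kappa>" and w: "integrable lborel w"
    and lip: "\<And>x y. norm (w x - w y) \<le> L * norm (x - y)"
  shows "norm (convolve \<kappa> w x - convolve \<kappa> w y) \<le> L * norm (x - y)"
proof -
  note a = convolve_altdef[OF mollifier_kernel[OF \<kappa>] w]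
  have eq: "convolve \<kappa> w x - convolve \<kappa> w y = (\<integral>z. \<kappa> z *\<^sub>R (w (x - z) - w (y - z)) \<partial>lborel)"
    using a[of x] a[of y] by (simp add: scaleR_diff_right)
  have "integrable lborel (\<lambda>z. \<kappa> z *\<^sub>R (w (x - z) - w (y - z)))"
    using a[of x] a[of y] by (simp add: scaleR_diff_right)
  moreover have "norm (w (x - z) - w (y - z)) \<le> L * norm (x - y)" for z
    using lip[of "x - z" "y - z"] by simp
  ultimately show ?thesis unfolding eq by (intro mollifier_average_le[OF \<kappa>]) simp_all
qed

lemma convolve_support:
  assumes \<kappa>: "smooth_kernel \<mu> \<kappa>" and w: "\<And>z. r \<le> norm z \<Longrightarrow> w z = 0" and y: "r + \<mu> \<le> norm y"
  shows "convolve \<kappa> w y = 0"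
proof -
  have "\<kappa> (y - z) *\<^sub>R w z = 0" for z
  proof (cases "r \<le> norm z")
    case False
    have "\<mu> \<le> norm (y - z)" using norm_triangle_ineq2[of y z] False y by linarith
    then show ?thesis using smooth_kernel_eq_0[OF \<kappa>] by simp
  qed (simp add: w)
  then have "(\<lambda>z. \<kappa> (y - z) *\<^sub>R w z) = (\<lambda>_. 0)" by (rule ext)
  then show ?thesis by (simp only: convolve_def Bochner_Integration.integral_zero)
qed

text \<open>Finiteness of the \<open>L\<^sup>\<infinity>\<close> norm only gives measurability of the norm of a function, so measurability of
a weak gradient has to come from its local integrability.\<close>

lemma locally_integrable_measurable:
  fixes G :: "'a::euclidean_space \<Rightarrow> 'b::euclidean_space"
  assumes D: "open D" and G: "locally_integrable_on D G"
  shows "(\<lambda>y. indicator D y *\<^sub>R G y) \<in> borel_measurable lebesgue"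
proof -
  obtain K where K: "\<And>n::nat. compact (K n)" "\<And>n. K n \<subseteq> D" "\<And>C. compact C \<Longrightarrow> C \<subseteq> D \<Longrightarrow> \<exists>N. \<forall>n\<ge>N. C \<subseteq> K n"
    using open_Union_compact_subsets[OF D] by metis
  show ?thesis
  proof (rule borel_measurable_LIMSEQ_metric)
    show "(\<lambda>y. indicator (K n) y *\<^sub>R G y) \<in> borel_measurable lebesgue" for n
      using G K(1,2) unfolding locally_integrable_on_def set_integrable_def
      by (blast intro: borel_measurable_integrable)
    fix y :: 'a
    show "(\<lambda>n. indicator (K n) y *\<^sub>R G y) \<longlonglongrightarrow> indicator D y *\<^sub>R G y"
    proof (cases "y \<in> D")
      case True
      then obtain N where "\<And>n. n \<ge> N \<Longrightarrow> y \<in> K n" using K(3)[of "{y}"] by auto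
      then have "\<forall>\<^sub>F n in sequentially. indicator (K n) y *\<^sub>R G y = indicator D y *\<^sub>R G y"
        using True unfolding eventually_sequentially by (auto intro!: exI[of _ N])
      then show ?thesis by (rule tendsto_eventually)
    next
      case False
      then have "y \<notin> K n" for n using K(2) by blast
      then show ?thesis using False by simp
    qed
  qed
qed

lemma Linf_norm_bounded:
  assumes D: "D \<in> sets lebesgue" and fin: "Linf_norm D G < \<infinity>"
  obtains C where "C \<ge> 0" "AE y in lebesgue. y \<in> D \<longrightarrow> norm (G y) \<le> C"
proof -
  have "AE y in lebesgue_on D. ereal (norm (G y)) \<le> Linf_norm D G"
    unfolding Linf_norm_def by (rule esssup_AE)
  then have ae: "AE y in lebesgue. y \<in> D \<longrightarrow> ereal (norm (G y)) \<le> Linf_norm D G"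
    using D by (subst (asm) AE_restrict_space_iff) auto
  obtain C where C: "Linf_norm D G \<le> ereal C"
    using fin by (cases "Linf_norm D G") auto
  have "AE y in lebesgue. y \<in> D \<longrightarrow> norm (G y) \<le> max C 0"
    using ae
  proof eventually_elim
    case (elim y)
    then show ?case using C order_trans by fastforce
  qed
  then show ?thesis by (intro that[of "max C 0"]) auto
qed

text \<open>Differentiating the kernel and then moving the derivative to \<open>\<phi>\<close> by the weak formulation. This needs
the support of the kernel, centred at \<open>y\<close>, to lie in the domain. The function \<open>w\<close> is an
extension of \<open>\<phi>\<close>, and \<open>h\<close> is a Borel version of the gradient extended by zero.\<close>

lemma convolve_gradient_eq_convolve:
  fixes \<phi> w :: "real^'d \<Rightarrow> real^'k"
  assumes \<phi>: "has_weak_gradient D \<phi> G" and sub: "cball y \<mu> \<subseteq> D" and D: "open D"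
    and w: "integrable lborel w" and wv: "AE z in lebesgue. z \<in> D \<longrightarrow> w z = \<phi> z"
    and h: "integrable lborel h" "AE z in lebesgue. indicator D z *\<^sub>R G z = h z"
    and \<kappa>: "mollifier \<mu> \<kappa>"
  shows "convolve_gradient \<kappa> w y = convolve \<kappa> h y"
proof -
  note kern = mollifier_kernel[OF \<kappa>]
  have \<psi>: "test_function D (\<lambda>z. \<kappa> (y - z))" by (rule test_function_reflected_mollifier[OF \<kappa> sub])
  have d\<psi>: "frechet_derivative (\<lambda>z. \<kappa> (y - z)) (at z) v = - frechet_derivative \<kappa> (at (y - z)) v" for z v
  proof -
    have "((\<lambda>z. y - z) has_derivative (\<lambda>v. - v)) (at z)" by (auto intro!: derivative_eq_intros)
    from has_derivative_compose[OF this smooth_kernel_derivative(1)[OF kern]]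
    have "frechet_derivative (\<lambda>z. \<kappa> (y - z)) (at z) = (\<lambda>v. frechet_derivative \<kappa> (at (y - z)) (- v))"
      by (rule frechet_derivative_at[symmetric])
    then show ?thesis using linear_neg[OF has_derivative_linear[OF smooth_kernel_derivative(1)[OF kern]]] by simp
  qed
  have out: "\<kappa> (y - z) = 0" "frechet_derivative \<kappa> (at (y - z)) v = 0" if "z \<notin> D" for z v
  proof -
    have far: "\<mu> < norm (y - z)" using that sub by (auto simp: dist_norm not_le[symmetric])
    then show "\<kappa> (y - z) = 0" by (intro smooth_kernel_eq_0[OF kern]) simp
    have "frechet_derivative \<kappa> (at (y - z)) = (\<lambda>_. 0)"
    proof (rule derivative_of_locally_vanishing[OF smooth_kernel_derivative(1)[OF kern]])
      show "open (- cball (0::real^'d) \<mu>)" by (rule open_Compl[OF closed_cball])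
      show "y - z \<in> - cball 0 \<mu>" using far by simp
      show "\<kappa> x = 0" if "x \<in> - cball 0 \<mu>" for x using that by (intro smooth_kernel_eq_0[OF kern]) simp
    qed
    then show "frechet_derivative \<kappa> (at (y - z)) v = 0" by simp
  qed
  have gm: "(\<lambda>z. indicator D z *\<^sub>R G z) \<in> borel_measurable lebesgue"
    by (rule locally_integrable_measurable[OF D has_weak_gradient_locally_integrable(2)[OF \<phi>]])
  have "convolve_gradient \<kappa> w y $ i $ j = convolve \<kappa> h y $ i $ j" for i j
  proof -
    let ?d = "\<lambda>z. frechet_derivative \<kappa> (at (y - z)) (axis j 1)"
    have comp: "(\<lambda>x::real^'k. x $ i) \<in> borel_measurable borel" 
      by (intro borel_measurable_continuous_onI linear_continuous_on bounded_linear_vec_nth)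
    have dm: "?d \<in> borel_measurable borel"
      using smooth_kernel_measurable[OF smooth_kernel_derivative(2)[OF kern]] by measurable
    have m1: "(\<lambda>z. ?d z * w z $ i) \<in> borel_measurable lborel"
      using dm measurable_compose[OF borel_measurable_integrable[OF w] comp] by simp
    have m2: "(\<lambda>z. indicator D z *\<^sub>R (\<phi> z $ i * ?d z)) \<in> borel_measurable lebesgue"
    proof -
      have "set_integrable lebesgue D (\<lambda>z. \<phi> z $ i * frechet_derivative (\<lambda>z. \<kappa> (y - z)) (at z) (axis j 1))"
        by (rule has_weak_gradient_integrable(1)[OF \<phi> \<psi>])
      then have "integrable lebesgue (\<lambda>z. - (indicator D z *\<^sub>R (\<phi> z $ i * ?d z)))"
        unfolding set_integrable_def d\<psi> by simp
      then have "(\<lambda>z. - (- (indicator D z *\<^sub>R (\<phi> z $ i * ?d z)))) \<in> borel_measurable lebesgue"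
        by (intro borel_measurable_uminus borel_measurable_integrable)
      then show ?thesis by simp
    qed
    have "convolve_gradient \<kappa> w y $ i $ j = (\<integral>z. ?d z * w z $ i \<partial>lborel)"
      by (rule convolve_gradient(3)[OF kern w])
    also have "\<dots> = (\<integral>z. ?d z * w z $ i \<partial>lebesgue)" by (rule integral_completion[OF m1, symmetric])
    also have "\<dots> = (\<integral>z. indicator D z *\<^sub>R (\<phi> z $ i * ?d z) \<partial>lebesgue)"
    proof (rule integral_cong_AE[OF measurable_completion[OF m1] m2])
      show "AE z in lebesgue. ?d z * w z $ i = indicator D z *\<^sub>R (\<phi> z $ i * ?d z)"
        using wv
      proof eventually_elim
        case (elim z)
        show ?case by (cases "z \<in> D") (use elim out(2)[of z] in auto)
      qed
    qed
    also have "\<dots> = - (LINT z:D|lebesgue. \<phi> z $ i * frechet_derivative (\<lambda>z. \<kappa> (y - z)) (at z) (axis j 1))"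
      unfolding set_lebesgue_integral_def d\<psi> by simp
    also have "\<dots> = (LINT z:D|lebesgue. G z $ i $ j * \<kappa> (y - z))"
      unfolding has_weak_gradient_integral[OF \<phi> \<psi>] by simp
    also have "\<dots> = (\<integral>z. \<kappa> (y - z) * (indicator D z *\<^sub>R G z) $ i $ j \<partial>lebesgue)"
      unfolding set_lebesgue_integral_def by (simp add: mult_ac)
    also have "\<dots> = convolve \<kappa> h y $ i $ j"
      by (rule convolve_lebesgue_version[OF \<kappa> h gm, symmetric])
    finally show ?thesis .
  qed
  then show ?thesis by (simp add: vec_eq_iff)
qed

lemma norm_matrix_le:
  fixes A :: "real^'d^'k"
  assumes "\<And>h. norm (A *v h) \<le> L * norm h"
  shows "norm A \<le> real CARD('k) * (real CARD('d) * L)"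
proof -
  have entry: "\<bar>A $ i $ j\<bar> \<le> L" for i j
  proof -
    have "\<bar>A $ i $ j\<bar> = \<bar>(A *v axis j 1) $ i\<bar>" by (simp add: matrix_vector_mult_basis column_def)
    also have "\<dots> \<le> norm (A *v axis j 1)" by (rule component_le_norm_cart)
    also have "\<dots> \<le> L" using assms[of "axis j 1"] by simp
    finally show ?thesis .
  qed
  have "norm (A $ i) \<le> real CARD('d) * L" for i
  proof -
    have "norm (A $ i) \<le> (\<Sum>j\<in>UNIV. \<bar>A $ i $ j\<bar>)" by (rule norm_le_l1_cart)
    also have "\<dots> \<le> (\<Sum>j\<in>(UNIV::'d set). L)" by (intro sum_mono entry)
    finally show ?thesis by simp
  qed
  then have "(\<Sum>i\<in>UNIV. norm (A $ i)) \<le> (\<Sum>i\<in>(UNIV::'k set). real CARD('d) * L)" by (intro sum_mono)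
  moreover have "norm A \<le> (\<Sum>i\<in>UNIV. norm (A $ i))" unfolding norm_vec_def by (rule L2_set_le_sum) simp
  ultimately show ?thesis by simp
qed

lemma norm_matrix_vector_mult_le:
  fixes A :: "real^'d^'k"
  shows "norm (A *v h) \<le> real CARD('k) * norm A * norm h"
proof -
  have "norm (A *v h) \<le> (\<Sum>i\<in>UNIV. \<bar>(A *v h) $ i\<bar>)" by (rule norm_le_l1_cart)
  also have "\<dots> \<le> (\<Sum>i\<in>(UNIV::'k set). norm A * norm h)"
  proof (rule sum_mono)
    fix i
    have "\<bar>(A *v h) $ i\<bar> = \<bar>A $ i \<bullet> h\<bar>" by (simp add: matrix_vector_mul_component)
    also have "\<dots> \<le> norm (A $ i) * norm h" by (rule Cauchy_Schwarz_ineq2)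
    also have "\<dots> \<le> norm A * norm h" by (intro mult_right_mono Finite_Cartesian_Product.norm_nth_le) auto
    finally show "\<bar>(A *v h) $ i\<bar> \<le> norm A * norm h" .
  qed
  finally show ?thesis by simp
qed

lemma derivative_norm_le_lipschitz:
  fixes f :: "'a::real_normed_vector \<Rightarrow> 'b::real_inner"
  assumes der: "(f has_derivative f') (at y)" and lip: "\<And>a b. norm (f a - f b) \<le> L * norm (a - b)"
  shows "norm (f' h) \<le> L * norm h"
proof -
  let ?u = "f' h"
  have "((\<lambda>z. f z \<bullet> ?u) has_derivative (\<lambda>v. f' v \<bullet> ?u)) (at (y + 0 *\<^sub>R h))"
    using has_derivative_inner_left[OF der] by simp
  from has_real_derivative_along_line[OF this]
  have "((\<lambda>t. f (y + t *\<^sub>R h) \<bullet> ?u) has_real_derivative ?u \<bullet> ?u) (at 0)" .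
  then have lim: "((\<lambda>t. (f (y + t *\<^sub>R h) \<bullet> ?u - f y \<bullet> ?u) / t) \<longlongrightarrow> ?u \<bullet> ?u) (at 0)"
    by (simp add: DERIV_def)
  have "\<forall>\<^sub>F t in at 0. (f (y + t *\<^sub>R h) \<bullet> ?u - f y \<bullet> ?u) / t \<le> L * norm h * norm ?u"
    unfolding eventually_at_filter
  proof (intro always_eventually allI impI)
    fix t :: real assume "t \<noteq> 0"
    have "\<bar>(f (y + t *\<^sub>R h) - f y) \<bullet> ?u\<bar> \<le> norm (f (y + t *\<^sub>R h) - f y) * norm ?u"
      by (rule Cauchy_Schwarz_ineq2)
    also have "\<dots> \<le> (L * (\<bar>t\<bar> * norm h)) * norm ?u"
      using lip[of "y + t *\<^sub>R h" y] by (intro mult_right_mono) auto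
    finally have "\<bar>(f (y + t *\<^sub>R h) - f y) \<bullet> ?u\<bar> / \<bar>t\<bar> \<le> L * norm h * norm ?u"
      using \<open>t \<noteq> 0\<close> by (simp add: field_simps)
    then have "\<bar>((f (y + t *\<^sub>R h) - f y) \<bullet> ?u) / t\<bar> \<le> L * norm h * norm ?u" by (simp only: abs_divide)
    then have "((f (y + t *\<^sub>R h) - f y) \<bullet> ?u) / t \<le> L * norm h * norm ?u" by (rule order_trans[OF abs_ge_self])
    then show "(f (y + t *\<^sub>R h) \<bullet> ?u - f y \<bullet> ?u) / t \<le> L * norm h * norm ?u"
      by (simp add: inner_diff_left)
  qed
  with lim have "?u \<bullet> ?u \<le> L * norm h * norm ?u" by (rule tendsto_upperbound) simp
  then have "norm ?u * norm ?u \<le> (L * norm h) * norm ?u" by (simp add: power2_norm_eq_inner[symmetric] power2_eq_square)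
  moreover have "0 \<le> L * norm h"
  proof -
    have "0 \<le> norm (f (y + h) - f y)" by simp
    also have "\<dots> \<le> L * norm h" using lip[of "y + h" y] by simp
    finally show ?thesis .
  qed
  ultimately show ?thesis by (cases "?u = 0") (auto simp: mult_le_cancel_right)
qed

section \<open>Approximation of test fields on the half ball\<close>

text \<open>Near a segment inside the domain the mollifications have gradients bounded by \<open>C\<close>, so they are
Lipschitz along the segment with a constant independent of the radius. The factor \<open>CARD('k)\<close> comes from
a crude comparison of the operator norm with the Euclidean norm of a matrix.\<close>

lemma weak_gradient_bounded_imp_lipschitz:
  fixes w :: "real^'d \<Rightarrow> real^'k"
  assumes D: "open D" "convex D" and w: "integrable lborel w" and wc: "continuous_on D w"
    and \<phi>: "has_weak_gradient D \<phi> G" and wv: "AE z in lebesgue. z \<in> D \<longrightarrow> w z = \<phi> z"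
    and h: "integrable lborel h" "AE z in lebesgue. indicator D z *\<^sub>R G z = h z"
    and bd: "AE z in lborel. norm (h z) \<le> C" and C: "C \<ge> 0"
  shows "(real CARD('k) * C)-lipschitz_on D w"
proof (rule lipschitz_onI)
  fix a b assume ab: "a \<in> D" "b \<in> D"
  obtain \<mu> and \<kappa> :: "nat \<Rightarrow> real^'d \<Rightarrow> real" where \<mu>: "\<mu> \<longlonglongrightarrow> 0"
    and \<kappa>: "\<And>n. mollifier (\<mu> n) (\<kappa> n)" using mollifier_sequence[OF zero_less_one] by metis
  have "compact (closed_segment a b)" "closed_segment a b \<subseteq> D"
    using ab D(2) by (auto simp: closed_segment_subset)
  then obtain e where e: "e > 0" "(\<Union>x\<in>closed_segment a b. cball x e) \<subseteq> D"
    using compact_subset_open_imp_cball_epsilon_subset[OF _ D(1)] by metis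
  have small: "norm (convolve (\<kappa> n) w a - convolve (\<kappa> n) w b) \<le> (real CARD('k) * C) * norm (a - b)" if n: "\<mu> n < e" for n
  proof (rule differentiable_bound[OF convex_closed_segment[of a b]])
    note kern = mollifier_kernel[OF \<kappa>[of n]]
    show "(convolve (\<kappa> n) w has_derivative (\<lambda>h. convolve_gradient (\<kappa> n) w x *v h)) (at x within closed_segment a b)" for x
      by (rule has_derivative_at_withinI[OF convolve_gradient(1)[OF kern w]])
    fix x assume x: "x \<in> closed_segment a b"
    have "cball x (\<mu> n) \<subseteq> cball x e" using n by (intro subset_cball) simp
    also have "\<dots> \<subseteq> D" using x e(2) by blast
    finally have "convolve_gradient (\<kappa> n) w x = convolve (\<kappa> n) h x"
      by (rule convolve_gradient_eq_convolve[OF \<phi> _ D(1) w wv h \<kappa>])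
    then have "norm (convolve_gradient (\<kappa> n) w x) \<le> C" using convolve_norm_le[OF \<kappa> h(1) bd] by simp
    then have "real CARD('k) * norm (convolve_gradient (\<kappa> n) w x) * norm v \<le> (real CARD('k) * C) * norm v" for v :: "real^'d"
      by (intro mult_right_mono mult_left_mono) auto
    then have "norm (convolve_gradient (\<kappa> n) w x *v v) \<le> (real CARD('k) * C) * norm v" for v
      using norm_matrix_vector_mult_le order_trans by blast
    then show "onorm (\<lambda>h. convolve_gradient (\<kappa> n) w x *v h) \<le> real CARD('k) * C" by (rule onorm_le)
  qed auto
  have conv: "(\<lambda>n. convolve (\<kappa> n) w y) \<longlonglongrightarrow> w y" if y: "y \<in> D" for y
  proof (rule metric_LIMSEQ_I)
    fix r :: real assume r: "r > 0"
    have "isCont w y" using wc D(1) y by (simp add: continuous_on_eq_continuous_at)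
    then obtain s where s: "s > 0" "\<And>x. dist x y < s \<Longrightarrow> dist (w x) (w y) < r / 2"
      using r unfolding continuous_at_eps_delta by (metis half_gt_zero)
    obtain N where N: "\<And>n. n \<ge> N \<Longrightarrow> \<mu> n < s"
      using order_tendstoD(2)[OF \<mu> s(1)] unfolding eventually_sequentially by blast
    have "dist (convolve (\<kappa> n) w y) (w y) < r" if "n \<ge> N" for n
    proof -
      have "norm (convolve (\<kappa> n) w y - w y) \<le> r / 2"
      proof (rule convolve_near[OF \<kappa> w])
        fix z :: "real^'d" assume "norm z < \<mu> n"
        then have "dist (y - z) y < s" using N[OF that] by (simp add: dist_norm)
        then show "norm (w (y - z) - w y) \<le> r / 2" using s(2)[of "y - z"] by (simp add: dist_norm)
      qed
      then show ?thesis using r by (simp add: dist_norm)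
    qed
    then show "\<exists>N. \<forall>n\<ge>N. dist (convolve (\<kappa> n) w y) (w y) < r" by blast
  qed
  have "(\<lambda>n. norm (convolve (\<kappa> n) w a - convolve (\<kappa> n) w b)) \<longlonglongrightarrow> norm (w a - w b)"
    by (intro tendsto_intros conv ab)
  moreover have "\<forall>\<^sub>F n in sequentially. norm (convolve (\<kappa> n) w a - convolve (\<kappa> n) w b) \<le> (real CARD('k) * C) * norm (a - b)"
    using order_tendstoD(2)[OF \<mu> e(1)] by eventually_elim (rule small)
  ultimately show "dist (w a) (w b) \<le> real CARD('k) * C * dist a b"
    unfolding dist_norm by (rule tendsto_upperbound) simp
qed (simp add: C)

text \<open>For a unit vector \<open>\<nu>\<close>, reflects the half space \<open>y \<bullet> \<nu> > 0\<close> onto its complement, which it leaves fixed.\<close>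

definition fold_half_space :: "'a::euclidean_space \<Rightarrow> 'a \<Rightarrow> 'a" where
  "fold_half_space \<nu> y = y - (y \<bullet> \<nu> + \<bar>y \<bullet> \<nu>\<bar>) *\<^sub>R \<nu>"

lemma fold_half_space:
  assumes \<nu>: "norm \<nu> = 1"
  shows "norm (fold_half_space \<nu> a - fold_half_space \<nu> b) \<le> norm (a - b)"
    and "norm (fold_half_space \<nu> a) = norm a"
    and "fold_half_space \<nu> a \<bullet> \<nu> \<le> 0"
    and "a \<bullet> \<nu> \<le> 0 \<Longrightarrow> fold_half_space \<nu> a = a"
proof -
  have \<nu>\<nu>: "\<nu> \<bullet> \<nu> = 1" using \<nu> by (simp add: norm_eq_1)
  \<comment> \<open>Folding only replaces the coordinate \<open>y \<bullet> \<nu>\<close> by \<open>- \<bar>y \<bullet> \<nu>\<bar>\<close>.\<close>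
  have sq: "(norm (fold_half_space \<nu> a - fold_half_space \<nu> b))\<^sup>2
      = (norm (a - b))\<^sup>2 - (a \<bullet> \<nu> - b \<bullet> \<nu>)\<^sup>2 + (\<bar>a \<bullet> \<nu>\<bar> - \<bar>b \<bullet> \<nu>\<bar>)\<^sup>2" for a b
  proof -
    let ?c = "(a \<bullet> \<nu> - b \<bullet> \<nu>) + (\<bar>a \<bullet> \<nu>\<bar> - \<bar>b \<bullet> \<nu>\<bar>)"
    have "fold_half_space \<nu> a - fold_half_space \<nu> b = (a - b) - ?c *\<^sub>R \<nu>"
      by (simp add: fold_half_space_def algebra_simps)
    then have "(norm (fold_half_space \<nu> a - fold_half_space \<nu> b))\<^sup>2 = ((a - b) - ?c *\<^sub>R \<nu>) \<bullet> ((a - b) - ?c *\<^sub>R \<nu>)"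
      by (simp only: power2_norm_eq_inner)
    also have "\<dots> = (a - b) \<bullet> (a - b) - 2 * ?c * ((a - b) \<bullet> \<nu>) + ?c\<^sup>2"
      using \<nu>\<nu> by (simp add: inner_diff_right inner_diff_left inner_commute power2_eq_square algebra_simps)
    also have "(a - b) \<bullet> \<nu> = a \<bullet> \<nu> - b \<bullet> \<nu>" by (simp add: inner_diff_left)
    finally show ?thesis
      unfolding power2_norm_eq_inner[of "a - b"] by (simp add: power2_eq_square algebra_simps)
  qed
  have "(\<bar>a \<bullet> \<nu>\<bar> - \<bar>b \<bullet> \<nu>\<bar>)\<^sup>2 \<le> (a \<bullet> \<nu> - b \<bullet> \<nu>)\<^sup>2"
    by (rule abs_le_square_iff[THEN iffD1]) linarith
  then have "(norm (fold_half_space \<nu> a - fold_half_space \<nu> b))\<^sup>2 \<le> (norm (a - b))\<^sup>2" using sq[of a b] by simp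
  then show "norm (fold_half_space \<nu> a - fold_half_space \<nu> b) \<le> norm (a - b)"
    by (rule power2_le_imp_le) simp
  have "(norm (fold_half_space \<nu> a))\<^sup>2 = (norm a)\<^sup>2"
    using sq[of a 0] by (simp add: fold_half_space_def)
  then show "norm (fold_half_space \<nu> a) = norm a" by (simp add: power2_eq_iff_nonneg)
  show "fold_half_space \<nu> a \<bullet> \<nu> \<le> 0"
    using \<nu>\<nu> by (simp add: fold_half_space_def inner_diff_left)
  show "a \<bullet> \<nu> \<le> 0 \<Longrightarrow> fold_half_space \<nu> a = a" by (simp add: fold_half_space_def)
qed

lemma norm_closest_point_ball:
  fixes y :: "'a::euclidean_space"
  assumes "1 \<le> norm y"
  shows "norm (closest_point (cball 0 1) y) = 1"
proof -
  have "closest_point (cball 0 1) y \<in> cball 0 1" by (rule closest_point_in_set) auto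
  moreover have "dist y (closest_point (cball 0 1) y) \<le> dist y (sgn y)"
    using assms by (intro closest_point_le) (auto simp: norm_sgn)
  moreover have "dist y (sgn y) = norm y - 1"
  proof -
    have "y \<noteq> 0" using assms by auto
    then have "y - sgn y = (norm y - 1) *\<^sub>R sgn y"
      by (simp add: sgn_div_norm algebra_simps)
    then show ?thesis using assms \<open>y \<noteq> 0\<close> by (simp add: dist_norm norm_sgn)
  qed
  ultimately show ?thesis
    using norm_triangle_ineq2[of y "y - closest_point (cball 0 1) y"] by (simp add: dist_norm)
qed

lemma half_ball_facts:
  fixes \<nu> :: "real^'d"
  assumes \<nu>: "norm \<nu> = 1"
  shows "open (half_ball \<nu>)" "convex (half_ball \<nu>)" "half_ball \<nu> \<noteq> {}"
    and "norm y \<le> 1 \<Longrightarrow> y \<bullet> \<nu> \<le> 0 \<Longrightarrow> y \<in> closure (half_ball \<nu>)"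
proof -
  have eq: "half_ball \<nu> = ball 0 1 \<inter> {y. \<nu> \<bullet> y < 0}" by (auto simp: half_ball_def inner_commute)
  show "open (half_ball \<nu>)" unfolding half_ball_def by (rule open_ball_halfspace)
  show "convex (half_ball \<nu>)" unfolding eq by (intro convex_Int convex_ball convex_halfspace_lt)
  have \<nu>\<nu>: "\<nu> \<bullet> \<nu> = 1" using \<nu> by (simp add: norm_eq_1)
  have "(- (1/2)) *\<^sub>R \<nu> \<in> half_ball \<nu>" using \<nu> \<nu>\<nu> by (simp add: half_ball_def)
  then show "half_ball \<nu> \<noteq> {}" by blast
  assume y: "norm y \<le> 1" "y \<bullet> \<nu> \<le> 0"
  define x where "x n = (1 - inverse (real (Suc n))) *\<^sub>R y + inverse (real (Suc n)) *\<^sub>R ((- (1/2)) *\<^sub>R \<nu>)" for n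
  have "x n \<in> half_ball \<nu>" for n
  proof -
    let ?t = "inverse (real (Suc n))"
    have t: "0 < ?t" "?t \<le> 1" by (auto simp: field_simps)
    have "norm (x n) \<le> (1 - ?t) * norm y + ?t * (1/2)"
      unfolding x_def using t \<nu> norm_triangle_ineq[of "(1 - ?t) *\<^sub>R y" "?t *\<^sub>R ((- (1/2)) *\<^sub>R \<nu>)"] by simp
    also have "\<dots> \<le> (1 - ?t) * 1 + ?t * (1/2)" using t y by (intro add_right_mono mult_left_mono) auto
    also have "\<dots> < 1" using t(1) by simp
    finally have "norm (x n) < 1" .
    moreover have "x n \<bullet> \<nu> = (1 - ?t) * (y \<bullet> \<nu>) - ?t / 2" unfolding x_def using \<nu>\<nu> by (simp add: inner_add_left inner_diff_left)
    moreover have "(1 - ?t) * (y \<bullet> \<nu>) \<le> 0" using t y by (intro mult_nonneg_nonpos) auto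
    moreover from calculation(2,3) have "x n \<bullet> \<nu> < 0" using t(1) by linarith
    ultimately show ?thesis by (simp add: half_ball_def)
  qed
  moreover have "x \<longlonglongrightarrow> (1 - 0) *\<^sub>R y + 0 *\<^sub>R ((- (1/2)) *\<^sub>R \<nu>)"
    unfolding x_def by (intro tendsto_intros LIMSEQ_inverse_real_of_nat)
  ultimately show "y \<in> closure (half_ball \<nu>)" unfolding closure_sequential by (intro exI[of _ x]) simp
qed

text \<open>The radius 2 leaves room for the mollification of a function supported in the unit ball.\<close>

definition C1_field :: "(real^'d \<Rightarrow> real^'k) \<Rightarrow> (real^'d \<Rightarrow> real^'d^'k) \<Rightarrow> bool" where
  "C1_field \<Phi> D\<Phi> \<longleftrightarrow> (\<forall>y. (\<Phi> has_derivative (\<lambda>h. D\<Phi> y *v h)) (at y)) \<and> continuous_on UNIV D\<Phi> \<and>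
     (\<forall>y. 2 \<le> norm y \<longrightarrow> \<Phi> y = 0)"

text \<open>The gradients of the approximations are bounded because the extended test function is Lipschitz across
the unit sphere and across the flat face. The two regions in which the gradients converge cover the half
space \<open>y \<bullet> \<nu> < 0\<close> up to a null set, namely a part of the unit sphere.\<close>

lemma half_ball_C1_approximation:
  fixes \<phi> :: "real^'d \<Rightarrow> real^'k"
  assumes \<nu>: "norm \<nu> = 1" and \<phi>: "\<phi> \<in> W1inf (half_ball \<nu>)"
    and van: "vanishes_on_boundary_part (half_ball \<nu>) (frontier (ball 0 1) \<inter> frontier (half_ball \<nu>)) \<phi>"
  shows "\<exists>\<Phi> D\<Phi> L. (\<forall>k::nat. C1_field (\<Phi> k) (D\<Phi> k)) \<and> (\<forall>k y. norm (D\<Phi> k y) \<le> L) \<and>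
    (\<forall>y. 1 < norm y \<longrightarrow> (\<lambda>k. D\<Phi> k y) \<longlonglongrightarrow> 0) \<and>
    (AE y in lebesgue. y \<in> half_ball \<nu> \<longrightarrow> (\<lambda>k. D\<Phi> k y) \<longlonglongrightarrow> weak_gradient (half_ball \<nu>) \<phi> y)"
proof -
  let ?D = "half_ball \<nu>"
  let ?G = "weak_gradient ?D \<phi>"
  note D = half_ball_facts[OF \<nu>]
  have wg: "has_weak_gradient ?D \<phi> ?G"
    using \<phi> has_weak_gradient_weak_gradient(1)[OF D(1)] unfolding W1inf_def by blast
  have fin: "Linf_norm ?D ?G < \<infinity>" using \<phi> unfolding W1inf_def by blast
  have Dm: "?D \<in> sets lebesgue" using D(1) by simp
  obtain C where C: "C \<ge> 0" "AE y in lebesgue. y \<in> ?D \<longrightarrow> norm (?G y) \<le> C"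
    using Linf_norm_bounded[OF Dm fin] by blast
  have Gm: "(\<lambda>y. indicator ?D y *\<^sub>R ?G y) \<in> borel_measurable lebesgue"
    by (rule locally_integrable_measurable[OF D(1) has_weak_gradient_locally_integrable(2)[OF wg]])
  have bD: "bounded ?D" unfolding half_ball_def by (rule bounded_subset[OF bounded_ball[of 0 1]]) auto
  have Gi: "integrable lebesgue (\<lambda>y. indicator ?D y *\<^sub>R ?G y)"
  proof (rule Bochner_Integration.integrable_bound)
    have "?D \<in> lmeasurable" using bD D(1) by (rule lmeasurable_open)
    then show "integrable lebesgue (\<lambda>y. indicator ?D y * C)"
      by (simp add: lmeasurable_iff_integrable)
    show "AE y in lebesgue. norm (indicator ?D y *\<^sub>R ?G y) \<le> norm (indicator ?D y * C)"
      using C(2) by eventually_elim (auto simp: indicator_def C(1))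
  qed (rule Gm)
  obtain h where h: "integrable lborel h" "AE y in lebesgue. indicator ?D y *\<^sub>R ?G y = h y"
    using integrable_lebesgue_borel_version[OF Gi] by blast
  have hm: "h \<in> borel_measurable lborel" by (rule borel_measurable_integrable[OF h(1)])
  have "AE y in lebesgue. norm (h y) \<le> C"
    using h(2) C(2)
  proof eventually_elim
    case (elim y)
    then show ?case using C(1) by (cases "y \<in> ?D") (auto simp: elim(1)[symmetric])
  qed
  then have hC: "AE y in lborel. norm (h y) \<le> C"
    using hm by (subst (asm) AE_completion_iff) auto
  obtain v where v: "continuous_on (closure ?D) v" "AE y in lebesgue_on ?D. v y = \<phi> y"
      "\<And>y. y \<in> frontier (ball 0 1) \<inter> frontier ?D \<Longrightarrow> v y = 0"
    using van unfolding vanishes_on_boundary_part_def by blast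
  have v0: "v y = 0" if "norm y = 1" "y \<bullet> \<nu> \<le> 0" for y
  proof (rule v(3))
    have "y \<in> closure ?D" using D(4) that by simp
    moreover have "y \<notin> ?D" using that by (simp add: half_ball_def)
    ultimately have "y \<in> frontier ?D" using D(1) by (simp add: frontier_def interior_open)
    then show "y \<in> frontier (ball 0 1) \<inter> frontier ?D" using that by (simp add: frontier_ball)
  qed
  \<comment> \<open>Projecting to the ball first makes the extension vanish outside it: the projection then lands on the unit sphere and the fold on the hemisphere, where \<open>v\<close> is zero.\<close>
  define T where "T y = fold_half_space \<nu> (closest_point (cball 0 1) y)" for y
  have T_lip: "norm (T a - T b) \<le> norm (a - b)" for a b
  proof -
    have "norm (T a - T b) \<le> norm (closest_point (cball 0 1) a - closest_point (cball 0 1) b)"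
      unfolding T_def by (rule fold_half_space(1)[OF \<nu>])
    also have "\<dots> \<le> norm (a - b)"
      using closest_point_lipschitz[of "cball 0 1" a b] by (simp add: dist_norm)
    finally show ?thesis .
  qed
  have T_cl: "T y \<in> closure ?D" for y
  proof (rule D(4))
    have "closest_point (cball 0 1) y \<in> cball 0 1" by (rule closest_point_in_set) auto
    then show "norm (T y) \<le> 1" unfolding T_def using fold_half_space(2)[OF \<nu>] by simp
    show "T y \<bullet> \<nu> \<le> 0" unfolding T_def by (rule fold_half_space(3)[OF \<nu>])
  qed
  have T_id: "T y = y" if "y \<in> ?D" for y
    using that fold_half_space(4)[OF \<nu>] by (simp add: T_def half_ball_def closest_point_self)
  define w where "w y = v (T y)" for y
  have w0: "w y = 0" if "1 \<le> norm y" for y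
    unfolding w_def T_def using norm_closest_point_ball[OF that] fold_half_space(2,3)[OF \<nu>] by (intro v0) auto
  have "continuous_on UNIV T"
  proof -
    have "1-lipschitz_on UNIV T" by (rule lipschitz_onI) (use T_lip in \<open>auto simp: dist_norm\<close>)
    then show ?thesis by (rule lipschitz_on_continuous_on)
  qed
  then have wc: "continuous_on UNIV w"
    unfolding w_def by (rule continuous_on_compose2[OF v(1)]) (use T_cl in auto)
  have wi: "integrable lborel w"
  proof -
    have "integrable lborel (\<lambda>x. indicator (cball 0 1) x *\<^sub>R w x)"
      by (rule borel_integrable_compact) (auto intro: continuous_on_subset[OF wc])
    moreover have "(\<lambda>x. indicator (cball 0 1) x *\<^sub>R w x) = w"
      using w0 by (auto simp: indicator_def fun_eq_iff)
    ultimately show ?thesis by simp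
  qed
  have wv: "AE z in lebesgue. z \<in> ?D \<longrightarrow> w z = \<phi> z"
  proof -
    have "AE z in lebesgue. z \<in> ?D \<longrightarrow> v z = \<phi> z"
      using v(2) Dm by (subst (asm) AE_restrict_space_iff) auto
    then show ?thesis by eventually_elim (simp add: w_def T_id)
  qed
  let ?L = "real CARD('k) * C"
  have "?L-lipschitz_on ?D w"
    by (rule weak_gradient_bounded_imp_lipschitz[OF D(1,2) wi continuous_on_subset[OF wc] wg wv h hC C(1)]) simp
  then have "?L-lipschitz_on ?D v"
    by (rule lipschitz_on_transform) (simp add: w_def T_id)
  then have vlip: "?L-lipschitz_on (closure ?D) v" using v(1) by (rule lipschitz_on_closure)
  have wlip: "norm (w a - w b) \<le> ?L * norm (a - b)" for a b
  proof -
    have "norm (w a - w b) \<le> ?L * norm (T a - T b)"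
      using lipschitz_onD[OF vlip T_cl T_cl] by (simp add: w_def dist_norm)
    also have "\<dots> \<le> ?L * norm (a - b)" using T_lip C(1) by (intro mult_left_mono) auto
    finally show ?thesis .
  qed
  obtain \<mu> and \<kappa> :: "nat \<Rightarrow> real^'d \<Rightarrow> real" where \<mu>: "\<And>n. \<mu> n \<le> 1" "\<mu> \<longlonglongrightarrow> 0"
    and \<kappa>: "\<And>n. mollifier (\<mu> n) (\<kappa> n)" using mollifier_sequence[OF zero_less_one] by metis
  obtain r :: "nat \<Rightarrow> nat" where r: "strict_mono r" "AE y in lborel. (\<lambda>n. convolve (\<kappa> (r n)) h y) \<longlonglongrightarrow> h y"
    using convolve_AE_subseq[OF h(1) \<kappa> \<mu>(2)] by blast
  have \<mu>r: "(\<lambda>n. \<mu> (r n)) \<longlonglongrightarrow> 0" using LIMSEQ_subseq_LIMSEQ[OF \<mu>(2) r(1)] by (simp add: o_def)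
  note kern = mollifier_kernel[OF \<kappa>]
  let ?\<Phi> = "\<lambda>n. convolve (\<kappa> (r n)) w" and ?D\<Phi> = "\<lambda>n. convolve_gradient (\<kappa> (r n)) w"
  have der: "(?\<Phi> n has_derivative (\<lambda>h. ?D\<Phi> n y *v h)) (at y)" for n y by (rule convolve_gradient(1)[OF kern wi])
  show ?thesis
  proof (intro exI[of _ ?\<Phi>] exI[of _ ?D\<Phi>] exI[of _ "real CARD('k) * (real CARD('d) * ?L)"] conjI allI impI)
    have "continuous_on UNIV (?D\<Phi> n)" for n by (rule convolve_gradient(2)[OF kern wi])
    moreover have "?\<Phi> n y = 0" if "2 \<le> norm y" for n y
      by (rule convolve_support[OF kern w0]) (use that \<mu>(1)[of "r n"] in auto)
    ultimately show "C1_field (?\<Phi> n) (?D\<Phi> n)" for n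
      using der unfolding C1_field_def by blast
    show "norm (?D\<Phi> n y) \<le> real CARD('k) * (real CARD('d) * ?L)" for n y
      by (rule norm_matrix_le) (rule derivative_norm_le_lipschitz[OF der convolve_lipschitz[OF \<kappa> wi wlip]])
    show "(\<lambda>n. ?D\<Phi> n y) \<longlonglongrightarrow> 0" if y: "1 < norm y" for y
    proof -
      have "norm y - 1 > 0" using y by simp
      from order_tendstoD(2)[OF \<mu>r this] have "\<forall>\<^sub>F n in sequentially. ?D\<Phi> n y = 0"
      proof eventually_elim
        case (elim n)
        have "(\<lambda>h. ?D\<Phi> n y *v h) = (\<lambda>_. 0)"
        proof (rule derivative_of_locally_vanishing[OF der])
          show "open (- cball (0::real^'d) (1 + \<mu> (r n)))" by (rule open_Compl[OF closed_cball])
          show "y \<in> - cball 0 (1 + \<mu> (r n))" using elim by simp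
          show "?\<Phi> n x = 0" if "x \<in> - cball 0 (1 + \<mu> (r n))" for x
            by (rule convolve_support[OF kern w0]) (use that in auto)
        qed
        then show ?case by (rule matrix_eq_0I)
      qed
      then show ?thesis by (rule tendsto_eventually)
    qed
    have "AE y in lebesgue. (\<lambda>n. convolve (\<kappa> (r n)) h y) \<longlonglongrightarrow> h y" using r(2) by (rule AE_completion)
    then show "AE y in lebesgue. y \<in> ?D \<longrightarrow> (\<lambda>n. ?D\<Phi> n y) \<longlonglongrightarrow> ?G y"
      using h(2)
    proof eventually_elim
      case (elim y)
      show ?case
      proof
        assume y: "y \<in> ?D"
        then have hG: "h y = ?G y" using elim(2) by simp
        obtain e where e: "e > 0" "cball y e \<subseteq> ?D" using D(1) y unfolding open_contains_cball by blast
        have "\<forall>\<^sub>F n in sequentially. convolve (\<kappa> (r n)) h y = ?D\<Phi> n y"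
          using order_tendstoD(2)[OF \<mu>r e(1)]
        proof eventually_elim
          case (elim n)
          have "cball y (\<mu> (r n)) \<subseteq> cball y e" using elim by (intro subset_cball) simp
          also have "\<dots> \<subseteq> ?D" by (rule e(2))
          finally show ?case
            by (rule convolve_gradient_eq_convolve[OF wg _ D(1) wi wv h \<kappa>, symmetric])
        qed
        with elim(1) show "(\<lambda>n. ?D\<Phi> n y) \<longlonglongrightarrow> ?G y" unfolding hG[symmetric] by (rule Lim_transform_eventually)
      qed
    qed
  qed
qed

section \<open>Sobolev functions, traces and the energy\<close>

lemma bounded_continuous_set_integrable:
  fixes f :: "'a::euclidean_space \<Rightarrow> 'b::euclidean_space"
  assumes \<Omega>: "open \<Omega>" "bounded \<Omega>" and f: "continuous_on \<Omega> f" "bounded (f ` \<Omega>)"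
  shows "integrable lborel (\<lambda>x. indicator \<Omega> x *\<^sub>R f x)" "set_integrable lebesgue \<Omega> f"
    "(\<lambda>x. indicator \<Omega> x *\<^sub>R f x) \<in> borel_measurable borel"
proof -
  obtain C where C: "\<And>x. x \<in> \<Omega> \<Longrightarrow> norm (f x) \<le> C" using f(2) unfolding bounded_iff by blast
  show m: "(\<lambda>x. indicator \<Omega> x *\<^sub>R f x) \<in> borel_measurable borel"
    by (rule borel_measurable_continuous_on_indicator) (use \<Omega>(1) f(1) in auto)
  show i: "integrable lborel (\<lambda>x. indicator \<Omega> x *\<^sub>R f x)"
  proof (rule Bochner_Integration.integrable_bound)
    have "emeasure lborel \<Omega> < \<infinity>" using emeasure_bounded_finite[OF \<Omega>(2)] by simp
    then show "integrable lborel (\<lambda>x. indicator \<Omega> x * C)" using \<Omega>(1) by simp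
    show "AE x in lborel. norm (indicator \<Omega> x *\<^sub>R f x) \<le> norm (indicator \<Omega> x * C)"
    proof (rule AE_I2)
      fix x
      show "norm (indicator \<Omega> x *\<^sub>R f x) \<le> norm (indicator \<Omega> x * C)"
        using C[of x] by (cases "x \<in> \<Omega>") auto
    qed
  qed (use m in simp)
  show "set_integrable lebesgue \<Omega> f"
    unfolding set_integrable_def using i m by (simp add: integrable_completion)
qed

lemma set_integrable_cong_AE_lebesgue:
  fixes f g :: "'a::euclidean_space \<Rightarrow> 'b::euclidean_space"
  assumes "set_integrable lebesgue \<Omega> g" "AE x in lebesgue. x \<in> \<Omega> \<longrightarrow> f x = g x"
    and "(\<lambda>x. indicator \<Omega> x *\<^sub>R f x) \<in> borel_measurable lebesgue"
  shows "set_integrable lebesgue \<Omega> f"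
  unfolding set_integrable_def
proof (rule integrable_cong_AE_imp[OF assms(1)[unfolded set_integrable_def] assms(3)])
  show "AE x in lebesgue. indicator \<Omega> x *\<^sub>R g x = indicator \<Omega> x *\<^sub>R f x"
    using assms(2) by eventually_elim (auto simp: indicator_def)
qed

lemma weak_gradient_measurable:
  assumes "open \<Omega>" "has_weak_gradient \<Omega> u G"
  shows "(\<lambda>x. indicator \<Omega> x *\<^sub>R weak_gradient \<Omega> u x) \<in> borel_measurable lebesgue"
  by (rule locally_integrable_measurable[OF assms(1)
        has_weak_gradient_locally_integrable(2)[OF has_weak_gradient_weak_gradient(1)[OF assms]]])

lemma W11_classical:
  fixes u :: "real^'d \<Rightarrow> real^'k"
  assumes \<Omega>: "open \<Omega>" "bounded \<Omega>" and u: "\<And>x. x \<in> \<Omega> \<Longrightarrow> (u has_derivative (\<lambda>h. Du x *v h)) (at x)"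
    and Du: "continuous_on \<Omega> Du" and bd: "bounded (u ` \<Omega>)" "bounded (Du ` \<Omega>)"
  shows "u \<in> W11 \<Omega>" "AE x in lebesgue. x \<in> \<Omega> \<longrightarrow> weak_gradient \<Omega> u x = Du x"
proof -
  have w: "has_weak_gradient \<Omega> u Du" by (rule classical_gradient_is_weak[OF \<Omega>(1) u Du])
  show ae: "AE x in lebesgue. x \<in> \<Omega> \<longrightarrow> weak_gradient \<Omega> u x = Du x"
    by (rule has_weak_gradient_weak_gradient(2)[OF \<Omega>(1) w])
  have uc: "continuous_on \<Omega> u"
    by (rule continuous_at_imp_continuous_on) (use has_derivative_continuous[OF u] in blast)
  have "set_integrable lebesgue \<Omega> (weak_gradient \<Omega> u)"
    by (rule set_integrable_cong_AE_lebesgue[OF bounded_continuous_set_integrable(2)[OF \<Omega> Du bd(2)] ae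
          weak_gradient_measurable[OF \<Omega>(1) w]])
  then show "u \<in> W11 \<Omega>"
    using w bounded_continuous_set_integrable(2)[OF \<Omega> uc bd(1)] unfolding W11_def by blast
qed

lemma W11_add:
  assumes \<Omega>: "open \<Omega>" and u: "u \<in> W11 \<Omega>" and v: "v \<in> W11 \<Omega>"
  shows "(\<lambda>x. u x + v x) \<in> W11 \<Omega>"
    "AE x in lebesgue. x \<in> \<Omega> \<longrightarrow> weak_gradient \<Omega> (\<lambda>x. u x + v x) x = weak_gradient \<Omega> u x + weak_gradient \<Omega> v x"
proof -
  have "has_weak_gradient \<Omega> u (weak_gradient \<Omega> u)" "has_weak_gradient \<Omega> v (weak_gradient \<Omega> v)"
    using u v has_weak_gradient_weak_gradient(1)[OF \<Omega>] unfolding W11_def by blast+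
  then have w: "has_weak_gradient \<Omega> (\<lambda>x. u x + v x) (\<lambda>x. weak_gradient \<Omega> u x + weak_gradient \<Omega> v x)"
    by (rule has_weak_gradient_add)
  show ae: "AE x in lebesgue. x \<in> \<Omega> \<longrightarrow> weak_gradient \<Omega> (\<lambda>x. u x + v x) x = weak_gradient \<Omega> u x + weak_gradient \<Omega> v x"
    by (rule has_weak_gradient_weak_gradient(2)[OF \<Omega> w])
  have i: "set_integrable lebesgue \<Omega> u" "set_integrable lebesgue \<Omega> v"
    "set_integrable lebesgue \<Omega> (weak_gradient \<Omega> u)" "set_integrable lebesgue \<Omega> (weak_gradient \<Omega> v)"
    using u v unfolding W11_def by blast+
  have "set_integrable lebesgue \<Omega> (weak_gradient \<Omega> (\<lambda>x. u x + v x))"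
    by (rule set_integrable_cong_AE_lebesgue[OF set_integral_add(1)[OF i(3,4)] ae weak_gradient_measurable[OF \<Omega> w]])
  then show "(\<lambda>x. u x + v x) \<in> W11 \<Omega>"
    using w set_integral_add(1)[OF i(1,2)] unfolding W11_def by blast
qed

text \<open>A function in \<open>W11\<close> that is continuous up to the boundary is its own trace. Adding it to the
approximating sequence leaves all three differences that must tend to zero unchanged.\<close>

lemma has_trace_add_continuous:
  fixes u w :: "real^'d \<Rightarrow> real^'k"
  assumes \<Omega>: "open \<Omega>" and u: "u \<in> W11 \<Omega>" and tr: "has_trace \<Omega> u g"
    and w: "w \<in> W11 \<Omega>" "continuous_on (closure \<Omega>) w"
  shows "has_trace \<Omega> (\<lambda>x. u x + w x) (\<lambda>x. g x + w x)"
proof -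
  let ?H = "hausdorff_measure (CARD('d) - 1) :: (real^'d) measure"
  have sH: "sets ?H = sets borel"
    unfolding hausdorff_measure_def by (simp add: sets_measure_of sets.sigma_sets_eq[of borel, simplified])
  from tr obtain v :: "nat \<Rightarrow> real^'d \<Rightarrow> real^'k" where
    g: "set_borel_measurable ?H (frontier \<Omega>) g" and
    v: "\<And>j. v j \<in> W11 \<Omega>" "\<And>j. continuous_on (closure \<Omega>) (v j)" and
    lim1: "(\<lambda>j. \<integral>\<^sup>+x\<in>\<Omega>. ennreal (norm (v j x - u x)) \<partial>lebesgue) \<longlonglongrightarrow> 0" and
    lim2: "(\<lambda>j. \<integral>\<^sup>+x\<in>\<Omega>. ennreal (norm (weak_gradient \<Omega> (v j) x - weak_gradient \<Omega> u x)) \<partial>lebesgue) \<longlonglongrightarrow> 0" and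
    lim3: "(\<lambda>j. \<integral>\<^sup>+x\<in>frontier \<Omega>. ennreal (norm (v j x - g x)) \<partial>?H) \<longlonglongrightarrow> 0"
    unfolding has_trace_def by blast
  have "(\<lambda>x. indicator (frontier \<Omega>) x *\<^sub>R w x) \<in> borel_measurable borel"
    by (rule borel_measurable_continuous_on_indicator)
       (auto intro: continuous_on_subset[OF w(2)] simp: frontier_def)
  then have wm: "(\<lambda>x. indicator (frontier \<Omega>) x *\<^sub>R w x) \<in> borel_measurable ?H"
    by (simp only: measurable_cong_sets[OF sH refl])
  have "set_borel_measurable ?H (frontier \<Omega>) (\<lambda>x. g x + w x)"
    using borel_measurable_add[OF g[unfolded set_borel_measurable_def] wm]
    unfolding set_borel_measurable_def by (simp add: scaleR_add_right)
  moreover have "(\<lambda>x. v j x + w x) \<in> W11 \<Omega>" for j by (rule W11_add(1)[OF \<Omega> v(1) w(1)])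
  moreover have "continuous_on (closure \<Omega>) (\<lambda>x. v j x + w x)" for j by (intro continuous_on_add v w)
  moreover have "(\<lambda>j. \<integral>\<^sup>+x\<in>\<Omega>. ennreal (norm ((v j x + w x) - (u x + w x))) \<partial>lebesgue) \<longlonglongrightarrow> 0"
    using lim1 by simp
  moreover have "(\<lambda>j. \<integral>\<^sup>+x\<in>\<Omega>. ennreal (norm (weak_gradient \<Omega> (\<lambda>x. v j x + w x) x
      - weak_gradient \<Omega> (\<lambda>x. u x + w x) x)) \<partial>lebesgue) \<longlonglongrightarrow> 0"
  proof -
    have "(\<integral>\<^sup>+x\<in>\<Omega>. ennreal (norm (weak_gradient \<Omega> (\<lambda>x. v j x + w x) x - weak_gradient \<Omega> (\<lambda>x. u x + w x) x)) \<partial>lebesgue)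
      = (\<integral>\<^sup>+x\<in>\<Omega>. ennreal (norm (weak_gradient \<Omega> (v j) x - weak_gradient \<Omega> u x)) \<partial>lebesgue)" for j
    proof (rule nn_integral_cong_AE)
      show "AE x in lebesgue. ennreal (norm (weak_gradient \<Omega> (\<lambda>x. v j x + w x) x - weak_gradient \<Omega> (\<lambda>x. u x + w x) x)) * indicator \<Omega> x
         = ennreal (norm (weak_gradient \<Omega> (v j) x - weak_gradient \<Omega> u x)) * indicator \<Omega> x"
        using W11_add(2)[OF \<Omega> v(1)[of j] w(1)] W11_add(2)[OF \<Omega> u w(1)]
        by eventually_elim (auto simp: indicator_def)
    qed
    then show ?thesis using lim2 by simp
  qed
  moreover have "(\<lambda>j. \<integral>\<^sup>+x\<in>frontier \<Omega>. ennreal (norm ((v j x + w x) - (g x + w x))) \<partial>?H) \<longlonglongrightarrow> 0"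
    using lim3 by simp
  ultimately show ?thesis unfolding has_trace_def by (intro conjI exI[of _ "\<lambda>j x. v j x + w x"]) auto
qed

lemma admissible_add_continuous:
  fixes u m :: "real^'d \<Rightarrow> real^'k"
  assumes \<Omega>: "open \<Omega>" and u: "u \<in> admissible \<Omega> M \<Gamma> n0"
    and w: "w \<in> W11 \<Omega>" "continuous_on (closure \<Omega>) w" and \<Gamma>: "\<And>x. x \<in> \<Gamma> \<Longrightarrow> w x = 0"
    and M: "\<And>x. x \<in> \<Omega> \<Longrightarrow> u x + w x \<in> M"
  shows "(\<lambda>x. u x + w x) \<in> admissible \<Omega> M \<Gamma> n0"
proof -
  have uW: "u \<in> W11 \<Omega>" and tr: "trace_eq_on \<Omega> \<Gamma> u n0" using u unfolding admissible_def W11_into_def by blast+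
  obtain g h where gh: "has_trace \<Omega> u g" "has_trace \<Omega> n0 h"
      "AE x in hausdorff_measure (CARD('d) - 1). x \<in> \<Gamma> \<longrightarrow> g x = h x"
    using tr unfolding trace_eq_on_def by blast
  have "AE x in hausdorff_measure (CARD('d) - 1). x \<in> \<Gamma> \<longrightarrow> g x + w x = h x"
    using gh(3) by eventually_elim (simp add: \<Gamma>)
  then have "trace_eq_on \<Omega> \<Gamma> (\<lambda>x. u x + w x) n0"
    using has_trace_add_continuous[OF \<Omega> uW gh(1) w] gh(2) unfolding trace_eq_on_def by blast
  moreover have "AE x in lebesgue_on \<Omega>. u x + w x \<in> M"
    by (rule AE_I2) (simp add: M)
  ultimately show ?thesis
    using W11_add(1)[OF \<Omega> uW w(1)] unfolding admissible_def W11_into_def by blast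
qed

text \<open>For integrands that are integrable the extended-valued energy is the ordinary integral, so that
energies may be subtracted.\<close>

lemma energy_eq_integral:
  assumes int: "set_integrable lebesgue \<Omega> (\<lambda>x. F x (u x) (Du x))"
    and ae: "AE x in lebesgue. x \<in> \<Omega> \<longrightarrow> weak_gradient \<Omega> u x = Du x"
  shows "energy F \<Omega> u = ereal (LINT x:\<Omega>|lebesgue. F x (u x) (Du x))"
proof -
  let ?f = "\<lambda>x. indicator \<Omega> x *\<^sub>R F x (u x) (Du x)"
  have i: "integrable lebesgue ?f" using int by (simp add: set_integrable_def)
  have pos: "(\<integral>\<^sup>+x\<in>\<Omega>. ennreal (F x (u x) (weak_gradient \<Omega> u x)) \<partial>lebesgue) = (\<integral>\<^sup>+x. ennreal (?f x) \<partial>lebesgue)"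
    by (rule nn_integral_cong_AE) (use ae in eventually_elim, auto simp: indicator_def)
  have neg: "(\<integral>\<^sup>+x\<in>\<Omega>. ennreal (- F x (u x) (weak_gradient \<Omega> u x)) \<partial>lebesgue) = (\<integral>\<^sup>+x. ennreal (- ?f x) \<partial>lebesgue)"
    by (rule nn_integral_cong_AE) (use ae in eventually_elim, auto simp: indicator_def)
  have fin: "(\<integral>\<^sup>+x. ennreal (?f x) \<partial>lebesgue) \<noteq> \<infinity>" "(\<integral>\<^sup>+x. ennreal (- ?f x) \<partial>lebesgue) \<noteq> \<infinity>"
    using i unfolding real_integrable_def by blast+
  define a where "a = enn2real (\<integral>\<^sup>+x. ennreal (?f x) \<partial>lebesgue)"
  define b where "b = enn2real (\<integral>\<^sup>+x. ennreal (- ?f x) \<partial>lebesgue)"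
  have a: "(\<integral>\<^sup>+x. ennreal (?f x) \<partial>lebesgue) = ennreal a"
    unfolding a_def using fin(1) by (intro ennreal_enn2real[symmetric]) (simp add: less_top)
  have b: "(\<integral>\<^sup>+x. ennreal (- ?f x) \<partial>lebesgue) = ennreal b"
    unfolding b_def using fin(2) by (intro ennreal_enn2real[symmetric]) (simp add: less_top)
  have "(LINT x:\<Omega>|lebesgue. F x (u x) (Du x)) = a - b"
    unfolding set_lebesgue_integral_def real_lebesgue_integral_def[OF i] a_def b_def ..
  moreover have "a \<ge> 0" "b \<ge> 0" by (simp_all add: a_def b_def)
  ultimately show ?thesis unfolding energy_def pos neg a b by simp
qed

lemma Linf_norm_le:
  fixes f :: "real^'d \<Rightarrow> 'b::euclidean_space"
  assumes "open \<Omega>" "continuous_on \<Omega> f" "\<And>x. x \<in> \<Omega> \<Longrightarrow> norm (f x) \<le> c"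
  shows "Linf_norm \<Omega> f \<le> ereal c"
  unfolding Linf_norm_def
proof (rule esssup_I)
  have "f \<in> borel_measurable (lebesgue_on \<Omega>)"
    using assms by (intro continuous_imp_measurable_on_sets_lebesgue) auto
  then show "(\<lambda>x. ereal (norm (f x))) \<in> borel_measurable (lebesgue_on \<Omega>)" by measurable
  show "AE x in lebesgue_on \<Omega>. ereal (norm (f x)) \<le> ereal c"
    by (rule AE_I2) (simp add: assms(3))
qed

text \<open>The rescaled domains \<open>(\<Omega> - x) / t\<close> converge pointwise to the half space \<open>y \<bullet> \<nu> < 0\<close>: along a ray
that is not tangential the defining function takes the sign of its derivative, which is a positive
multiple of \<open>y \<bullet> \<nu>\<close>.\<close>

lemma exterior_unit_normal_ray:
  fixes \<nu> :: "real^'d"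
  assumes \<Omega>: "open \<Omega>" and ext: "exterior_unit_normal \<Omega> x \<nu>"
  shows "norm \<nu> = 1"
    and "y \<bullet> \<nu> < 0 \<Longrightarrow> \<forall>\<^sub>F t in at_right 0. x + t *\<^sub>R y \<in> \<Omega>"
    and "y \<bullet> \<nu> > 0 \<Longrightarrow> \<forall>\<^sub>F t in at_right 0. x + t *\<^sub>R y \<notin> \<Omega>"
proof -
  obtain \<rho> r D where x: "x \<in> frontier \<Omega>" and r: "r > 0"
    and hd: "higher_differentiable_on 1 \<rho> (ball x r)"
    and eq: "\<Omega> \<inter> ball x r = {y \<in> ball x r. \<rho> y < (0::real)}"
    and gd: "GDERIV \<rho> x :> D" and D: "D \<noteq> 0" "\<nu> = sgn D"
    using ext unfolding exterior_unit_normal_def by blast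
  show "norm \<nu> = 1" using D by (simp add: norm_sgn)
  have der: "(\<rho> has_derivative (\<lambda>h. h \<bullet> D)) (at x)" using gd by (simp add: gderiv_def)
  have \<rho>x: "\<rho> x = 0"
  proof (rule antisym)
    have "x \<notin> \<Omega>" using x \<Omega> by (simp add: frontier_def interior_open)
    then show "0 \<le> \<rho> x" using eq r by (metis (no_types, lifting) Int_iff centre_in_ball mem_Collect_eq not_le)
    show "\<rho> x \<le> 0"
    proof (rule ccontr)
      assume "\<not> \<rho> x \<le> 0"
      moreover have "isCont \<rho> x" using has_derivative_continuous[OF der] .
      ultimately have "\<forall>\<^sub>F z in nhds x. \<rho> z > 0"
        by (intro order_tendstoD(1)) (auto simp: isCont_def tendsto_at_iff_tendsto_nhds)
      moreover have "\<forall>\<^sub>F z in nhds x. z \<in> ball x r" using r by (intro eventually_nhds_in_open) auto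
      ultimately have "\<forall>\<^sub>F z in nhds x. z \<notin> \<Omega>"
        by eventually_elim (use eq in force)
      then obtain S where S: "open S" "x \<in> S" "\<And>z. z \<in> S \<Longrightarrow> z \<notin> \<Omega>" unfolding eventually_nhds by blast
      then have "x \<notin> closure \<Omega>" using open_Int_closure_eq_empty[of S \<Omega>] by blast
      then show False using x by (simp add: frontier_def)
    qed
  qed
  have near: "\<forall>\<^sub>F t in at_right 0. x + t *\<^sub>R y \<in> ball x r" for y
  proof -
    have "((\<lambda>t. x + t *\<^sub>R y) \<longlongrightarrow> x + 0 *\<^sub>R y) (at_right 0)" by (intro tendsto_intros)
    then show ?thesis using r by (intro topological_tendstoD[of _ x]) auto
  qed
  have line: "((\<lambda>t. \<rho> (x + t *\<^sub>R y)) has_real_derivative y \<bullet> D) (at 0)" for y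
    by (rule has_real_derivative_along_line) (use der in simp)
  have sign: "y \<bullet> \<nu> = (y \<bullet> D) / norm D" for y
    unfolding D(2) sgn_div_norm by (simp add: divide_inverse mult.commute)
  show "\<forall>\<^sub>F t in at_right 0. x + t *\<^sub>R y \<in> \<Omega>" if y: "y \<bullet> \<nu> < 0"
  proof -
    have "y \<bullet> D < 0" using y D(1) unfolding sign by (simp add: divide_less_0_iff)
    from DERIV_neg_dec_right[OF line this] obtain d where d: "d > 0" "\<And>h. h > 0 \<Longrightarrow> h < d \<Longrightarrow> \<rho> (x + h *\<^sub>R y) < 0"
      using \<rho>x by auto
    then have "\<forall>\<^sub>F t in at_right 0. \<rho> (x + t *\<^sub>R y) < 0"
      unfolding eventually_at_right_field by (intro exI[of _ d]) auto
    with near[of y] show ?thesis by eventually_elim (use eq in blast)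
  qed
  show "\<forall>\<^sub>F t in at_right 0. x + t *\<^sub>R y \<notin> \<Omega>" if y: "y \<bullet> \<nu> > 0"
  proof -
    have "y \<bullet> D > 0" using y D(1) unfolding sign by (simp add: zero_less_divide_iff)
    from DERIV_pos_inc_right[OF line this] obtain d where d: "d > 0" "\<And>h. h > 0 \<Longrightarrow> h < d \<Longrightarrow> \<rho> (x + h *\<^sub>R y) > 0"
      using \<rho>x by auto
    then have "\<forall>\<^sub>F t in at_right 0. \<rho> (x + t *\<^sub>R y) > 0"
      unfolding eventually_at_right_field by (intro exI[of _ d]) auto
    with near[of y] show ?thesis by eventually_elim (use eq in force)
  qed
qed

section \<open>Projected variations and their blow-up\<close>

lemma bounded_bilinear_matrix_mult:
  "bounded_bilinear ((**) :: real^'n^'k \<Rightarrow> real^'d^'n \<Rightarrow> real^'d^'k)"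
proof -
  have "bilinear ((**) :: real^'n^'k \<Rightarrow> real^'d^'n \<Rightarrow> real^'d^'k)"
    unfolding bilinear_def
    by (auto intro!: linearI simp: matrix_matrix_mult_def vec_eq_iff sum.distrib sum_distrib_left algebra_simps)
  then show ?thesis by (simp add: bilinear_conv_bounded_bilinear)
qed

lemmas continuous_on_matrix_mult = bounded_bilinear.continuous_on[OF bounded_bilinear_matrix_mult]
lemmas tendsto_matrix_mult = bounded_bilinear.tendsto[OF bounded_bilinear_matrix_mult]

text \<open>The data of the blow-up at a single point \<open>x0\<close>, for a fixed field \<open>\<Phi>\<close>. The nearest point projection
enters as a \<open>C\<^sup>1\<close> retraction of the open set \<open>U\<close> onto \<open>M\<close>.\<close>

locale projected_variation =
  fixes \<Omega> :: "(real^'d) set" and M U :: "(real^'k) set" and P :: "real^'k \<Rightarrow> real^'k"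
    and F :: "real^'d \<Rightarrow> real^'k \<Rightarrow> real^'d^'k \<Rightarrow> real"
    and n :: "real^'d \<Rightarrow> real^'k" and Dn :: "real^'d \<Rightarrow> real^'d^'k" and x0 :: "real^'d"
    and \<Phi> :: "real^'d \<Rightarrow> real^'k" and D\<Phi> :: "real^'d \<Rightarrow> real^'d^'k"
  assumes \<Omega>: "open \<Omega>" "bounded \<Omega>" and M: "compact M" and U: "open U" "M \<subseteq> U"
    and P_in: "\<And>u. u \<in> U \<Longrightarrow> P u \<in> M" and P_id: "\<And>u. u \<in> M \<Longrightarrow> P u = u"
    and P_der: "\<And>u. u \<in> U \<Longrightarrow> (P has_derivative (\<lambda>h. jacobian P (at u) *v h)) (at u)"
    and P_cont: "continuous_on U (\<lambda>u. jacobian P (at u))"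
    and F: "continuous_on (closure \<Omega> \<times> M \<times> UNIV) (\<lambda>(x, u, A). F x u A)"
    and n: "C1_closure_gradient \<Omega> n Dn" and nM: "n ` closure \<Omega> \<subseteq> M"
    and x0: "x0 \<in> closure \<Omega>"
    and \<Phi>: "C1_field \<Phi> D\<Phi>"
begin

lemma \<Phi>_der: "(\<Phi> has_derivative (\<lambda>h. D\<Phi> y *v h)) (at y)" and D\<Phi>: "continuous_on UNIV D\<Phi>"
  and \<Phi>_out: "2 \<le> norm y \<Longrightarrow> \<Phi> y = 0"
  using \<Phi> unfolding C1_field_def by blast+

definition "perturbed \<epsilon> x = n x + \<epsilon> *\<^sub>R \<Phi> ((x - x0) /\<^sub>R \<epsilon>)"
definition "variation \<epsilon> x = P (perturbed \<epsilon> x)"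
definition "D_variation \<epsilon> x = jacobian P (at (perturbed \<epsilon> x)) ** (Dn x + D\<Phi> ((x - x0) /\<^sub>R \<epsilon>))"

lemma n_cont: "continuous_on (closure \<Omega>) n" and Dn_cont: "continuous_on (closure \<Omega>) Dn"
  and n_der: "x \<in> \<Omega> \<Longrightarrow> (n has_derivative (\<lambda>h. Dn x *v h)) (at x)"
  using n unfolding C1_closure_gradient_def by blast+

lemma compact_closure_\<Omega>: "compact (closure \<Omega>)"
  using \<Omega>(2) by simp

lemma \<Phi>_cont: "continuous_on UNIV \<Phi>"
  by (rule continuous_at_imp_continuous_on) (use has_derivative_continuous[OF \<Phi>_der] in blast)

lemma D\<Phi>_out: "2 < norm y \<Longrightarrow> D\<Phi> y = 0"
proof -
  assume y: "2 < norm y"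
  have "(\<lambda>h. D\<Phi> y *v h) = (\<lambda>_. 0)"
  proof (rule derivative_of_locally_vanishing[OF \<Phi>_der])
    show "open (- cball (0::real^'d) 2)" by (rule open_Compl[OF closed_cball])
    show "y \<in> - cball 0 2" using y by simp
    show "\<Phi> x = 0" if "x \<in> - cball 0 2" for x using that by (intro \<Phi>_out) simp
  qed
  then show "D\<Phi> y = 0" by (rule matrix_eq_0I)
qed

text \<open>Differentiating \<open>P \<circ> n = n\<close> in \<open>\<Omega>\<close>; both sides are continuous up to the boundary, which is where the
identity is used.\<close>

lemma jacobian_Dn: "x \<in> closure \<Omega> \<Longrightarrow> jacobian P (at (n x)) ** Dn x = Dn x"
proof -
  have zero: "jacobian P (at (n x)) ** Dn x - Dn x = 0" if x: "x \<in> \<Omega>" for x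
  proof -
    have nx: "n x \<in> U" using x nM U(2) closure_subset by blast
    have "((\<lambda>x. P (n x)) has_derivative (\<lambda>h. jacobian P (at (n x)) *v (Dn x *v h))) (at x)"
      by (rule has_derivative_compose[OF n_der[OF x] P_der[OF nx]])
    moreover have "((\<lambda>x. P (n x)) has_derivative (\<lambda>h. Dn x *v h)) (at x)"
    proof (rule has_derivative_transform_within_open[OF n_der[OF x] \<Omega>(1) x])
      show "n y = P (n y)" if "y \<in> \<Omega>" for y
      proof -
        have "y \<in> closure \<Omega>" using that closure_subset by blast
        then show ?thesis using P_id nM by (metis image_subset_iff)
      qed
    qed
    ultimately have "(\<lambda>h. jacobian P (at (n x)) *v (Dn x *v h)) = (\<lambda>h. Dn x *v h)"
      by (rule has_derivative_unique)
    then have "(jacobian P (at (n x)) ** Dn x) *v h = Dn x *v h" for h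
      by (simp add: matrix_vector_mul_assoc[symmetric] fun_eq_iff)
    then have "jacobian P (at (n x)) ** Dn x = Dn x" by (simp only: matrix_eq) simp
    then show ?thesis by simp
  qed
  have cont: "continuous_on (closure \<Omega>) (\<lambda>x. jacobian P (at (n x)) ** Dn x - Dn x)"
    using nM U(2) by (intro continuous_on_diff continuous_on_matrix_mult Dn_cont
        continuous_on_compose2[OF P_cont n_cont]) auto
  assume x: "x \<in> closure \<Omega>"
  have "jacobian P (at (n x)) ** Dn x - Dn x = 0"
  proof (rule continuous_constant_on_closure[where f = "\<lambda>x. jacobian P (at (n x)) ** Dn x - Dn x", OF cont])
    show "jacobian P (at (n y)) ** Dn y - Dn y = 0" if "y \<in> \<Omega>" for y by (rule zero[OF that])
  qed (rule x)
  then show ?thesis by simp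
qed

lemma F_bounded:
  obtains C where "\<And>x u A. x \<in> closure \<Omega> \<Longrightarrow> u \<in> M \<Longrightarrow> norm A \<le> B \<Longrightarrow> \<bar>F x u A\<bar> \<le> C"
proof -
  let ?K = "closure \<Omega> \<times> M \<times> cball (0::real^'d^'k) B"
  have "bounded ((\<lambda>(x, u, A). F x u A) ` ?K)"
    by (intro compact_imp_bounded compact_continuous_image continuous_on_subset[OF F] compact_Times
        compact_closure_\<Omega> M compact_cball) auto
  then obtain C where C: "\<And>z. z \<in> ?K \<Longrightarrow> norm ((\<lambda>(x, u, A). F x u A) z) \<le> C" unfolding bounded_iff by blast
  show ?thesis
  proof (rule that[of C])
    show "\<bar>F x u A\<bar> \<le> C" if "x \<in> closure \<Omega>" "u \<in> M" "norm A \<le> B" for x u A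
      using C[of "(x, u, A)"] that by simp
  qed
qed

lemma F_integrand_continuous:
  assumes "continuous_on S u" "continuous_on S A" "S \<subseteq> closure \<Omega>" "\<And>x. x \<in> S \<Longrightarrow> u x \<in> M"
  shows "continuous_on S (\<lambda>x. F x (u x) (A x))"
proof -
  have "continuous_on S (\<lambda>x. (x, u x, A x))" by (intro continuous_on_Pair continuous_on_id assms)
  then have "continuous_on S (\<lambda>x. (\<lambda>(x, u, A). F x u A) (x, u x, A x))"
    by (rule continuous_on_compose2[OF F]) (use assms(3,4) in auto)
  then show ?thesis by simp
qed

text \<open>The constants that do not depend on \<open>\<epsilon>\<close>: perturbed maps stay in a compact part \<open>N\<close> of \<open>U\<close>, at distance
at most \<open>\<epsilon> C\<close> from \<open>n\<close>, and all gradients are bounded by \<open>B\<close>.\<close>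

definition "controlled \<eta> C N B \<longleftrightarrow> \<eta> > 0 \<and> C > 0 \<and> compact N \<and> N \<subseteq> U \<and> M \<subseteq> N \<and>
    (\<forall>\<epsilon> x. 0 < \<epsilon> \<longrightarrow> norm (perturbed \<epsilon> x - n x) \<le> \<epsilon> * C) \<and>
    (\<forall>\<epsilon> x. 0 < \<epsilon> \<and> \<epsilon> \<le> \<eta> \<and> x \<in> closure \<Omega> \<longrightarrow> perturbed \<epsilon> x \<in> N \<and> norm (D_variation \<epsilon> x) \<le> B) \<and>
    (\<forall>x\<in>closure \<Omega>. norm (Dn x) \<le> B)"

lemma variation_control: "\<exists>\<eta> C N B. controlled \<eta> C N B"
proof -
  obtain C where C: "C > 0" "\<And>y. norm (\<Phi> y) \<le> C"
    using continuous_vanishing_outside_bounded[OF \<Phi>_cont, of 2] \<Phi>_out by (meson less_imp_le)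
  obtain L where L: "L > 0" "\<And>y. norm (D\<Phi> y) \<le> L"
    using continuous_vanishing_outside_bounded[OF D\<Phi> D\<Phi>_out] by blast
  obtain e where e: "e > 0" "(\<Union>u\<in>M. cball u e) \<subseteq> U"
    using compact_subset_open_imp_cball_epsilon_subset[OF M U] by metis
  define N where "N = {u + v |u v. u \<in> M \<and> v \<in> cball 0 e}"
  have N: "compact N" unfolding N_def by (rule compact_sums[OF M compact_cball])
  have NU: "N \<subseteq> U"
  proof
    fix z assume "z \<in> N"
    then obtain u v where "z = u + v" "u \<in> M" "norm v \<le> e" unfolding N_def by auto
    then have "z \<in> cball u e" "u \<in> M" by (auto simp: dist_norm)
    then show "z \<in> U" using e(2) by blast
  qed
  have MN: "M \<subseteq> N"
  proof
    fix u assume "u \<in> M"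
    then show "u \<in> N" unfolding N_def using e(1) by (intro CollectI exI[of _ u] exI[of _ 0]) simp
  qed
  define \<eta> where "\<eta> = e / C"
  have close: "norm (perturbed \<epsilon> x - n x) \<le> \<epsilon> * C" if "0 < \<epsilon>" for \<epsilon> x
    using that C(2) by (simp add: perturbed_def mult_left_mono)
  have argN: "perturbed \<epsilon> x \<in> N" if "0 < \<epsilon>" "\<epsilon> \<le> \<eta>" "x \<in> closure \<Omega>" for \<epsilon> x
  proof -
    have "\<epsilon> * C \<le> e" using that(2) C(1) by (simp add: \<eta>_def field_simps)
    then have "norm (perturbed \<epsilon> x - n x) \<le> e" using close[OF that(1), of x] by simp
    moreover have "n x \<in> M" using nM that(3) by blast
    ultimately show ?thesis unfolding N_def
      by (intro CollectI exI[of _ "n x"] exI[of _ "perturbed \<epsilon> x - n x"]) simp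
  qed
  have "bounded (Dn ` closure \<Omega>)"
    by (intro compact_imp_bounded compact_continuous_image Dn_cont compact_closure_\<Omega>)
  then obtain B1 where B1: "\<And>x. x \<in> closure \<Omega> \<Longrightarrow> norm (Dn x) \<le> B1" unfolding bounded_iff by blast
  let ?K = "N \<times> cball (0::real^'d^'k) B1 \<times> cball (0::real^'d^'k) L"
  have "continuous_on ?K (\<lambda>z. jacobian P (at (fst z)) ** (fst (snd z) + snd (snd z)))"
    by (intro continuous_on_matrix_mult continuous_on_compose2[OF P_cont] continuous_intros) (use NU in auto)
  then have "bounded ((\<lambda>z. jacobian P (at (fst z)) ** (fst (snd z) + snd (snd z))) ` ?K)"
    by (intro compact_imp_bounded compact_continuous_image compact_Times N compact_cball)
  then obtain B2 where B2: "\<And>z. z \<in> ?K \<Longrightarrow> norm (jacobian P (at (fst z)) ** (fst (snd z) + snd (snd z))) \<le> B2"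
    unfolding bounded_iff by blast
  have DB: "norm (D_variation \<epsilon> x) \<le> max B1 B2" if "0 < \<epsilon>" "\<epsilon> \<le> \<eta>" "x \<in> closure \<Omega>" for \<epsilon> x
    using B2[of "(perturbed \<epsilon> x, Dn x, D\<Phi> ((x - x0) /\<^sub>R \<epsilon>))"] argN[OF that] B1[OF that(3)] L(2)
    by (simp add: D_variation_def le_max_iff_disj)
  have DnB: "norm (Dn x) \<le> max B1 B2" if "x \<in> closure \<Omega>" for x using B1[OF that] by simp
  have "\<eta> > 0" using e(1) C(1) by (simp add: \<eta>_def)
  then have "controlled \<eta> C N (max B1 B2)"
    unfolding controlled_def using C(1) N NU MN argN close DB DnB by simp
  then show ?thesis by blast
qed

lemma perturbed_der:
  assumes "0 < \<epsilon>" "x \<in> \<Omega>"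
  shows "(perturbed \<epsilon> has_derivative (\<lambda>h. (Dn x + D\<Phi> ((x - x0) /\<^sub>R \<epsilon>)) *v h)) (at x)"
proof -
  have "((\<lambda>x. (x - x0) /\<^sub>R \<epsilon>) has_derivative (\<lambda>h. h /\<^sub>R \<epsilon>)) (at x)"
    by (auto intro!: derivative_eq_intros)
  from has_derivative_compose[OF this \<Phi>_der]
  have "((\<lambda>x. \<Phi> ((x - x0) /\<^sub>R \<epsilon>)) has_derivative (\<lambda>h. D\<Phi> ((x - x0) /\<^sub>R \<epsilon>) *v (h /\<^sub>R \<epsilon>))) (at x)" .
  then have "((\<lambda>x. n x + \<epsilon> *\<^sub>R \<Phi> ((x - x0) /\<^sub>R \<epsilon>)) has_derivative
      (\<lambda>h. Dn x *v h + \<epsilon> *\<^sub>R (D\<Phi> ((x - x0) /\<^sub>R \<epsilon>) *v (h /\<^sub>R \<epsilon>)))) (at x)"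
    by (intro has_derivative_add n_der[OF assms(2)] has_derivative_scaleR_right)
  moreover have "(\<lambda>h. Dn x *v h + \<epsilon> *\<^sub>R (D\<Phi> ((x - x0) /\<^sub>R \<epsilon>) *v (h /\<^sub>R \<epsilon>)))
      = (\<lambda>h. (Dn x + D\<Phi> ((x - x0) /\<^sub>R \<epsilon>)) *v h)"
    using assms(1) by (simp add: matrix_vector_mult_add_rdistrib matrix_vector_mult_scaleR)
  moreover have "perturbed \<epsilon> = (\<lambda>x. n x + \<epsilon> *\<^sub>R \<Phi> ((x - x0) /\<^sub>R \<epsilon>))" by (rule ext) (rule perturbed_def)
  ultimately show ?thesis by (simp only:)
qed

lemma perturbed_cont: "continuous_on (closure \<Omega>) (perturbed \<epsilon>)"
proof -
  have "continuous_on (closure \<Omega>) (\<lambda>x. n x + \<epsilon> *\<^sub>R \<Phi> ((x - x0) /\<^sub>R \<epsilon>))"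
    by (intro continuous_intros n_cont continuous_on_compose2[OF \<Phi>_cont]) auto
  then show ?thesis by (simp add: perturbed_def[abs_def])
qed

lemma variation_regular:
  assumes \<epsilon>: "0 < \<epsilon>" and U: "perturbed \<epsilon> ` closure \<Omega> \<subseteq> U"
  shows "x \<in> \<Omega> \<Longrightarrow> (variation \<epsilon> has_derivative (\<lambda>h. D_variation \<epsilon> x *v h)) (at x)"
    and "continuous_on (closure \<Omega>) (variation \<epsilon>)" "continuous_on (closure \<Omega>) (D_variation \<epsilon>)"
    and "x \<in> closure \<Omega> \<Longrightarrow> variation \<epsilon> x \<in> M"
proof -
  show "(variation \<epsilon> has_derivative (\<lambda>h. D_variation \<epsilon> x *v h)) (at x)" if x: "x \<in> \<Omega>"
  proof -
    have ax: "perturbed \<epsilon> x \<in> U" using U x closure_subset by blast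
    have "((\<lambda>x. P (perturbed \<epsilon> x)) has_derivative (\<lambda>h. jacobian P (at (perturbed \<epsilon> x)) *v
        ((Dn x + D\<Phi> ((x - x0) /\<^sub>R \<epsilon>)) *v h))) (at x)"
      by (rule has_derivative_compose[OF perturbed_der[OF \<epsilon> x] P_der[OF ax]])
    then show ?thesis
      by (simp add: variation_def[abs_def] D_variation_def matrix_vector_mul_assoc)
  qed
  have "continuous_on U P"
    by (rule continuous_at_imp_continuous_on) (use has_derivative_continuous[OF P_der] in blast)
  then have "continuous_on (closure \<Omega>) (\<lambda>x. P (perturbed \<epsilon> x))"
    by (rule continuous_on_compose2[OF _ perturbed_cont]) (use U in auto)
  then show "continuous_on (closure \<Omega>) (variation \<epsilon>)" by (simp add: variation_def[abs_def])
  have "continuous_on (closure \<Omega>) (\<lambda>x. jacobian P (at (perturbed \<epsilon> x)) ** (Dn x + D\<Phi> ((x - x0) /\<^sub>R \<epsilon>)))"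
    by (intro continuous_on_matrix_mult continuous_on_compose2[OF P_cont perturbed_cont] continuous_on_add Dn_cont
        continuous_on_compose2[OF D\<Phi>] continuous_intros) (use U in auto)
  then show "continuous_on (closure \<Omega>) (D_variation \<epsilon>)" by (simp add: D_variation_def[abs_def])
  show "x \<in> closure \<Omega> \<Longrightarrow> variation \<epsilon> x \<in> M" unfolding variation_def using P_in U by blast
qed

lemma variation_eq_n:
  assumes "0 < \<epsilon>" "x \<in> closure \<Omega>" "2 * \<epsilon> \<le> dist x0 x"
  shows "variation \<epsilon> x = n x"
proof -
  have "norm ((x - x0) /\<^sub>R \<epsilon>) = dist x0 x / \<epsilon>"
    using assms(1) by (simp add: dist_norm norm_minus_commute divide_inverse mult.commute)
  then have "2 \<le> norm ((x - x0) /\<^sub>R \<epsilon>)" using assms(1,3) by (simp add: le_divide_eq)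
  then have "perturbed \<epsilon> x = n x" by (simp add: perturbed_def \<Phi>_out)
  then show ?thesis using P_id nM assms(2) by (auto simp: variation_def)
qed

lemma D_variation_eq_Dn:
  assumes "0 < \<epsilon>" "x \<in> closure \<Omega>" "2 * \<epsilon> < dist x0 x"
  shows "D_variation \<epsilon> x = Dn x"
proof -
  have "norm ((x - x0) /\<^sub>R \<epsilon>) = dist x0 x / \<epsilon>"
    using assms(1) by (simp add: dist_norm norm_minus_commute divide_inverse mult.commute)
  then have far: "2 < norm ((x - x0) /\<^sub>R \<epsilon>)" using assms(1,3) by (simp add: less_divide_eq)
  then have "perturbed \<epsilon> x = n x" by (simp add: perturbed_def \<Phi>_out)
  then show ?thesis using jacobian_Dn[OF assms(2)] D\<Phi>_out[OF far] by (simp add: D_variation_def)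
qed

text \<open>Extended by zero outside \<open>\<Omega>\<close> so that the rescaled integrals can all be taken over the whole space.\<close>

definition "excess \<epsilon> x = indicator \<Omega> x *\<^sub>R (F x (variation \<epsilon> x) (D_variation \<epsilon> x) - F x (n x) (Dn x))"

text \<open>This is where minimality enters: for small \<open>\<epsilon>\<close> the variation is admissible and uniformly close to
\<open>n\<close>. The bound on the excess, uniform in \<open>\<epsilon>\<close>, is what dominated convergence needs later.\<close>

lemma excess_integral_nonneg:
  assumes min: "strong_local_minimizer F \<Omega> (admissible \<Omega> M \<Gamma>1 n0) n"
    and \<Gamma>1: "\<Gamma>1 \<subseteq> closure \<Omega>" "\<Gamma>1 \<inter> ball x0 r = {}" "r > 0"
  shows "\<exists>\<eta>>0. \<exists>B. \<forall>\<epsilon>. 0 < \<epsilon> \<and> \<epsilon> \<le> \<eta> \<longrightarrow>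
    excess \<epsilon> \<in> borel_measurable borel \<and> 0 \<le> (\<integral>x. excess \<epsilon> x \<partial>lborel) \<and>
    (\<forall>x. \<bar>excess \<epsilon> x\<bar> \<le> B) \<and> (\<forall>x\<in>closure \<Omega>. variation \<epsilon> x \<in> M)"
proof -
  obtain \<eta>1 C N B where ctrl: "controlled \<eta>1 C N B" using variation_control by blast
  have c: "\<eta>1 > 0" "C > 0" "compact N" "N \<subseteq> U" "M \<subseteq> N" using ctrl unfolding controlled_def by blast+
  have argN: "perturbed \<epsilon> x \<in> N" and DB: "norm (D_variation \<epsilon> x) \<le> B"
    if "0 < \<epsilon>" "\<epsilon> \<le> \<eta>1" "x \<in> closure \<Omega>" for \<epsilon> x
    using ctrl that unfolding controlled_def by blast+
  have close: "norm (perturbed \<epsilon> x - n x) \<le> \<epsilon> * C" if "0 < \<epsilon>" for \<epsilon> x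
    using ctrl that unfolding controlled_def by blast
  have DnB: "norm (Dn x) \<le> B" if "x \<in> closure \<Omega>" for x
    using ctrl that unfolding controlled_def by blast
  have nA: "n \<in> admissible \<Omega> M \<Gamma>1 n0" using min unfolding strong_local_minimizer_def by blast
  obtain \<epsilon>0 where \<epsilon>0: "\<epsilon>0 > 0" "\<And>m. m \<in> admissible \<Omega> M \<Gamma>1 n0 \<Longrightarrow>
      Linf_norm \<Omega> (\<lambda>x. n x - m x) < ereal \<epsilon>0 \<Longrightarrow> energy F \<Omega> n \<le> energy F \<Omega> m"
    using min unfolding strong_local_minimizer_def by blast
  have "continuous_on U P"
    by (rule continuous_at_imp_continuous_on) (use has_derivative_continuous[OF P_der] in blast)
  then have "uniformly_continuous_on N P"
    by (intro compact_uniformly_continuous c(3) continuous_on_subset[OF _ c(4)])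
  then obtain d where d: "d > 0" "\<And>u v. u \<in> N \<Longrightarrow> v \<in> N \<Longrightarrow> dist v u < d \<Longrightarrow> dist (P v) (P u) < \<epsilon>0 / 2"
    unfolding uniformly_continuous_on_def using \<epsilon>0(1) by (metis half_gt_zero)
  obtain C' where C': "\<And>x u A. x \<in> closure \<Omega> \<Longrightarrow> u \<in> M \<Longrightarrow> norm A \<le> B \<Longrightarrow> \<bar>F x u A\<bar> \<le> C'"
    using F_bounded by metis
  \<comment> \<open>The three bounds keep the perturbed map inside \<open>N\<close>, the variation within the distance that minimality tolerates, and its support, of radius \<open>2 \<epsilon>\<close>, off \<open>\<Gamma>1\<close>.\<close>
  define \<eta> where "\<eta> = min \<eta>1 (min (d / (2 * C)) (r / 2))"
  have \<eta>: "\<eta> > 0" "\<eta> \<le> \<eta>1" "\<eta> \<le> d / (2 * C)" "\<eta> \<le> r / 2" using c(1,2) d(1) \<Gamma>1(3) by (auto simp: \<eta>_def)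
  have sub: "\<Omega> \<subseteq> closure \<Omega>" by (rule closure_subset)
  have nMx: "n x \<in> M" if "x \<in> closure \<Omega>" for x using nM that by blast
  note nc = continuous_on_subset[OF n_cont sub] and Dnc = continuous_on_subset[OF Dn_cont sub]
  have bdM: "bounded M" by (rule compact_imp_bounded[OF M])
  have bdn: "bounded (n ` \<Omega>)" using nM sub by (intro bounded_subset[OF bdM]) auto
  have bdDn: "bounded (Dn ` \<Omega>)" unfolding bounded_iff using DnB sub by blast
  have nW: "AE x in lebesgue. x \<in> \<Omega> \<longrightarrow> weak_gradient \<Omega> n x = Dn x"
    by (rule W11_classical(2)[OF \<Omega> n_der Dnc bdn bdDn])
  have Fn: "continuous_on \<Omega> (\<lambda>x. F x (n x) (Dn x))"
    by (rule F_integrand_continuous[OF nc Dnc sub]) (use nMx sub in blast)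
  have Fnb: "bounded ((\<lambda>x. F x (n x) (Dn x)) ` \<Omega>)"
    unfolding bounded_iff using C'[OF _ nMx DnB] sub by (intro exI[of _ C']) auto
  note Fni = bounded_continuous_set_integrable[OF \<Omega> Fn Fnb]
  have main: "excess \<epsilon> \<in> borel_measurable borel \<and> 0 \<le> (\<integral>x. excess \<epsilon> x \<partial>lborel)
      \<and> (\<forall>x. \<bar>excess \<epsilon> x\<bar> \<le> 2 * \<bar>C'\<bar>) \<and> (\<forall>x\<in>closure \<Omega>. variation \<epsilon> x \<in> M)"
    if \<epsilon>: "0 < \<epsilon>" "\<epsilon> \<le> \<eta>" for \<epsilon>
  proof -
    have \<epsilon>1: "\<epsilon> \<le> \<eta>1" using \<epsilon>(2) \<eta>(2) by simp
    have argU: "perturbed \<epsilon> ` closure \<Omega> \<subseteq> U" using c(4) argN[OF \<epsilon>(1) \<epsilon>1] by blast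
    note reg = variation_regular[OF \<epsilon>(1) argU]
    let ?m = "variation \<epsilon>" and ?Dm = "D_variation \<epsilon>"
    note mc = continuous_on_subset[OF reg(2) sub] and Dmc = continuous_on_subset[OF reg(3) sub]
    have bdm: "bounded (?m ` \<Omega>)" using reg(4) sub by (intro bounded_subset[OF bdM]) auto
    have bdDm: "bounded (?Dm ` \<Omega>)" unfolding bounded_iff using DB[OF \<epsilon>(1) \<epsilon>1] sub by blast
    have mW: "AE x in lebesgue. x \<in> \<Omega> \<longrightarrow> weak_gradient \<Omega> ?m x = ?Dm x"
      by (rule W11_classical(2)[OF \<Omega> reg(1) Dmc bdm bdDm])
    have Fm: "continuous_on \<Omega> (\<lambda>x. F x (?m x) (?Dm x))"
      by (rule F_integrand_continuous[OF mc Dmc sub]) (use reg(4) sub in auto)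
    have Fmb: "bounded ((\<lambda>x. F x (?m x) (?Dm x)) ` \<Omega>)"
      unfolding bounded_iff using C'[OF _ reg(4) DB[OF \<epsilon>(1) \<epsilon>1]] sub by (intro exI[of _ C']) auto
    note Fmi = bounded_continuous_set_integrable[OF \<Omega> Fm Fmb]
    let ?w = "\<lambda>x. ?m x - n x"
    have wW: "?w \<in> W11 \<Omega>"
    proof (rule W11_classical(1)[OF \<Omega>, of _ "\<lambda>x. ?Dm x - Dn x"])
      show "(?w has_derivative (\<lambda>h. (?Dm x - Dn x) *v h)) (at x)" if "x \<in> \<Omega>" for x
        using has_derivative_diff[OF reg(1)[OF that] n_der[OF that]] by (simp add: matrix_vector_mult_diff_rdistrib)
      show "continuous_on \<Omega> (\<lambda>x. ?Dm x - Dn x)" by (intro continuous_on_diff Dmc Dnc)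
      show "bounded (?w ` \<Omega>)" by (rule bounded_minus_comp[OF bdm bdn])
      show "bounded ((\<lambda>x. ?Dm x - Dn x) ` \<Omega>)" by (rule bounded_minus_comp[OF bdDm bdDn])
    qed
    have "(\<lambda>x. n x + ?w x) \<in> admissible \<Omega> M \<Gamma>1 n0"
    proof (rule admissible_add_continuous[OF \<Omega>(1) nA wW])
      show "continuous_on (closure \<Omega>) ?w" by (intro continuous_on_diff reg(2) n_cont)
      show "?w x = 0" if "x \<in> \<Gamma>1" for x
      proof -
        have "r \<le> dist x0 x" using \<Gamma>1(2) that by (auto simp: not_less[symmetric])
        then have "2 * \<epsilon> \<le> dist x0 x" using \<epsilon>(2) \<eta>(4) by simp
        then show ?thesis using variation_eq_n[OF \<epsilon>(1)] \<Gamma>1(1) that by auto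
      qed
      show "n x + ?w x \<in> M" if "x \<in> \<Omega>" for x using reg(4)[of x] that sub by auto
    qed
    then have mA: "?m \<in> admissible \<Omega> M \<Gamma>1 n0" by simp
    have "Linf_norm \<Omega> (\<lambda>x. n x - ?m x) \<le> ereal (\<epsilon>0 / 2)"
    proof (rule Linf_norm_le[OF \<Omega>(1)])
      show "continuous_on \<Omega> (\<lambda>x. n x - ?m x)" by (intro continuous_on_diff nc mc)
      fix x assume "x \<in> \<Omega>"
      then have x: "x \<in> closure \<Omega>" using sub by blast
      have "\<epsilon> * C \<le> d / 2"
      proof -
        have "\<epsilon> * C \<le> d / (2 * C) * C" using \<epsilon>(2) \<eta>(3) c(2) by (intro mult_right_mono) auto
        then show ?thesis using c(2) by simp
      qed
      then have "dist (perturbed \<epsilon> x) (n x) < d" using close[OF \<epsilon>(1), of x] d(1) by (simp add: dist_norm)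
      then have "dist (P (perturbed \<epsilon> x)) (P (n x)) < \<epsilon>0 / 2"
        using c(5) argN[OF \<epsilon>(1) \<epsilon>1 x] nMx[OF x] by (intro d(2)) auto
      then show "norm (n x - ?m x) \<le> \<epsilon>0 / 2"
        using P_id[OF nMx[OF x]] by (simp add: variation_def dist_norm norm_minus_commute)
    qed
    also have "\<dots> < ereal \<epsilon>0" using \<epsilon>0(1) by simp
    finally have "energy F \<Omega> n \<le> energy F \<Omega> ?m" by (rule \<epsilon>0(2)[OF mA])
    then have le: "(LINT x:\<Omega>|lebesgue. F x (n x) (Dn x)) \<le> (LINT x:\<Omega>|lebesgue. F x (?m x) (?Dm x))"
      unfolding energy_eq_integral[where F = F, OF Fni(2) nW] energy_eq_integral[where F = F, OF Fmi(2) mW] by simp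
    have ex: "excess \<epsilon> = (\<lambda>x. indicator \<Omega> x *\<^sub>R F x (?m x) (?Dm x) - indicator \<Omega> x *\<^sub>R F x (n x) (Dn x))"
      by (rule ext) (simp add: excess_def right_diff_distrib)
    have "(\<integral>x. excess \<epsilon> x \<partial>lborel) = (\<integral>x. indicator \<Omega> x *\<^sub>R F x (?m x) (?Dm x) \<partial>lborel)
        - (\<integral>x. indicator \<Omega> x *\<^sub>R F x (n x) (Dn x) \<partial>lborel)"
      unfolding ex by (rule Bochner_Integration.integral_diff[OF Fmi(1) Fni(1)])
    also have "\<dots> = (LINT x:\<Omega>|lebesgue. F x (?m x) (?Dm x)) - (LINT x:\<Omega>|lebesgue. F x (n x) (Dn x))"
      unfolding set_lebesgue_integral_def using Fmi(3) Fni(3) by (simp add: integral_completion)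
    finally have "0 \<le> (\<integral>x. excess \<epsilon> x \<partial>lborel)" using le by simp
    moreover have "excess \<epsilon> \<in> borel_measurable borel"
      unfolding ex by (rule borel_measurable_diff[OF Fmi(3) Fni(3)])
    moreover have "\<bar>excess \<epsilon> x\<bar> \<le> 2 * \<bar>C'\<bar>" for x
    proof (cases "x \<in> \<Omega>")
      case True
      then have x: "x \<in> closure \<Omega>" using sub by blast
      show ?thesis using C'[OF x reg(4)[OF x] DB[OF \<epsilon>(1) \<epsilon>1 x]] C'[OF x nMx[OF x] DnB[OF x]] True
        by (simp add: excess_def)
    qed (simp add: excess_def)
    ultimately show ?thesis using reg(4) by blast
  qed
  show ?thesis
    using \<eta>(1) main by blast
qed

end

context projected_variation
begin

text \<open>Any radius beyond 2 would do: the gradient of \<open>\<Phi>\<close> vanishes off the closed ball of radius 2.\<close>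

lemma excess_far:
  assumes "0 < \<epsilon>" "3 \<le> norm y"
  shows "excess \<epsilon> (x0 + \<epsilon> *\<^sub>R y) = 0"
proof (cases "x0 + \<epsilon> *\<^sub>R y \<in> \<Omega>")
  case True
  then have x: "x0 + \<epsilon> *\<^sub>R y \<in> closure \<Omega>" using closure_subset by blast
  have "2 * \<epsilon> < dist x0 (x0 + \<epsilon> *\<^sub>R y)" using assms by (simp add: dist_norm)
  then show ?thesis
    using variation_eq_n[OF assms(1) x] D_variation_eq_Dn[OF assms(1) x] by (simp add: excess_def)
qed (simp add: excess_def)

lemma blow_up_integrand:
  fixes e :: "nat \<Rightarrow> real"
  assumes e: "e \<longlonglongrightarrow> 0" "\<And>k. 0 < e k"
    and inside: "\<forall>\<^sub>F k in sequentially. x0 + e k *\<^sub>R y \<in> \<Omega>"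
    and vM: "\<And>k x. x \<in> closure \<Omega> \<Longrightarrow> variation (e k) x \<in> M"
  shows "(\<lambda>k. excess (e k) (x0 + e k *\<^sub>R y)) \<longlonglongrightarrow>
    F x0 (n x0) (Dn x0 + jacobian P (at (n x0)) ** D\<Phi> y) - F x0 (n x0) (Dn x0)"
proof -
  let ?X = "\<lambda>k. x0 + e k *\<^sub>R y"
  have "?X \<longlonglongrightarrow> x0 + 0 *\<^sub>R y" by (intro tendsto_intros e)
  then have X: "?X \<longlonglongrightarrow> x0" by simp
  have ev: "\<forall>\<^sub>F k in sequentially. ?X k \<in> closure \<Omega>"
    using inside by eventually_elim (use closure_subset in blast)
  have nX: "(\<lambda>k. n (?X k)) \<longlonglongrightarrow> n x0" by (rule continuous_on_tendsto_compose[OF n_cont X x0 ev])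
  have DnX: "(\<lambda>k. Dn (?X k)) \<longlonglongrightarrow> Dn x0" by (rule continuous_on_tendsto_compose[OF Dn_cont X x0 ev])
  have scale: "(?X k - x0) /\<^sub>R e k = y" for k using e(2)[of k] by simp
  have perturbed_eq: "perturbed (e k) (?X k) = n (?X k) + e k *\<^sub>R \<Phi> y" for k
    unfolding perturbed_def scale ..
  have "(\<lambda>k. n (?X k) + e k *\<^sub>R \<Phi> y) \<longlonglongrightarrow> n x0 + 0 *\<^sub>R \<Phi> y" by (intro tendsto_intros nX e)
  then have argX: "(\<lambda>k. perturbed (e k) (?X k)) \<longlonglongrightarrow> n x0" unfolding perturbed_eq by simp
  have nx0: "n x0 \<in> M" "n x0 \<in> U" using nM x0 U(2) by blast+
  have "isCont P (n x0)" by (rule has_derivative_continuous[OF P_der[OF nx0(2)]])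
  from isCont_tendsto_compose[OF this argX]
  have vX: "(\<lambda>k. variation (e k) (?X k)) \<longlonglongrightarrow> n x0"
    unfolding variation_def P_id[OF nx0(1)] .
  have "isCont (\<lambda>u. jacobian P (at u)) (n x0)"
    using P_cont U(1) nx0(2) by (simp add: continuous_on_eq_continuous_at)
  from isCont_tendsto_compose[OF this argX]
  have JX: "(\<lambda>k. jacobian P (at (perturbed (e k) (?X k)))) \<longlonglongrightarrow> jacobian P (at (n x0))" .
  have "(\<lambda>k. jacobian P (at (perturbed (e k) (?X k))) ** (Dn (?X k) + D\<Phi> y)) \<longlonglongrightarrow> jacobian P (at (n x0)) ** (Dn x0 + D\<Phi> y)"
    by (intro tendsto_matrix_mult JX tendsto_add DnX tendsto_const)
  moreover have "jacobian P (at (n x0)) ** (Dn x0 + D\<Phi> y) = Dn x0 + jacobian P (at (n x0)) ** D\<Phi> y"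
    by (simp add: matrix_add_ldistrib jacobian_Dn[OF x0])
  ultimately have DX: "(\<lambda>k. D_variation (e k) (?X k)) \<longlonglongrightarrow> Dn x0 + jacobian P (at (n x0)) ** D\<Phi> y"
    unfolding D_variation_def scale by simp
  have 1: "(\<lambda>k. (\<lambda>(x, u, A). F x u A) (?X k, variation (e k) (?X k), D_variation (e k) (?X k)))
      \<longlonglongrightarrow> (\<lambda>(x, u, A). F x u A) (x0, n x0, Dn x0 + jacobian P (at (n x0)) ** D\<Phi> y)"
  proof (rule continuous_on_tendsto_compose[OF F])
    show "(\<lambda>k. (?X k, variation (e k) (?X k), D_variation (e k) (?X k))) \<longlonglongrightarrow> (x0, n x0, Dn x0 + jacobian P (at (n x0)) ** D\<Phi> y)"
      by (intro tendsto_Pair X vX DX)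
    show "\<forall>\<^sub>F k in sequentially. (?X k, variation (e k) (?X k), D_variation (e k) (?X k)) \<in> closure \<Omega> \<times> M \<times> UNIV"
      using ev by eventually_elim (simp add: vM)
  qed (use x0 nx0 in simp)
  have 2: "(\<lambda>k. (\<lambda>(x, u, A). F x u A) (?X k, n (?X k), Dn (?X k))) \<longlonglongrightarrow> (\<lambda>(x, u, A). F x u A) (x0, n x0, Dn x0)"
  proof (rule continuous_on_tendsto_compose[OF F])
    show "(\<lambda>k. (?X k, n (?X k), Dn (?X k))) \<longlonglongrightarrow> (x0, n x0, Dn x0)"
      by (intro tendsto_Pair X nX DnX)
    show "\<forall>\<^sub>F k in sequentially. (?X k, n (?X k), Dn (?X k)) \<in> closure \<Omega> \<times> M \<times> UNIV"
      using ev by eventually_elim (use nM in auto)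
  qed (use x0 nx0 in simp)
  have "(\<lambda>k. F (?X k) (variation (e k) (?X k)) (D_variation (e k) (?X k)) - F (?X k) (n (?X k)) (Dn (?X k)))
      \<longlonglongrightarrow> F x0 (n x0) (Dn x0 + jacobian P (at (n x0)) ** D\<Phi> y) - F x0 (n x0) (Dn x0)"
    using tendsto_diff[OF 1 2] by simp
  moreover have "\<forall>\<^sub>F k in sequentially. F (?X k) (variation (e k) (?X k)) (D_variation (e k) (?X k)) - F (?X k) (n (?X k)) (Dn (?X k))
      = excess (e k) (?X k)"
    using inside by eventually_elim (simp add: excess_def)
  ultimately show ?thesis by (rule Lim_transform_eventually)
qed

text \<open>Substituting \<open>x = x0 + \<epsilon> y\<close> changes the excess integral by a positive factor, so it stays nonnegative; then \<open>\<epsilon>\<close> tends to zero under the integral. The directions with \<open>y \<bullet> \<nu> = 0\<close>, in which the rescaled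
domains need not converge, form a null set.\<close>

lemma blow_up_inequality:
  assumes min: "strong_local_minimizer F \<Omega> (admissible \<Omega> M \<Gamma>1 n0) n"
    and \<Gamma>1: "\<Gamma>1 \<subseteq> closure \<Omega>" "\<Gamma>1 \<inter> ball x0 r = {}" "r > 0"
    and ext: "exterior_unit_normal \<Omega> x0 \<nu>"
  shows "0 \<le> (\<integral>y. indicator {y \<in> ball 0 3. y \<bullet> \<nu> < 0} y *\<^sub>R
    (F x0 (n x0) (Dn x0 + jacobian P (at (n x0)) ** D\<Phi> y) - F x0 (n x0) (Dn x0)) \<partial>lebesgue)"
proof -
  let ?H = "{y \<in> ball 0 3. y \<bullet> \<nu> < 0}"
  let ?f = "\<lambda>y. indicator ?H y *\<^sub>R (F x0 (n x0) (Dn x0 + jacobian P (at (n x0)) ** D\<Phi> y) - F x0 (n x0) (Dn x0))"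
  note ray = exterior_unit_normal_ray[OF \<Omega>(1) ext]
  obtain \<eta> B where \<eta>: "\<eta> > 0" and all: "\<And>\<epsilon>. 0 < \<epsilon> \<and> \<epsilon> \<le> \<eta> \<Longrightarrow>
    excess \<epsilon> \<in> borel_measurable borel \<and> 0 \<le> (\<integral>x. excess \<epsilon> x \<partial>lborel) \<and>
    (\<forall>x. \<bar>excess \<epsilon> x\<bar> \<le> B) \<and> (\<forall>x\<in>closure \<Omega>. variation \<epsilon> x \<in> M)"
    using excess_integral_nonneg[OF min \<Gamma>1] by blast
  define e :: "nat \<Rightarrow> real" where "e k = \<eta> * inverse (real (Suc k))" for k
  have e: "0 < e k" "e k \<le> \<eta>" for k
  proof -
    have "0 < inverse (real (Suc k))" "inverse (real (Suc k)) \<le> 1" by (auto simp: field_simps)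
    then show "0 < e k" "e k \<le> \<eta>" using \<eta> by (simp_all only: e_def mult_pos_pos mult_left_le less_imp_le)
  qed
  have e0: "e \<longlonglongrightarrow> 0" unfolding e_def by (intro tendsto_mult_right_zero LIMSEQ_inverse_real_of_nat)
  moreover have "e k \<noteq> 0" for k using e(1)[of k] by simp
  ultimately have er: "filterlim e (at_right 0) sequentially"
    using e(1) by (simp add: filterlim_at)
  have meas: "excess (e k) \<in> borel_measurable borel" and nonneg: "0 \<le> (\<integral>x. excess (e k) x \<partial>lborel)"
    and bd: "\<bar>excess (e k) x\<bar> \<le> B" and vM: "x \<in> closure \<Omega> \<Longrightarrow> variation (e k) x \<in> M" for k x
    using all[of "e k"] e[of k] by blast+
  have fm: "?f \<in> borel_measurable borel"
  proof (rule borel_measurable_continuous_on_indicator)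
    show "?H \<in> sets borel" using open_ball_halfspace[of 3 \<nu>] by simp
    have "continuous_on ?H (\<lambda>y. F x0 (n x0) (Dn x0 + jacobian P (at (n x0)) ** D\<Phi> y))"
    proof -
      have "continuous_on ?H (\<lambda>y. (x0, n x0, Dn x0 + jacobian P (at (n x0)) ** D\<Phi> y))"
        by (intro continuous_on_Pair continuous_on_const continuous_on_add continuous_on_matrix_mult
            continuous_on_subset[OF D\<Phi>]) auto
      then have "continuous_on ?H (\<lambda>y. (\<lambda>(x, u, A). F x u A) (x0, n x0, Dn x0 + jacobian P (at (n x0)) ** D\<Phi> y))"
        by (rule continuous_on_compose2[OF F]) (use x0 nM in auto)
      then show ?thesis by simp
    qed
    then show "continuous_on ?H (\<lambda>y. F x0 (n x0) (Dn x0 + jacobian P (at (n x0)) ** D\<Phi> y) - F x0 (n x0) (Dn x0))"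
      by (intro continuous_on_diff continuous_on_const)
  qed
  let ?g = "\<lambda>k y. excess (e k) (x0 + e k *\<^sub>R y)"
  have gm: "?g k \<in> borel_measurable lborel" for k
    using meas[of k] by measurable
  have g0: "0 \<le> (\<integral>y. ?g k y \<partial>lborel)" for k
  proof -
    have "0 \<le> \<bar>e k\<bar> ^ DIM(real^'d) *\<^sub>R (\<integral>y. ?g k y \<partial>lborel)"
      using nonneg[of k] lborel_affine_integral(1)[OF meas[of k], of "e k" x0] e(1)[of k] by simp
    moreover have "\<bar>e k\<bar> ^ DIM(real^'d) > 0" using e(1)[of k] by simp
    ultimately show ?thesis by (simp only: real_scaleR_def zero_le_mult_iff) linarith
  qed
  have "(\<lambda>k. \<integral>y. ?g k y \<partial>lborel) \<longlonglongrightarrow> (\<integral>y. ?f y \<partial>lborel)"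
  proof (rule integral_dominated_convergence[where w = "\<lambda>y. indicator (cball 0 3) y *\<^sub>R B"])
    show "?f \<in> borel_measurable lborel" using fm by simp
    show "integrable lborel (\<lambda>y::real^'d. indicat_real (cball 0 3) y *\<^sub>R B)"
      by (rule borel_integrable_compact) auto
    have "\<nu> \<noteq> 0" using ray(1) by auto
    then have "negligible {y. \<nu> \<bullet> y = 0}" by (intro negligible_hyperplane) simp
    then have "AE y in lebesgue. y \<notin> {y. \<nu> \<bullet> y = 0}"
      unfolding negligible_iff_null_sets by (rule AE_not_in)
    moreover have "{y. \<nu> \<bullet> y = 0} \<in> sets lborel" by (simp add: closed_hyperplane)
    ultimately have "AE y in lborel. \<nu> \<bullet> y \<noteq> 0" by (subst (asm) AE_completion_iff) auto
    then show "AE y in lborel. (\<lambda>k. ?g k y) \<longlonglongrightarrow> ?f y"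
    proof eventually_elim
      case (elim y)
      consider "norm y \<ge> 3" | "norm y < 3" "y \<bullet> \<nu> < 0" | "norm y < 3" "y \<bullet> \<nu> > 0"
        using elim by (metis inner_commute linorder_cases not_less)
      then show ?case
      proof cases
        case 1
        then have y: "y \<notin> ?H" by simp
        have f0: "?f y = 0" unfolding indicator_simps(2)[OF y] by (rule scaleR_zero_left)
        show ?thesis unfolding f0 excess_far[OF e(1) 1] by (rule tendsto_const)
      next
        case 2
        have "\<forall>\<^sub>F k in sequentially. x0 + e k *\<^sub>R y \<in> \<Omega>"
          using eventually_compose_filterlim[OF ray(2)[OF 2(2)] er] .
        from blow_up_integrand[OF e0 e(1) this vM] show ?thesis using 2 by simp
      next
        case 3
        have "\<forall>\<^sub>F k in sequentially. x0 + e k *\<^sub>R y \<notin> \<Omega>"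
          using eventually_compose_filterlim[OF ray(3)[OF 3(2)] er] .
        then have "\<forall>\<^sub>F k in sequentially. ?g k y = ?f y"
          by eventually_elim (use 3 in \<open>simp add: excess_def\<close>)
        then show ?thesis by (rule tendsto_eventually)
      qed
    qed
    show "AE y in lborel. norm (?g k y) \<le> indicat_real (cball 0 3) y *\<^sub>R B" for k
    proof (rule AE_I2)
      fix y :: "real^'d"
      show "norm (?g k y) \<le> indicat_real (cball 0 3) y *\<^sub>R B"
      proof (cases "norm y \<le> 3")
        case True
        then show ?thesis using bd[of k "x0 + e k *\<^sub>R y"] by simp
      next
        case False
        then show ?thesis using excess_far[OF e(1)[of k], of y] by simp
      qed
    qed
  qed (rule gm)
  then have "0 \<le> (\<integral>y. ?f y \<partial>lborel)" by (rule LIMSEQ_le_const) (use g0 in blast)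
  then show ?thesis using integral_completion[of ?f lborel] fm by simp
qed

end

section \<open>Quasiconvexity at the boundary\<close>

lemma higher_differentiable_jacobian:
  fixes P :: "real^'k \<Rightarrow> real^'k"
  assumes "higher_differentiable_on (Suc (Suc r)) P U"
  shows "u \<in> U \<Longrightarrow> (P has_derivative (\<lambda>h. jacobian P (at u) *v h)) (at u)"
    and "continuous_on U (\<lambda>u. jacobian P (at u))"
proof -
  have d: "\<forall>x\<in>U. P differentiable (at x)"
    and h: "\<forall>v. higher_differentiable_on (Suc r) (\<lambda>x. frechet_derivative P (at x) v) U"
    using higher_differentiable_on.simps(2)[of "Suc r" P U, THEN iffD1, OF assms] by blast+
  show "u \<in> U \<Longrightarrow> (P has_derivative (\<lambda>h. jacobian P (at u) *v h)) (at u)"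
    using d jacobian_works by blast
  have "continuous_on U (\<lambda>x. frechet_derivative P (at x) v)" for v
  proof (rule continuous_at_imp_continuous_on, rule ballI)
    fix x assume "x \<in> U"
    have "\<forall>x\<in>U. (\<lambda>x. frechet_derivative P (at x) v) differentiable (at x)"
      using h[rule_format, of v, unfolded higher_differentiable_on.simps] by (rule conjunct1)
    then show "isCont (\<lambda>x. frechet_derivative P (at x) v) x"
      using \<open>x \<in> U\<close> by (blast intro: differentiable_imp_continuous_within)
  qed
  then have "continuous_on U (\<lambda>u. \<chi> i j. frechet_derivative P (at u) (axis j 1) $ i)"
    by (intro continuous_on_vec_lambda bounded_linear.continuous_on[OF bounded_linear_vec_nth])
  then show "continuous_on U (\<lambda>u. jacobian P (at u))"
    by (simp add: jacobian_def matrix_def)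
qed

lemma nearest_point_projection_fixes:
  assumes "nearest_point_projection M U P" "M \<subseteq> U" "u \<in> M"
  shows "P u = u"
proof (rule ccontr)
  assume "P u \<noteq> u"
  then have "dist u (P u) < dist u u"
    using assms unfolding nearest_point_projection_def by (metis subsetD)
  then show False by simp
qed

lemma average_over_half_ball:
  fixes f :: "real^'d \<Rightarrow> real"
  assumes \<nu>: "norm \<nu> = 1" and f: "(\<lambda>y. indicator (half_ball \<nu>) y *\<^sub>R f y) \<in> borel_measurable lebesgue"
    and bd: "AE y in lebesgue. y \<in> half_ball \<nu> \<longrightarrow> \<bar>f y\<bar> \<le> C"
    and nn: "0 \<le> (\<integral>y. indicator (half_ball \<nu>) y *\<^sub>R (f y - c) \<partial>lebesgue)"
  shows "c \<le> 1 / measure lebesgue (half_ball \<nu>) * (LINT y:half_ball \<nu>|lebesgue. f y)"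
proof -
  let ?D = "half_ball \<nu>"
  note D = half_ball_facts[OF \<nu>]
  have bD: "bounded ?D" unfolding half_ball_def by (rule bounded_subset[OF bounded_ball[of 0 1]]) auto
  have Dl: "?D \<in> lmeasurable" using bD D(1) by (rule lmeasurable_open)
  then have iD: "integrable lebesgue (indicator ?D :: _ \<Rightarrow> real)" by (simp add: lmeasurable_iff_integrable)
  have fi: "integrable lebesgue (\<lambda>y. indicator ?D y *\<^sub>R f y)"
  proof (rule Bochner_Integration.integrable_bound[OF _ f])
    show "integrable lebesgue (\<lambda>y. indicator ?D y * C)" using iD by simp
    show "AE y in lebesgue. norm (indicator ?D y *\<^sub>R f y) \<le> norm (indicator ?D y * C)"
      using bd by eventually_elim (auto simp: indicator_def)
  qed
  have "(\<integral>y. indicator ?D y *\<^sub>R (f y - c) \<partial>lebesgue) = (\<integral>y. indicator ?D y *\<^sub>R f y - indicator ?D y * c \<partial>lebesgue)"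
    by (simp add: right_diff_distrib)
  also have "\<dots> = (\<integral>y. indicator ?D y *\<^sub>R f y \<partial>lebesgue) - (\<integral>y. indicator ?D y * c \<partial>lebesgue)"
    by (rule Bochner_Integration.integral_diff[OF fi]) (use iD in simp)
  also have "(\<integral>y. indicator ?D y * c \<partial>lebesgue) = measure lebesgue ?D * c"
    using Dl by simp
  finally have "measure lebesgue ?D * c \<le> (LINT y:?D|lebesgue. f y)"
    using nn by (simp add: set_lebesgue_integral_def)
  moreover have "measure lebesgue ?D > 0"
  proof -
    have "\<not> negligible ?D" using D(1,3) by (rule open_not_negligible)
    then show ?thesis using Dl by (simp add: negligible_iff_measure zero_less_measure_iff)
  qed
  ultimately show ?thesis by (simp add: field_simps)
qed

text \<open>Passage from \<open>C\<^sup>1\<close> fields on the half space to test functions on the half ball. In the limit the integrand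
vanishes on the part of the half space outside the unit ball, since the gradients tend to zero there.\<close>

lemma half_ball_inequality_by_approximation:
  fixes f :: "real^'d^'k \<Rightarrow> real" and J :: "real^'k^'k"
  assumes f: "continuous_on UNIV f" and \<nu>: "norm \<nu> = 1" and \<phi>: "\<phi> \<in> W1inf (half_ball \<nu>)"
    and van: "vanishes_on_boundary_part (half_ball \<nu>) (frontier (ball 0 1) \<inter> frontier (half_ball \<nu>)) \<phi>"
    and C1: "\<And>(\<Phi> :: real^'d \<Rightarrow> real^'k) D\<Phi>. C1_field \<Phi> D\<Phi> \<Longrightarrow>
      0 \<le> (\<integral>y. indicator {y \<in> ball 0 3. y \<bullet> \<nu> < 0} y *\<^sub>R (f (A + J ** D\<Phi> y) - f A) \<partial>lebesgue)"
  shows "f A \<le> 1 / measure lebesgue (half_ball \<nu>) *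
    (LINT y:half_ball \<nu>|lebesgue. f (A + J ** weak_gradient (half_ball \<nu>) \<phi> y))"
proof -
  let ?D = "half_ball \<nu>" and ?H = "{y \<in> ball 0 3. y \<bullet> \<nu> < 0}"
  let ?G = "weak_gradient ?D \<phi>"
  obtain \<Phi> :: "nat \<Rightarrow> real^'d \<Rightarrow> real^'k" and D\<Phi> L where
    field: "\<And>n. C1_field (\<Phi> n) (D\<Phi> n)" and L: "\<And>n y. norm (D\<Phi> n y) \<le> L"
    and lim0: "\<And>y. 1 < norm y \<Longrightarrow> (\<lambda>n. D\<Phi> n y) \<longlonglongrightarrow> 0"
    and lim: "AE y in lebesgue. y \<in> ?D \<longrightarrow> (\<lambda>n. D\<Phi> n y) \<longlonglongrightarrow> ?G y"
    using half_ball_C1_approximation[OF \<nu> \<phi> van] by blast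
  have cont: "continuous_on UNIV (D\<Phi> n)" for n using field[of n] unfolding C1_field_def by blast
  have "\<exists>G. has_weak_gradient ?D \<phi> G" using \<phi> unfolding W1inf_def by blast
  then have Gm: "(\<lambda>y. indicator ?D y *\<^sub>R ?G y) \<in> borel_measurable lebesgue"
    using weak_gradient_measurable[OF half_ball_facts(1)[OF \<nu>]] by blast
  have fJ: "continuous_on S (\<lambda>X. f (A + J ** X))" for S
    by (rule continuous_on_compose2[OF f]) (auto intro!: continuous_on_add continuous_on_matrix_mult
        continuous_on_const continuous_on_id)
  have "bounded ((\<lambda>X. f (A + J ** X)) ` cball 0 L)"
    by (intro compact_imp_bounded compact_continuous_image fJ compact_cball)
  then obtain C where C: "\<And>X. X \<in> cball 0 L \<Longrightarrow> norm (f (A + J ** X)) \<le> C" unfolding bounded_iff by blast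
  have DL: "D \<in> cball 0 L" if "norm D \<le> L" for D :: "real^'d^'k" using that by simp
  have op: "open ?H" by (rule open_ball_halfspace)
  have DH: "y \<in> ?H" if "y \<in> ?D" for y using that by (simp add: half_ball_def)
  let ?q = "\<lambda>n y. indicator ?H y *\<^sub>R (f (A + J ** D\<Phi> n y) - f A)"
  have G_bd: "AE y in lebesgue. y \<in> ?D \<longrightarrow> norm (?G y) \<le> L"
    using lim
  proof eventually_elim
    case (elim y)
    show ?case
    proof
      assume "y \<in> ?D"
      with elim have "(\<lambda>n. norm (D\<Phi> n y)) \<longlonglongrightarrow> norm (?G y)" by (intro tendsto_norm) simp
      then show "norm (?G y) \<le> L" by (rule LIMSEQ_le_const2) (use L in blast)
    qed
  qed
  have fG: "(\<lambda>y. indicator ?D y *\<^sub>R f (A + J ** ?G y)) \<in> borel_measurable lebesgue"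
  proof -
    have "(\<lambda>X. f (A + J ** X)) \<in> borel_measurable borel"
      by (rule borel_measurable_continuous_onI[OF fJ])
    from measurable_compose[OF Gm this]
    have "(\<lambda>y. f (A + J ** (indicator ?D y *\<^sub>R ?G y))) \<in> borel_measurable lebesgue" .
    then have "(\<lambda>y. indicator ?D y *\<^sub>R f (A + J ** (indicator ?D y *\<^sub>R ?G y))) \<in> borel_measurable lebesgue"
      using half_ball_facts(1)[OF \<nu>] by (intro borel_measurable_scaleR borel_measurable_indicator) auto
    moreover have "(\<lambda>y. indicator ?D y *\<^sub>R f (A + J ** (indicator ?D y *\<^sub>R ?G y))) = (\<lambda>y. indicator ?D y *\<^sub>R f (A + J ** ?G y))"
    proof
      fix y
      show "indicator ?D y *\<^sub>R f (A + J ** (indicator ?D y *\<^sub>R ?G y)) = indicator ?D y *\<^sub>R f (A + J ** ?G y)"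
        by (cases "y \<in> ?D") simp_all
    qed
    ultimately show ?thesis by simp
  qed
  have "(\<lambda>n. \<integral>y. ?q n y \<partial>lebesgue) \<longlonglongrightarrow> (\<integral>y. indicator ?D y *\<^sub>R (f (A + J ** ?G y) - f A) \<partial>lebesgue)"
  proof (rule integral_dominated_convergence[where w = "\<lambda>y. indicator ?H y * (C + \<bar>f A\<bar>)"])
    have "(\<lambda>y. indicator ?D y *\<^sub>R f (A + J ** ?G y) - indicator ?D y *\<^sub>R f A) \<in> borel_measurable lebesgue"
      using half_ball_facts(1)[OF \<nu>]
      by (intro borel_measurable_diff fG borel_measurable_scaleR borel_measurable_indicator) auto
    then show "(\<lambda>y. indicator ?D y *\<^sub>R (f (A + J ** ?G y) - f A)) \<in> borel_measurable lebesgue"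
      by (simp add: right_diff_distrib)
    show "?q n \<in> borel_measurable lebesgue" for n
    proof (rule measurable_completion)
      have "?q n \<in> borel_measurable borel"
      proof (rule borel_measurable_continuous_on_indicator)
        show "?H \<in> sets borel" using op by simp
        show "continuous_on ?H (\<lambda>y. f (A + J ** D\<Phi> n y) - f A)"
          by (intro continuous_on_diff continuous_on_const continuous_on_compose2[OF fJ[of UNIV]]
              continuous_on_subset[OF cont]) auto
      qed
      then show "?q n \<in> borel_measurable lborel" by simp
    qed
    have "bounded ?H" by (rule bounded_subset[OF bounded_ball[of 0 3]]) auto
    then have "?H \<in> lmeasurable" using op by (rule lmeasurable_open)
    then have "integrable lebesgue (indicator ?H :: _ \<Rightarrow> real)" by (simp only: lmeasurable_iff_integrable)
    then show "integrable lebesgue (\<lambda>y. indicator ?H y * (C + \<bar>f A\<bar>))" by (rule integrable_mult_left)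
    show "AE y in lebesgue. norm (?q n y) \<le> indicator ?H y * (C + \<bar>f A\<bar>)" for n
    proof (rule AE_I2)
      fix y
      show "norm (?q n y) \<le> indicator ?H y * (C + \<bar>f A\<bar>)"
        using C[OF DL[OF L[of n y]]] by (cases "y \<in> ?H") (auto simp: abs_le_iff)
    qed
    have "AE y in lebesgue. y \<notin> sphere (0::real^'d) 1"
      by (rule AE_not_in) (simp only: negligible_iff_null_sets[symmetric] negligible_sphere)
    with lim show "AE y in lebesgue. (\<lambda>n. ?q n y) \<longlonglongrightarrow> indicator ?D y *\<^sub>R (f (A + J ** ?G y) - f A)"
    proof eventually_elim
      case (elim y)
      have comp: "(\<lambda>n. f (A + J ** D\<Phi> n y)) \<longlonglongrightarrow> f (A + J ** X)" if "(\<lambda>n. D\<Phi> n y) \<longlonglongrightarrow> X" for X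
        by (rule continuous_on_tendsto_compose[OF fJ[of UNIV] that]) auto
      consider "y \<in> ?D" | "y \<notin> ?H" | "y \<in> ?H" "1 < norm y"
        using elim(2) by (fastforce simp: half_ball_def)
      then show ?case
      proof cases
        case 1
        with elim(1) have "(\<lambda>n. f (A + J ** D\<Phi> n y) - f A) \<longlonglongrightarrow> f (A + J ** ?G y) - f A"
          by (intro tendsto_diff comp tendsto_const) simp
        then show ?thesis using 1 DH[OF 1] by simp
      next
        case 2
        then have "y \<notin> ?D" using DH by blast
        then show ?thesis using 2 by simp
      next
        case 3
        have "(\<lambda>n. f (A + J ** D\<Phi> n y) - f A) \<longlonglongrightarrow> f (A + J ** 0) - f A"
          by (intro tendsto_diff comp tendsto_const lim0 3)
        moreover have "y \<notin> ?D" using 3 by (simp add: half_ball_def)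
        ultimately show ?thesis using 3(1) by simp
      qed
    qed
  qed
  moreover have "0 \<le> (\<integral>y. ?q n y \<partial>lebesgue)" for n
    by (rule C1[OF field])
  ultimately have "0 \<le> (\<integral>y. indicator ?D y *\<^sub>R (f (A + J ** ?G y) - f A) \<partial>lebesgue)"
    by (intro LIMSEQ_le_const) auto
  then show ?thesis
  proof (rule average_over_half_ball[OF \<nu> fG, rotated])
    show "AE y in lebesgue. y \<in> ?D \<longrightarrow> \<bar>f (A + J ** ?G y)\<bar> \<le> C"
      using G_bd by eventually_elim (use C in auto)
  qed
qed

theorem theorem14:
  fixes \<Omega> \<Gamma>1 \<Gamma>2 :: "(real^'d) set"
    and M U :: "(real^'k) set"
    and P :: "real^'k \<Rightarrow> real^'k"
    and F :: "real^'d \<Rightarrow> real^'k \<Rightarrow> real^'d^'k \<Rightarrow> real"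
    and n0 n :: "real^'d \<Rightarrow> real^'k"
    and Dn :: "real^'d \<Rightarrow> real^'d^'k"
    and \<nu> :: "real^'d \<Rightarrow> real^'d"
  assumes "bounded_lipschitz_domain \<Omega>"
    and "openin (top_of_set (frontier \<Omega>)) \<Gamma>1" and "openin (top_of_set (frontier \<Omega>)) \<Gamma>2"
    and "\<Gamma>1 \<in> sets (hausdorff_measure (CARD('d) - 1))"
    and "\<Gamma>2 \<in> sets (hausdorff_measure (CARD('d) - 1))"
    and "\<Gamma>1 \<inter> \<Gamma>2 = {}"
    and "frontier \<Omega> = closure \<Gamma>1 \<union> closure \<Gamma>2"
    and "closed M" and "bounded M" and "submanifold_of_class 4 M"
    and "open U" and "M \<subseteq> U"
    and "nearest_point_projection M U P" and "higher_differentiable_on 3 P U"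
    and "continuous_on (closure \<Omega> \<times> M \<times> UNIV) (\<lambda>(x, u, A). F x u A)"
    and "n0 \<in> W11_into \<Omega> M"
    and "C1_closure_gradient \<Omega> n Dn" and "n ` closure \<Omega> \<subseteq> M"
    and "strong_local_minimizer F \<Omega> (admissible \<Omega> M \<Gamma>1 n0) n"
    and "\<And>x. x \<in> \<Gamma>2 \<Longrightarrow> boundary_C1_at \<Omega> x \<Longrightarrow> exterior_unit_normal \<Omega> x (\<nu> x)"
  shows "AE x in hausdorff_measure (CARD('d) - 1).
    x \<in> \<Gamma>2 \<and> boundary_C1_at \<Omega> x \<longrightarrow>
      (\<forall>\<phi> \<in> W1inf (half_ball (\<nu> x)).
         vanishes_on_boundary_part (half_ball (\<nu> x)) (frontier (ball 0 1) \<inter> frontier (half_ball (\<nu> x))) \<phi> \<longrightarrow>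
         F x (n x) (Dn x) \<le>
           1 / measure lebesgue (half_ball (\<nu> x)) *
           (LINT y:half_ball (\<nu> x)|lebesgue.
              F x (n x) (Dn x + jacobian P (at (n x)) ** weak_gradient (half_ball (\<nu> x)) \<phi> y)))"
proof (rule AE_I2, intro impI ballI)
  fix x and \<phi> :: "real^'d \<Rightarrow> real^'k"
  assume x: "x \<in> \<Gamma>2 \<and> boundary_C1_at \<Omega> x" and \<phi>: "\<phi> \<in> W1inf (half_ball (\<nu> x))"
    and van: "vanishes_on_boundary_part (half_ball (\<nu> x)) (frontier (ball 0 1) \<inter> frontier (half_ball (\<nu> x))) \<phi>"
  have \<Omega>: "open \<Omega>" "bounded \<Omega>" using assms(1) unfolding bounded_lipschitz_domain_def by blast+
  have ext: "exterior_unit_normal \<Omega> x (\<nu> x)" using assms(20) x by blast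
  have \<Gamma>1: "\<Gamma>1 \<subseteq> frontier \<Omega>" using assms(2) by (rule openin_imp_subset)
  obtain r where r: "r > 0" "ball x r \<inter> frontier \<Omega> \<subseteq> \<Gamma>2"
    using assms(3) x unfolding openin_contains_ball by blast
  have disj: "\<Gamma>1 \<inter> ball x r = {}" using \<Gamma>1 r(2) assms(6) by blast
  have \<Gamma>1cl: "\<Gamma>1 \<subseteq> closure \<Omega>" using \<Gamma>1 by (auto simp: frontier_def)
  have xcl: "x \<in> closure \<Omega>" using ext unfolding exterior_unit_normal_def frontier_def by blast
  have nx: "n x \<in> M" using assms(18) xcl by blast
  have hd: "higher_differentiable_on (Suc (Suc 1)) P U" using assms(14) by (simp only: numeral_3_eq_3 One_nat_def)
  have inst: "projected_variation \<Omega> M U P F n Dn x \<Phi> D\<Phi>"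
    if "C1_field \<Phi> D\<Phi>" for \<Phi> D\<Phi>
  proof
    show "open \<Omega>" "bounded \<Omega>" by fact+
    show "compact M" using assms(8,9) by (simp add: compact_eq_bounded_closed)
    show "open U" "M \<subseteq> U" by fact+
    show "P u \<in> M" if "u \<in> U" for u using assms(13) that unfolding nearest_point_projection_def by blast
    show "P u = u" if "u \<in> M" for u using nearest_point_projection_fixes[OF assms(13,12) that] .
    show "(P has_derivative (\<lambda>h. jacobian P (at u) *v h)) (at u)" if "u \<in> U" for u
      by (rule higher_differentiable_jacobian(1)[OF hd that])
    show "continuous_on U (\<lambda>u. jacobian P (at u))" by (rule higher_differentiable_jacobian(2)[OF hd])
    show "continuous_on (closure \<Omega> \<times> M \<times> UNIV) (\<lambda>(x, u, A). F x u A)" by fact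
    show "C1_closure_gradient \<Omega> n Dn" "n ` closure \<Omega> \<subseteq> M" by fact+
    show "x \<in> closure \<Omega>" by fact
    show "C1_field \<Phi> D\<Phi>" by fact
  qed
  have Fc: "continuous_on UNIV (F x (n x))"
  proof -
    have "continuous_on UNIV (\<lambda>A. (\<lambda>(x, u, A). F x u A) (x, n x, A))"
      by (rule continuous_on_compose2[OF assms(15)])
         (use xcl nx in \<open>auto intro!: continuous_on_Pair continuous_on_const continuous_on_id\<close>)
    then show ?thesis by simp
  qed
  show "F x (n x) (Dn x) \<le> 1 / measure lebesgue (half_ball (\<nu> x)) *
      (LINT y:half_ball (\<nu> x)|lebesgue. F x (n x) (Dn x + jacobian P (at (n x)) ** weak_gradient (half_ball (\<nu> x)) \<phi> y))"
  proof (rule half_ball_inequality_by_approximation[OF Fc exterior_unit_normal_ray(1)[OF \<Omega>(1) ext] \<phi> van])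
    fix \<Phi> :: "real^'d \<Rightarrow> real^'k" and D\<Phi>
    assume *: "C1_field \<Phi> D\<Phi>"
    interpret projected_variation \<Omega> M U P F n Dn x \<Phi> D\<Phi> by (rule inst[OF *])
    show "0 \<le> (\<integral>y. indicator {y \<in> ball 0 3. y \<bullet> \<nu> x < 0} y *\<^sub>R
        (F x (n x) (Dn x + jacobian P (at (n x)) ** D\<Phi> y) - F x (n x) (Dn x)) \<partial>lebesgue)"
      by (rule blow_up_inequality[OF assms(19) \<Gamma>1cl disj r(1) ext])
  qed
qed

end
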